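(* Let $\mathcal{E}$ be a category with pullbacks. There is a bicategory $\mathbf{Poly}_{\mathcal{E}}$ whose objects are those of $\mathcal{E}$, whose hom category from $X$ to $Y$ is the category $\mathbf{Poly}_{\mathcal{E}}(X,Y)$ of polynomials from $X$ to $Y$ and cartesian morphisms between them, whose identity on $X$ is the polynomial $X \xleftarrow{1_X} X \xrightarrow{1_X} X \xrightarrow{1_X} X$, whose horizontal composition of 1-cells is the composition of polynomials, and whose horizontal composition of 2-cells is the horizontal composition of cartesian morphisms, both as defined (by means of terminal subdivided composites) in the context.
   Context: For $f:X\to Y$ in a category $\mathcal{E}$ with pullbacks, $\Sigma_f:\mathcal{E}/X\to\mathcal{E}/Y$ is composition with $f$, $\Delta_f:\mathcal{E}/Y\to\mathcal{E}/X$ is its right adjoint (pulling back along $f$), and $f$ is exponentiable when $\Delta_f$ has a right adjoint $\Pi_f$. Exponentiable maps are closed under composition and stable under pullback. A polynomial $p$ from $X$ to $Y$ in $\mathcal{E}$ is a diagram $X\xleftarrow{p_1}A\xrightarrow{p_2}B\xrightarrow{p_3}Y$ with $p_2$ exponentiable. A cartesian morphism $f:p\to q$, where $q$ is $X\xleftarrow{q_1}A'\xrightarrow{q_2}B'\xrightarrow{q_3}Y$, is a pair $f_0:A\to A'$, $f_1:B\to B'$ with $q_1f_0=p_1$, $q_3f_1=p_3$, $q_2f_0=f_1p_2$, the last commutative square being a pullback. These form the category $\mathbf{Poly}_{\mathcal{E}}(X,Y)$, with composition as in $\mathcal{E}$. Subdivided composites. Let $n\geq 1$ and let $p_i = (X_{i-1}\xleftarrow{p_{i1}}A_i\xrightarrow{p_{i2}}B_i\xrightarrow{p_{i3}}X_i)$,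 $1\leq i\leq n$, be a composable sequence of polynomials. A subdivided composite $(Y,q,r,s)$ over $(p_i)_i$ consists of objects $Y_0,\dots,Y_n$ and morphisms $q_1:Y_0\to X_0$, $q_{2,i}:Y_{i-1}\to Y_i$, $q_3:Y_n\to X_n$, $r_i:Y_{i-1}\to A_i$, $s_i:Y_i\to B_i$ (for $0<i\leq n$) such that $p_{11}r_1=q_1$, $p_{n3}s_n=q_3$, $p_{i+1,1}r_{i+1}=p_{i3}s_i$ for $0<i<n$, and for $0<i\le n$ the square $s_iq_{2,i}=p_{i2}r_i$ commutes and is a pullback. A morphism $(Y,q,r,s)\to(Y',q',r',s')$ consists of morphisms $t_i:Y_i\to Y'_i$ ($0\leq i\leq n$) with $q_1=q'_1t_0$, $q'_{2,i}t_{i-1}=t_iq_{2,i}$, $q_3=q'_3t_n$, $r_i=r'_it_{i-1}$, $s_i=s'_it_i$. This gives a category $\mathrm{SdC}(p_i)_i$. The associated polynomial of $(Y,q,r,s)$ is $X_0\xleftarrow{q_1}Y_0\xrightarrow{q_2}Y_n\xrightarrow{q_3}X_n$ with $q_2=q_{2,n}\cdots q_{2,1}$; this is the object map of a functor $\mathrm{ass}:\mathrm{SdC}(p_i)_i\to\mathbf{Poly}_{\mathcal{E}}(X_0,X_n)$, sending $(t_i)_i$ to $(t_0,t_n)$. Composition of 1-cells. A composite $p_n\circ\cdots\circ p_1$ is the associated polynomial of a (chosen) terminal object of $\mathrm{SdC}(p_i)_i$. For $n=2$ such a terminal object is constructed as follows: form the pullback $P=B_1\times_{X_1}A_2$ of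 $p_{13}$ and $p_{21}$ with projections $\pi_1:P\to B_1$, $\pi_2:P\to A_2$; form the distributivity pullback $(\varepsilon:F\to P,\ e:F\to G,\ r:G\to B_2)$ around $(p_{22},\pi_2)$; form the pullback $H$ of $p_{12}$ and $\pi_1\varepsilon:F\to B_1$; then $Y_0=H$, $Y_1=F$, $Y_2=G$ with the evident maps. (A distributivity pullback around composable maps $(f:A\to B,\ g:Z\to A)$ is a terminal object in the category whose objects are triples $(p:X\to Z,\ q:X\to Y,\ r:Y\to B)$ for which $fgp=rq$ is a pullback square exhibiting $X$ as the pullback of $f$ and $r$, with morphisms $(p,q,r)\to(p',q',r')$ the pairs $s:X\to X'$, $t:Y\to Y'$ such that $p's=p$, $q's=tq$, $r't=r$; it exists when $f$ is exponentiable.) Horizontal composition of 2-cells. Given cartesian morphisms $(f_{0i},f_{1i}):p_i\to q_i$ between polynomials from $X_{i-1}$ to $X_i$, postcomposing the $r_i$ with $f_{0i}$ and the $s_i$ with $f_{1i}$ gives a functor $\mathrm{SdC}(f_{0i},f_{1i})_i:\mathrm{SdC}(p_i)_i\to\mathrm{SdC}(q_i)_i$ compatible with the functors $\mathrm{ass}$. If $t_1,t_2$ are the chosen terminal objects of $\mathrm{SdC}(p_i)_i$ and $\mathrm{SdC}(q_i)_i$, and $u:\mathrm{SdC}(f_{0i},f_{1i})_i(t_1)\to t_2$ is the unique morphism, then $f_n\circ\cdots\circ f_1:p_n\circ\cdots\circ p_1\to q_n\circ\cdots\circ q_1$ is defined to be $\mathrm{ass}(u)$. In a bicategory only the case $n=2$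 is needed. *)

theory Defs
  imports Main
begin

section \<open>Categories, functors, adjunctions\<close>

text \<open>Objects and arrows are carrier sets in two types; all operations are only meaningful
  on the carriers. Composition is in function order.\<close>

record ('o, 'm) precat =
  Obj :: "'o set"
  Arr :: "'m set"
  Dom :: "'m \<Rightarrow> 'o"
  Cod :: "'m \<Rightarrow> 'o"
  Ident :: "'o \<Rightarrow> 'm"
  Comp :: "'m \<Rightarrow> 'm \<Rightarrow> 'm" (infixr "\<cdot>\<index>" 70)

definition hom :: "('o, 'm) precat \<Rightarrow> 'o \<Rightarrow> 'o \<Rightarrow> 'm set" where
  "hom C a b = {f \<in> Arr C. Dom C f = a \<and> Cod C f = b}"

locale category =
  fixes C :: "('o, 'm) precat" (structure)
  assumes dom_obj: "f \<in> Arr C \<Longrightarrow> Dom C f \<in> Obj C"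
    and cod_obj: "f \<in> Arr C \<Longrightarrow> Cod C f \<in> Obj C"
    and ident_hom: "a \<in> Obj C \<Longrightarrow> Ident C a \<in> hom C a a"
    and comp_hom: "f \<in> hom C a b \<Longrightarrow> g \<in> hom C b c \<Longrightarrow> g \<cdot> f \<in> hom C a c"
    and comp_ident: "f \<in> hom C a b \<Longrightarrow> f \<cdot> Ident C a = f"
    and ident_comp: "f \<in> hom C a b \<Longrightarrow> Ident C b \<cdot> f = f"
    and comp_assoc: "f \<in> hom C a b \<Longrightarrow> g \<in> hom C b c \<Longrightarrow> h \<in> hom C c d \<Longrightarrow>
          (h \<cdot> g) \<cdot> f = h \<cdot> (g \<cdot> f)"

definition is_iso :: "('o, 'm) precat \<Rightarrow> 'm \<Rightarrow> bool" where
  "is_iso C f \<longleftrightarrow> f \<in> Arr C \<and>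
     (\<exists>g \<in> hom C (Cod C f) (Dom C f).
        g \<cdot>\<^bsub>C\<^esub> f = Ident C (Dom C f) \<and> f \<cdot>\<^bsub>C\<^esub> g = Ident C (Cod C f))"

definition terminal :: "('o, 'm) precat \<Rightarrow> 'o \<Rightarrow> bool" where
  "terminal C t \<longleftrightarrow> t \<in> Obj C \<and> (\<forall>a \<in> Obj C. \<exists>!f. f \<in> hom C a t)"

definition prod_cat ::
  "('o1, 'm1) precat \<Rightarrow> ('o2, 'm2) precat \<Rightarrow> ('o1 \<times> 'o2, 'm1 \<times> 'm2) precat" where
  "prod_cat C D =
    \<lparr> Obj = Obj C \<times> Obj D,
      Arr = Arr C \<times> Arr D,
      Dom = (\<lambda>(f, g). (Dom C f, Dom D g)),
      Cod = (\<lambda>(f, g). (Cod C f, Cod D g)),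
      Ident = (\<lambda>(a, b). (Ident C a, Ident D b)),
      Comp = (\<lambda>(f', g') (f, g). (f' \<cdot>\<^bsub>C\<^esub> f, g' \<cdot>\<^bsub>D\<^esub> g)) \<rparr>"

record ('o1, 'm1, 'o2, 'm2) ftor =
  fob :: "'o1 \<Rightarrow> 'o2"
  far :: "'m1 \<Rightarrow> 'm2"

locale cat_functor = C: category C + D: category D
  for C :: "('o1, 'm1) precat" and D :: "('o2, 'm2) precat"
    and F :: "('o1, 'm1, 'o2, 'm2) ftor" +
  assumes fob_obj: "a \<in> Obj C \<Longrightarrow> fob F a \<in> Obj D"
    and far_hom: "f \<in> hom C a b \<Longrightarrow> far F f \<in> hom D (fob F a) (fob F b)"
    and far_ident: "a \<in> Obj C \<Longrightarrow> far F (Ident C a) = Ident D (fob F a)"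
    and far_comp: "f \<in> hom C a b \<Longrightarrow> g \<in> hom C b c \<Longrightarrow>
          far F (g \<cdot>\<^bsub>C\<^esub> f) = far F g \<cdot>\<^bsub>D\<^esub> far F f"

text \<open>\<open>F : C \<rightarrow> D\<close> is left adjoint to \<open>G : D \<rightarrow> C\<close>: natural bijections
  \<open>D(F a, b) \<cong> C(a, G b)\<close>.\<close>

definition adjoint ::
  "('o1, 'm1) precat \<Rightarrow> ('o2, 'm2) precat \<Rightarrow>
   ('o1, 'm1, 'o2, 'm2) ftor \<Rightarrow> ('o2, 'm2, 'o1, 'm1) ftor \<Rightarrow> bool" where
  "adjoint C D F G \<longleftrightarrow> cat_functor C D F \<and> cat_functor D C G \<and>
    (\<exists>\<phi>. (\<forall>a \<in> Obj C. \<forall>b \<in> Obj D. bij_betw (\<phi> a b) (hom D (fob F a) b) (hom C a (fob G b))) \<and>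
         (\<forall>a \<in> Obj C. \<forall>a' \<in> Obj C. \<forall>b \<in> Obj D. \<forall>b' \<in> Obj D.
           \<forall>x \<in> hom C a' a. \<forall>y \<in> hom D b b'. \<forall>g \<in> hom D (fob F a) b.
             \<phi> a' b' (y \<cdot>\<^bsub>D\<^esub> (g \<cdot>\<^bsub>D\<^esub> far F x)) =
               far G y \<cdot>\<^bsub>C\<^esub> (\<phi> a b g \<cdot>\<^bsub>C\<^esub> x)))"

section \<open>Pullbacks and exponentiable maps\<close>

text \<open>\<open>(p, q)\<close> is a pullback of the cospan \<open>(f, g)\<close>, with \<open>f p = g q\<close>.\<close>

definition is_pullback :: "('o, 'm) precat \<Rightarrow> 'm \<Rightarrow> 'm \<Rightarrow> 'm \<Rightarrow> 'm \<Rightarrow> bool" where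
  "is_pullback C f g p q \<longleftrightarrow>
     f \<in> Arr C \<and> g \<in> Arr C \<and> p \<in> Arr C \<and> q \<in> Arr C \<and>
     Cod C f = Cod C g \<and> Dom C p = Dom C q \<and> Cod C p = Dom C f \<and> Cod C q = Dom C g \<and>
     f \<cdot>\<^bsub>C\<^esub> p = g \<cdot>\<^bsub>C\<^esub> q \<and>
     (\<forall>z \<in> Obj C. \<forall>u \<in> hom C z (Dom C f). \<forall>v \<in> hom C z (Dom C g).
        f \<cdot>\<^bsub>C\<^esub> u = g \<cdot>\<^bsub>C\<^esub> v \<longrightarrow>
        (\<exists>!h. h \<in> hom C z (Dom C p) \<and> p \<cdot>\<^bsub>C\<^esub> h = u \<and> q \<cdot>\<^bsub>C\<^esub> h = v))"

definition has_pullbacks :: "('o, 'm) precat \<Rightarrow> bool" where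
  "has_pullbacks C \<longleftrightarrow>
     (\<forall>f \<in> Arr C. \<forall>g \<in> Arr C. Cod C f = Cod C g \<longrightarrow> (\<exists>p q. is_pullback C f g p q))"

text \<open>An arrow of the slice is \<open>(a, b, h)\<close> with source \<open>a\<close>, target \<open>b\<close>
  and underlying arrow \<open>h\<close>.\<close>

definition slice :: "('o, 'm) precat \<Rightarrow> 'o \<Rightarrow> ('m, 'm \<times> 'm \<times> 'm) precat" where
  "slice C X =
    \<lparr> Obj = {a \<in> Arr C. Cod C a = X},
      Arr = {(a, b, h). a \<in> Arr C \<and> b \<in> Arr C \<and> Cod C a = X \<and> Cod C b = X \<and>
                        h \<in> hom C (Dom C a) (Dom C b) \<and> b \<cdot>\<^bsub>C\<^esub> h = a},
      Dom = (\<lambda>(a, b, h). a),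
      Cod = (\<lambda>(a, b, h). b),
      Ident = (\<lambda>a. (a, a, Ident C (Dom C a))),
      Comp = (\<lambda>(b', c, k) (a, b, h). (a, c, k \<cdot>\<^bsub>C\<^esub> h)) \<rparr>"

definition slice_sum ::
  "('o, 'm) precat \<Rightarrow> 'm \<Rightarrow> ('m, 'm \<times> 'm \<times> 'm, 'm, 'm \<times> 'm \<times> 'm) ftor" where
  "slice_sum C f =
    \<lparr> fob = (\<lambda>a. f \<cdot>\<^bsub>C\<^esub> a),
      far = (\<lambda>(a, b, h). (f \<cdot>\<^bsub>C\<^esub> a, f \<cdot>\<^bsub>C\<^esub> b, h)) \<rparr>"

text \<open>\<open>\<Delta>\<close> is only determined up to isomorphism, as a right adjoint of \<^const>\<open>slice_sum\<close>
  (given by any choice of pullbacks along \<open>f\<close>); having a right adjoint does not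
  depend on which one is taken.\<close>

definition exponentiable :: "('o, 'm) precat \<Rightarrow> 'm \<Rightarrow> bool" where
  "exponentiable C f \<longleftrightarrow> f \<in> Arr C \<and>
     (\<exists>\<Delta> \<Pi>. adjoint (slice C (Dom C f)) (slice C (Cod C f)) (slice_sum C f) \<Delta> \<and>
            adjoint (slice C (Cod C f)) (slice C (Dom C f)) \<Delta> \<Pi>)"

section \<open>Polynomials and cartesian morphisms\<close>

text \<open>The objects in \<open>X \<leftarrow> A \<rightarrow> B \<rightarrow> Y\<close> are recovered as domains and codomains of the arrows.\<close>

record 'm polynomial =
  poly1 :: 'm
  poly2 :: 'm
  poly3 :: 'm

definition is_polynomial :: "('o, 'm) precat \<Rightarrow> 'o \<Rightarrow> 'o \<Rightarrow> 'm polynomial \<Rightarrow> bool" where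
  "is_polynomial E X Y p \<longleftrightarrow>
     poly1 p \<in> Arr E \<and> poly3 p \<in> Arr E \<and> exponentiable E (poly2 p) \<and>
     Cod E (poly1 p) = X \<and> Dom E (poly1 p) = Dom E (poly2 p) \<and>
     Cod E (poly2 p) = Dom E (poly3 p) \<and> Cod E (poly3 p) = Y"

record 'm cart_mor =
  csrc :: "'m polynomial"
  ctgt :: "'m polynomial"
  cart0 :: 'm
  cart1 :: 'm

definition is_cart_mor :: "('o, 'm) precat \<Rightarrow> 'm cart_mor \<Rightarrow> bool" where
  "is_cart_mor E f \<longleftrightarrow>
     (let p = csrc f; q = ctgt f; f0 = cart0 f; f1 = cart1 f in
       f0 \<in> hom E (Dom E (poly2 p)) (Dom E (poly2 q)) \<and>
       f1 \<in> hom E (Cod E (poly2 p)) (Cod E (poly2 q)) \<and>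
       poly1 q \<cdot>\<^bsub>E\<^esub> f0 = poly1 p \<and>
       poly3 q \<cdot>\<^bsub>E\<^esub> f1 = poly3 p \<and>
       is_pullback E (poly2 q) f1 f0 (poly2 p))"

definition Poly ::
  "('o, 'm) precat \<Rightarrow> 'o \<Rightarrow> 'o \<Rightarrow> ('m polynomial, 'm cart_mor) precat" where
  "Poly E X Y =
    \<lparr> Obj = {p. is_polynomial E X Y p},
      Arr = {f. is_polynomial E X Y (csrc f) \<and> is_polynomial E X Y (ctgt f) \<and> is_cart_mor E f},
      Dom = csrc,
      Cod = ctgt,
      Ident = (\<lambda>p. \<lparr> csrc = p, ctgt = p, cart0 = Ident E (Dom E (poly2 p)),
                     cart1 = Ident E (Cod E (poly2 p)) \<rparr>),
      Comp = (\<lambda>g f. \<lparr> csrc = csrc f, ctgt = ctgt g, cart0 = cart0 g \<cdot>\<^bsub>E\<^esub> cart0 f,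
                       cart1 = cart1 g \<cdot>\<^bsub>E\<^esub> cart1 f \<rparr>) \<rparr>"

definition poly_ident :: "('o, 'm) precat \<Rightarrow> 'o \<Rightarrow> 'm polynomial" where
  "poly_ident E X = \<lparr> poly1 = Ident E X, poly2 = Ident E X, poly3 = Ident E X \<rparr>"

section \<open>Subdivided composites\<close>

text \<open>A sequence \<open>p\<^sub>1, \<dots>, p\<^sub>n\<close> (applied in this order) is a list, so \<open>ps ! i\<close> is
  \<open>p\<^bsub>i+1\<^esub>\<close>. Likewise \<open>sY ! i\<close> is \<open>Y\<^sub>i\<close>, whereas \<open>sq2 ! i\<close>, \<open>sr ! i\<close>, \<open>ss ! i\<close> are
  \<open>q\<^bsub>2,i+1\<^esub>\<close>, \<open>r\<^bsub>i+1\<^esub>\<close>, \<open>s\<^bsub>i+1\<^esub>\<close>.\<close>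

definition composable :: "('o, 'm) precat \<Rightarrow> 'm polynomial list \<Rightarrow> bool" where
  "composable E ps \<longleftrightarrow> ps \<noteq> [] \<and>
     (\<forall>p \<in> set ps. \<exists>X Y. is_polynomial E X Y p) \<and>
     (\<forall>i. Suc i < length ps \<longrightarrow> Cod E (poly3 (ps ! i)) = Cod E (poly1 (ps ! Suc i)))"

record ('o, 'm) sdc =
  sY :: "'o list"
  sq1 :: 'm
  sq2 :: "'m list"
  sq3 :: 'm
  sr :: "'m list"
  ss :: "'m list"

definition is_sdc :: "('o, 'm) precat \<Rightarrow> 'm polynomial list \<Rightarrow> ('o, 'm) sdc \<Rightarrow> bool" where
  "is_sdc E ps S \<longleftrightarrow>
     (let n = length ps in
       length (sY S) = Suc n \<and> length (sq2 S) = n \<and> length (sr S) = n \<and> length (ss S) = n \<and>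
       set (sY S) \<subseteq> Obj E \<and>
       sq1 S \<in> hom E (sY S ! 0) (Cod E (poly1 (hd ps))) \<and>
       sq3 S \<in> hom E (sY S ! n) (Cod E (poly3 (last ps))) \<and>
       (\<forall>i<n. sq2 S ! i \<in> hom E (sY S ! i) (sY S ! Suc i) \<and>
              sr S ! i \<in> hom E (sY S ! i) (Dom E (poly2 (ps ! i))) \<and>
              ss S ! i \<in> hom E (sY S ! Suc i) (Cod E (poly2 (ps ! i)))) \<and>
       poly1 (hd ps) \<cdot>\<^bsub>E\<^esub> hd (sr S) = sq1 S \<and>
       poly3 (last ps) \<cdot>\<^bsub>E\<^esub> last (ss S) = sq3 S \<and>
       (\<forall>i. Suc i < n \<longrightarrow>
          poly1 (ps ! Suc i) \<cdot>\<^bsub>E\<^esub> (sr S ! Suc i) = poly3 (ps ! i) \<cdot>\<^bsub>E\<^esub> (ss S ! i)) \<and>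
       (\<forall>i<n. is_pullback E (poly2 (ps ! i)) (ss S ! i) (sr S ! i) (sq2 S ! i)))"

record ('o, 'm) sdc_mor =
  tsrc :: "('o, 'm) sdc"
  ttgt :: "('o, 'm) sdc"
  tarr :: "'m list"

definition is_sdc_mor :: "('o, 'm) precat \<Rightarrow> nat \<Rightarrow> ('o, 'm) sdc_mor \<Rightarrow> bool" where
  "is_sdc_mor E n f \<longleftrightarrow>
     (let S = tsrc f; S' = ttgt f; t = tarr f in
       length t = Suc n \<and>
       (\<forall>i\<le>n. t ! i \<in> hom E (sY S ! i) (sY S' ! i)) \<and>
       sq1 S = sq1 S' \<cdot>\<^bsub>E\<^esub> (t ! 0) \<and>
       sq3 S = sq3 S' \<cdot>\<^bsub>E\<^esub> (t ! n) \<and>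
       (\<forall>i<n. (sq2 S' ! i) \<cdot>\<^bsub>E\<^esub> (t ! i) = (t ! Suc i) \<cdot>\<^bsub>E\<^esub> (sq2 S ! i) \<and>
              sr S ! i = (sr S' ! i) \<cdot>\<^bsub>E\<^esub> (t ! i) \<and>
              ss S ! i = (ss S' ! i) \<cdot>\<^bsub>E\<^esub> (t ! Suc i)))"

definition SdC ::
  "('o, 'm) precat \<Rightarrow> 'm polynomial list \<Rightarrow> (('o, 'm) sdc, ('o, 'm) sdc_mor) precat" where
  "SdC E ps =
    \<lparr> Obj = {S. is_sdc E ps S},
      Arr = {f. is_sdc E ps (tsrc f) \<and> is_sdc E ps (ttgt f) \<and> is_sdc_mor E (length ps) f},
      Dom = tsrc,
      Cod = ttgt,
      Ident = (\<lambda>S. \<lparr> tsrc = S, ttgt = S, tarr = map (Ident E) (sY S) \<rparr>),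
      Comp = (\<lambda>g f. \<lparr> tsrc = tsrc f, ttgt = ttgt g,
                       tarr = map2 (\<lambda>b a. b \<cdot>\<^bsub>E\<^esub> a) (tarr g) (tarr f) \<rparr>) \<rparr>"

text \<open>The middle map is \<open>q\<^bsub>2,n\<^esub> \<cdots> q\<^bsub>2,1\<^esub>\<close>.\<close>

definition ass_poly :: "('o, 'm) precat \<Rightarrow> ('o, 'm) sdc \<Rightarrow> 'm polynomial" where
  "ass_poly E S =
    \<lparr> poly1 = sq1 S,
      poly2 = foldl (\<lambda>a b. b \<cdot>\<^bsub>E\<^esub> a) (hd (sq2 S)) (tl (sq2 S)),
      poly3 = sq3 S \<rparr>"

definition ass ::
  "('o, 'm) precat \<Rightarrow> (('o, 'm) sdc, ('o, 'm) sdc_mor, 'm polynomial, 'm cart_mor) ftor" where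
  "ass E =
    \<lparr> fob = ass_poly E,
      far = (\<lambda>f. \<lparr> csrc = ass_poly E (tsrc f), ctgt = ass_poly E (ttgt f),
                   cart0 = hd (tarr f), cart1 = last (tarr f) \<rparr>) \<rparr>"

text \<open>The functor from subdivided composites over \<open>map csrc fs\<close> to those over
  \<open>map ctgt fs\<close> induced by a list \<open>fs\<close> of cartesian morphisms.\<close>

definition sdc_push :: "('o, 'm) precat \<Rightarrow> 'm cart_mor list \<Rightarrow> ('o, 'm) sdc \<Rightarrow> ('o, 'm) sdc" where
  "sdc_push E fs S =
     S \<lparr> sr := map2 (\<lambda>f r. cart0 f \<cdot>\<^bsub>E\<^esub> r) fs (sr S),
         ss := map2 (\<lambda>f s. cart1 f \<cdot>\<^bsub>E\<^esub> s) fs (ss S) \<rparr>"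

definition sdc_functor ::
  "('o, 'm) precat \<Rightarrow> 'm cart_mor list \<Rightarrow>
   (('o, 'm) sdc, ('o, 'm) sdc_mor, ('o, 'm) sdc, ('o, 'm) sdc_mor) ftor" where
  "sdc_functor E fs =
    \<lparr> fob = sdc_push E fs,
      far = (\<lambda>t. \<lparr> tsrc = sdc_push E fs (tsrc t), ttgt = sdc_push E fs (ttgt t),
                   tarr = tarr t \<rparr>) \<rparr>"

section \<open>Composition of polynomials\<close>

text \<open>\<open>T\<close> assigns to each composable pair the chosen terminal subdivided composite.\<close>

definition terminal_choice ::
  "('o, 'm) precat \<Rightarrow> ('m polynomial list \<Rightarrow> ('o, 'm) sdc) \<Rightarrow> bool" where
  "terminal_choice E T \<longleftrightarrow>
     (\<forall>p1 p2. composable E [p1, p2] \<longrightarrow> terminal (SdC E [p1, p2]) (T [p1, p2]))"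

definition poly_comp ::
  "('o, 'm) precat \<Rightarrow> ('m polynomial list \<Rightarrow> ('o, 'm) sdc) \<Rightarrow> 'm polynomial list \<Rightarrow> 'm polynomial"
  where "poly_comp E T ps = fob (ass E) (T ps)"

definition cart_hcomp ::
  "('o, 'm) precat \<Rightarrow> ('m polynomial list \<Rightarrow> ('o, 'm) sdc) \<Rightarrow> 'm cart_mor list \<Rightarrow> 'm cart_mor"
  where
  "cart_hcomp E T fs =
     far (ass E)
       (THE u. u \<in> hom (SdC E (map ctgt fs))
                     (fob (sdc_functor E fs) (T (map csrc fs))) (T (map ctgt fs)))"

section \<open>Bicategories\<close>

text \<open>\<open>HComp B X Y Z\<close> takes the pair \<open>(g, f)\<close> of \<open>f : X \<rightarrow> Y\<close> and \<open>g : Y \<rightarrow> Z\<close> to their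
  composite from \<open>X\<close> to \<open>Z\<close>, and \<open>Assoc B W X Y Z h g f\<close> goes from \<open>(h g) f\<close> to \<open>h (g f)\<close>.\<close>

record ('o, 'c, 'd) prebicat =
  Obj0 :: "'o set"
  HomCat :: "'o \<Rightarrow> 'o \<Rightarrow> ('c, 'd) precat"
  Unit :: "'o \<Rightarrow> 'c"
  HComp :: "'o \<Rightarrow> 'o \<Rightarrow> 'o \<Rightarrow> ('c \<times> 'c, 'd \<times> 'd, 'c, 'd) ftor"
  Assoc :: "'o \<Rightarrow> 'o \<Rightarrow> 'o \<Rightarrow> 'o \<Rightarrow> 'c \<Rightarrow> 'c \<Rightarrow> 'c \<Rightarrow> 'd"
  LUnit :: "'o \<Rightarrow> 'o \<Rightarrow> 'c \<Rightarrow> 'd"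
  RUnit :: "'o \<Rightarrow> 'o \<Rightarrow> 'c \<Rightarrow> 'd"

locale bicategory =
  fixes B :: "('o, 'c, 'd) prebicat"
    and cells1 :: "'o \<Rightarrow> 'o \<Rightarrow> 'c set"
    and id2 :: "'o \<Rightarrow> 'o \<Rightarrow> 'c \<Rightarrow> 'd"
    and vc :: "'o \<Rightarrow> 'o \<Rightarrow> 'd \<Rightarrow> 'd \<Rightarrow> 'd"
    and hc1 :: "'o \<Rightarrow> 'o \<Rightarrow> 'o \<Rightarrow> 'c \<Rightarrow> 'c \<Rightarrow> 'c"
    and hc2 :: "'o \<Rightarrow> 'o \<Rightarrow> 'o \<Rightarrow> 'd \<Rightarrow> 'd \<Rightarrow> 'd"
  defines "cells1 X Y \<equiv> Obj (HomCat B X Y)"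
    and "id2 X Y \<equiv> Ident (HomCat B X Y)"
    and "vc X Y \<equiv> Comp (HomCat B X Y)"
    and "hc1 X Y Z g f \<equiv> fob (HComp B X Y Z) (g, f)"
    and "hc2 X Y Z b a \<equiv> far (HComp B X Y Z) (b, a)"
  assumes hom_category: "X \<in> Obj0 B \<Longrightarrow> Y \<in> Obj0 B \<Longrightarrow> category (HomCat B X Y)"
    and unit_cell: "X \<in> Obj0 B \<Longrightarrow> Unit B X \<in> cells1 X X"
    and hcomp_functor: "X \<in> Obj0 B \<Longrightarrow> Y \<in> Obj0 B \<Longrightarrow> Z \<in> Obj0 B \<Longrightarrow>
          cat_functor (prod_cat (HomCat B Y Z) (HomCat B X Y)) (HomCat B X Z) (HComp B X Y Z)"
    and assoc_hom: "\<lbrakk>W \<in> Obj0 B; X \<in> Obj0 B; Y \<in> Obj0 B; Z \<in> Obj0 B;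
            f \<in> cells1 W X; g \<in> cells1 X Y; h \<in> cells1 Y Z\<rbrakk> \<Longrightarrow>
          Assoc B W X Y Z h g f \<in>
            hom (HomCat B W Z) (hc1 W X Z (hc1 X Y Z h g) f) (hc1 W Y Z h (hc1 W X Y g f))"
    and assoc_iso: "\<lbrakk>W \<in> Obj0 B; X \<in> Obj0 B; Y \<in> Obj0 B; Z \<in> Obj0 B;
            f \<in> cells1 W X; g \<in> cells1 X Y; h \<in> cells1 Y Z\<rbrakk> \<Longrightarrow>
          is_iso (HomCat B W Z) (Assoc B W X Y Z h g f)"
    and assoc_natural: "\<lbrakk>W \<in> Obj0 B; X \<in> Obj0 B; Y \<in> Obj0 B; Z \<in> Obj0 B;
            a \<in> hom (HomCat B W X) f f'; b \<in> hom (HomCat B X Y) g g';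
            c \<in> hom (HomCat B Y Z) h h'\<rbrakk> \<Longrightarrow>
          vc W Z (Assoc B W X Y Z h' g' f') (hc2 W X Z (hc2 X Y Z c b) a) =
          vc W Z (hc2 W Y Z c (hc2 W X Y b a)) (Assoc B W X Y Z h g f)"
    and lunit_hom: "\<lbrakk>X \<in> Obj0 B; Y \<in> Obj0 B; f \<in> cells1 X Y\<rbrakk> \<Longrightarrow>
          LUnit B X Y f \<in> hom (HomCat B X Y) (hc1 X Y Y (Unit B Y) f) f"
    and lunit_iso: "\<lbrakk>X \<in> Obj0 B; Y \<in> Obj0 B; f \<in> cells1 X Y\<rbrakk> \<Longrightarrow>
          is_iso (HomCat B X Y) (LUnit B X Y f)"
    and lunit_natural: "\<lbrakk>X \<in> Obj0 B; Y \<in> Obj0 B; a \<in> hom (HomCat B X Y) f f'\<rbrakk> \<Longrightarrow>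
          vc X Y (LUnit B X Y f') (hc2 X Y Y (id2 Y Y (Unit B Y)) a) =
          vc X Y a (LUnit B X Y f)"
    and runit_hom: "\<lbrakk>X \<in> Obj0 B; Y \<in> Obj0 B; f \<in> cells1 X Y\<rbrakk> \<Longrightarrow>
          RUnit B X Y f \<in> hom (HomCat B X Y) (hc1 X X Y f (Unit B X)) f"
    and runit_iso: "\<lbrakk>X \<in> Obj0 B; Y \<in> Obj0 B; f \<in> cells1 X Y\<rbrakk> \<Longrightarrow>
          is_iso (HomCat B X Y) (RUnit B X Y f)"
    and runit_natural: "\<lbrakk>X \<in> Obj0 B; Y \<in> Obj0 B; a \<in> hom (HomCat B X Y) f f'\<rbrakk> \<Longrightarrow>
          vc X Y (RUnit B X Y f') (hc2 X X Y a (id2 X X (Unit B X))) =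
          vc X Y a (RUnit B X Y f)"
    and pentagon: "\<lbrakk>V \<in> Obj0 B; W \<in> Obj0 B; X \<in> Obj0 B; Y \<in> Obj0 B; Z \<in> Obj0 B;
            f \<in> cells1 V W; g \<in> cells1 W X; h \<in> cells1 X Y; k \<in> cells1 Y Z\<rbrakk> \<Longrightarrow>
          vc V Z (hc2 V Y Z (id2 Y Z k) (Assoc B V W X Y h g f))
            (vc V Z (Assoc B V W Y Z k (hc1 W X Y h g) f)
                    (hc2 V W Z (Assoc B W X Y Z k h g) (id2 V W f))) =
          vc V Z (Assoc B V X Y Z k h (hc1 V W X g f))
                 (Assoc B V W X Z (hc1 X Y Z k h) g f)"
    and triangle: "\<lbrakk>X \<in> Obj0 B; Y \<in> Obj0 B; Z \<in> Obj0 B; f \<in> cells1 X Y; g \<in> cells1 Y Z\<rbrakk> \<Longrightarrow>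
          vc X Z (hc2 X Y Z (id2 Y Z g) (LUnit B X Y f)) (Assoc B X Y Y Z g (Unit B Y) f) =
          hc2 X Y Z (RUnit B Y Z g) (id2 X Y f)"

end

theory Submission
  imports Defs
begin

text \<open>A \<^emph>\<open>cell\<close> into a polynomial \<open>X \<leftarrow> A \<rightarrow> B \<rightarrow> Y\<close> is a map \<open>V \<rightarrow> W\<close> together with a pullback square
from it to \<open>A \<rightarrow> B\<close>; it has a left boundary \<open>V \<rightarrow> X\<close> and a right boundary \<open>W \<rightarrow> Y\<close>. A subdivided
composite of \<open>p\<close> and \<open>q\<close> is nothing but a cell \<open>c\<close> into \<open>p\<close> followed by a cell \<open>d\<close> into \<open>q\<close> whose left
boundary is the right boundary of \<open>c\<close>. The unique morphism from it to the terminal subdivided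
composite exhibits the composite of the middle maps of \<open>c\<close> and \<open>d\<close> as a cell \<open>\<langle>c, d\<rangle>\<close> into the
composite polynomial. Two facts about this pairing carry the whole proof.

\<^item> Every cell into the composite is a pairing (\<open>pair_surj\<close>): pull the factorisation of the middle map
  of the composite back along the cell.
\<^item> Morphisms \<open>\<langle>c, d\<rangle> \<rightarrow> \<langle>c', d'\<rangle>\<close> are the same as pairs of morphisms \<open>c \<rightarrow> c'\<close> and \<open>d \<rightarrow> d'\<close> that agree in
  the middle (\<open>pair_mor_iff\<close>).

A cartesian morphism \<open>\<alpha> : p \<rightarrow> p'\<close> acts on the cells into \<open>p\<close>, turning them into cells into \<open>p'\<close>. It is
determined by its effect on the identity cell of \<open>p\<close>, and conversely a rule that turns cells into \<open>p\<close>
into cells into \<open>p'\<close> with the same middle map and the same boundaries, compatibly with morphisms of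
cells, is given by a cartesian morphism (\<open>comparison\<close>). Each 2-cell of the bicategory is thereby
characterised by an equation:

\<^item> horizontal composition by \<open>(\<alpha> * \<beta>) \<langle>c, d\<rangle> = \<langle>\<alpha> c, \<beta> d\<rangle>\<close>,
\<^item> the associator by sending \<open>\<langle>c, \<langle>d, e\<rangle>\<rangle>\<close> to \<open>\<langle>\<langle>c, d\<rangle>, e\<rangle>\<close>,
\<^item> the unitors by sending \<open>\<langle>c, u\<rangle>\<close> and \<open>\<langle>u, c\<rangle>\<close> to \<open>c\<close>, where \<open>u\<close> is a cell into the identity polynomial
  whose middle map is an identity.

Functoriality, naturality, the pentagon and the triangle all assert that two cartesian morphisms
out of a composite are equal, and they follow by evaluating both on iterated pairings of cells. For
the pentagon, for example, both sides send \<open>\<langle>c, \<langle>d, \<langle>e, f\<rangle>\<rangle>\<rangle>\<close> to \<open>\<langle>\<langle>\<langle>c, d\<rangle>, e\<rangle>, f\<rangle>\<close>.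

That composites exist, and that their middle maps are again exponentiable, rests on a
description of exponentiability by universal objects: a map \<open>f\<close> is exponentiable if and only if
there is a distributivity pullback around \<open>(f, x)\<close> for each \<open>x\<close> into the domain of \<open>f\<close>
(\<open>exponentiable_iff\<close>).\<close>


section \<open>Arrows and pullbacks\<close>

context category
begin

lemma comp_type [simp]:
  assumes "f \<in> Arr C" "g \<in> Arr C" "Cod C f = Dom C g"
  shows "g \<cdot> f \<in> Arr C" "Dom C (g \<cdot> f) = Dom C f" "Cod C (g \<cdot> f) = Cod C g"
  using comp_hom[of f "Dom C f" "Dom C g" g "Cod C g"] assms by (auto simp: hom_def)

lemma ident_type [simp]:
  assumes "a \<in> Obj C"
  shows "Ident C a \<in> Arr C" "Dom C (Ident C a) = a" "Cod C (Ident C a) = a"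
  using ident_hom[OF assms] by (auto simp: hom_def)

lemma comp_ident_arr [simp]: "f \<in> Arr C \<Longrightarrow> Dom C f = a \<Longrightarrow> f \<cdot> Ident C a = f"
  using comp_ident[of f a "Cod C f"] by (auto simp: hom_def)

lemma ident_comp_arr [simp]: "f \<in> Arr C \<Longrightarrow> Cod C f = a \<Longrightarrow> Ident C a \<cdot> f = f"
  using ident_comp[of f "Dom C f" a] by (auto simp: hom_def)

lemma assoc_arr [simp]:
  assumes "f \<in> Arr C" "g \<in> Arr C" "h \<in> Arr C" "Cod C f = Dom C g" "Cod C g = Dom C h"
  shows "(h \<cdot> g) \<cdot> f = h \<cdot> (g \<cdot> f)"
  using comp_assoc[of f "Dom C f" "Dom C g" g "Dom C h" h "Cod C h"] assms by (auto simp: hom_def)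

lemmas obj_simps [simp] = dom_obj cod_obj

text \<open>The simplifier nests composites to the right, which separates the two factors on either side of a
commuting square as soon as something is composed with them. The next two lemmas restore the
equation in that position.\<close>

lemma square_comp:
  assumes "a \<cdot> b = c \<cdot> d" "a \<in> Arr C" "b \<in> Arr C" "c \<in> Arr C" "d \<in> Arr C" "z \<in> Arr C"
    "Cod C b = Dom C a" "Cod C d = Dom C c" "Cod C z = Dom C b" "Cod C z = Dom C d"
  shows "a \<cdot> (b \<cdot> z) = c \<cdot> (d \<cdot> z)"
  using assms assoc_arr[of z b a] assoc_arr[of z d c] by simp

lemma triangle_comp:
  assumes "a \<cdot> b = c" "a \<in> Arr C" "b \<in> Arr C" "z \<in> Arr C"
    "Cod C b = Dom C a" "Cod C z = Dom C b"
  shows "a \<cdot> (b \<cdot> z) = c \<cdot> z"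
  using assms assoc_arr[of z b a] by simp

lemma pullback_square:
  assumes "is_pullback C f g p q"
  shows "f \<in> Arr C" "g \<in> Arr C" "p \<in> Arr C" "q \<in> Arr C" "Cod C f = Cod C g"
    "Dom C p = Dom C q" "Cod C p = Dom C f" "Cod C q = Dom C g" "f \<cdot> p = g \<cdot> q"
  using assms unfolding is_pullback_def by auto

lemma pullback_lift:
  assumes "is_pullback C f g p q" "u \<in> Arr C" "v \<in> Arr C" "Dom C u = Dom C v"
    "Cod C u = Dom C f" "Cod C v = Dom C g" "f \<cdot> u = g \<cdot> v"
  obtains h where "h \<in> Arr C" "Dom C h = Dom C u" "Cod C h = Dom C p" "p \<cdot> h = u" "q \<cdot> h = v"
proof -
  have "\<forall>z \<in> Obj C. \<forall>u \<in> hom C z (Dom C f). \<forall>v \<in> hom C z (Dom C g). f \<cdot> u = g \<cdot> v \<longrightarrow>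
        (\<exists>!h. h \<in> hom C z (Dom C p) \<and> p \<cdot> h = u \<and> q \<cdot> h = v)"
    using assms(1) unfolding is_pullback_def by blast
  moreover have "Dom C u \<in> Obj C" "u \<in> hom C (Dom C u) (Dom C f)" "v \<in> hom C (Dom C u) (Dom C g)"
    using assms by (auto simp: hom_def)
  ultimately have "\<exists>!h. h \<in> hom C (Dom C u) (Dom C p) \<and> p \<cdot> h = u \<and> q \<cdot> h = v"
    using assms(7) by blast
  then show ?thesis using that by (auto simp: hom_def)
qed

lemma pullback_unique:
  assumes pb: "is_pullback C f g p q" and h: "h \<in> Arr C" "Cod C h = Dom C p"
    and h': "h' \<in> Arr C" "Cod C h' = Dom C p" and d: "Dom C h = Dom C h'"
    and e: "p \<cdot> h = p \<cdot> h'" "q \<cdot> h = q \<cdot> h'"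
  shows "h = h'"
proof -
  note s = pullback_square[OF pb]
  have "Dom C h \<in> Obj C" "p \<cdot> h \<in> hom C (Dom C h) (Dom C f)" "q \<cdot> h \<in> hom C (Dom C h) (Dom C g)"
    using s h by (auto simp: hom_def)
  moreover have "f \<cdot> (p \<cdot> h) = g \<cdot> (q \<cdot> h)"
    by (rule square_comp) (use s h in simp_all)
  ultimately have "\<exists>!k. k \<in> hom C (Dom C h) (Dom C p) \<and> p \<cdot> k = p \<cdot> h \<and> q \<cdot> k = q \<cdot> h"
    using pb unfolding is_pullback_def by blast
  moreover have "h \<in> hom C (Dom C h) (Dom C p)" "h' \<in> hom C (Dom C h) (Dom C p)"
    using h h' d by (auto simp: hom_def)
  ultimately show ?thesis using e by metis
qed

lemma pullbackI:
  assumes "f \<in> Arr C" "g \<in> Arr C" "p \<in> Arr C" "q \<in> Arr C" "Cod C f = Cod C g"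
    "Dom C p = Dom C q" "Cod C p = Dom C f" "Cod C q = Dom C g" "f \<cdot> p = g \<cdot> q"
    and lift: "\<And>u v. u \<in> Arr C \<Longrightarrow> v \<in> Arr C \<Longrightarrow> Dom C u = Dom C v \<Longrightarrow> Cod C u = Dom C f \<Longrightarrow>
      Cod C v = Dom C g \<Longrightarrow> f \<cdot> u = g \<cdot> v \<Longrightarrow>
      \<exists>h. h \<in> Arr C \<and> Dom C h = Dom C u \<and> Cod C h = Dom C p \<and> p \<cdot> h = u \<and> q \<cdot> h = v"
    and uniq: "\<And>h h'. h \<in> Arr C \<Longrightarrow> h' \<in> Arr C \<Longrightarrow> Dom C h = Dom C h' \<Longrightarrow> Cod C h = Dom C p \<Longrightarrow>
      Cod C h' = Dom C p \<Longrightarrow> p \<cdot> h = p \<cdot> h' \<Longrightarrow> q \<cdot> h = q \<cdot> h' \<Longrightarrow> h = h'"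
  shows "is_pullback C f g p q"
proof -
  have "\<exists>!h. h \<in> hom C z (Dom C p) \<and> p \<cdot> h = u \<and> q \<cdot> h = v"
    if "u \<in> hom C z (Dom C f)" "v \<in> hom C z (Dom C g)" "f \<cdot> u = g \<cdot> v" for z u v
  proof -
    have "\<exists>h. h \<in> hom C z (Dom C p) \<and> p \<cdot> h = u \<and> q \<cdot> h = v"
      using lift[of u v] that by (simp add: hom_def)
    then obtain h where h: "h \<in> hom C z (Dom C p)" "p \<cdot> h = u" "q \<cdot> h = v" by blast
    moreover have "k = h" if "k \<in> hom C z (Dom C p)" "p \<cdot> k = u" "q \<cdot> k = v" for k
      by (rule uniq) (use h that in \<open>auto simp: hom_def\<close>)
    ultimately show ?thesis by blast
  qed
  then show ?thesis using assms(1-9) unfolding is_pullback_def by blast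
qed

lemma pullback_swap:
  assumes pb: "is_pullback C f g p q" shows "is_pullback C g f q p"
proof (rule pullbackI)
  note s = pullback_square[OF pb]
  show "g \<in> Arr C" "f \<in> Arr C" "q \<in> Arr C" "p \<in> Arr C" "Cod C g = Cod C f"
    "Dom C q = Dom C p" "Cod C q = Dom C g" "Cod C p = Dom C f" "g \<cdot> q = f \<cdot> p"
    using s by auto
  show "\<exists>h. h \<in> Arr C \<and> Dom C h = Dom C u \<and> Cod C h = Dom C q \<and> q \<cdot> h = u \<and> p \<cdot> h = v"
    if "u \<in> Arr C" "v \<in> Arr C" "Dom C u = Dom C v" "Cod C u = Dom C g" "Cod C v = Dom C f"
      "g \<cdot> u = f \<cdot> v" for u v
    using pullback_lift[OF pb, of v u] that s by metis
  show "h = h'" if "h \<in> Arr C" "h' \<in> Arr C" "Dom C h = Dom C h'" "Cod C h = Dom C q"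
      "Cod C h' = Dom C q" "q \<cdot> h = q \<cdot> h'" "p \<cdot> h = p \<cdot> h'" for h h'
    using pullback_unique[OF pb, of h h'] that s by metis
qed

lemma pullback_paste:
  assumes pb: "is_pullback C f s r m" and pb': "is_pullback C m t' t n"
  shows "is_pullback C f (s \<cdot> t') (r \<cdot> t) n"
proof (rule pullbackI)
  note s = pullback_square[OF pb] pullback_square[OF pb']
  show "f \<in> Arr C" "s \<cdot> t' \<in> Arr C" "r \<cdot> t \<in> Arr C" "n \<in> Arr C" "Cod C f = Cod C (s \<cdot> t')"
    "Dom C (r \<cdot> t) = Dom C n" "Cod C (r \<cdot> t) = Dom C f" "Cod C n = Dom C (s \<cdot> t')"
    using s by auto
  have "f \<cdot> (r \<cdot> t) = s \<cdot> (m \<cdot> t)" by (rule square_comp) (use s in simp_all)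
  then show "f \<cdot> (r \<cdot> t) = (s \<cdot> t') \<cdot> n" using s by simp
  show "\<exists>h. h \<in> Arr C \<and> Dom C h = Dom C u \<and> Cod C h = Dom C (r \<cdot> t) \<and> (r \<cdot> t) \<cdot> h = u \<and> n \<cdot> h = v"
    if uv: "u \<in> Arr C" "v \<in> Arr C" "Dom C u = Dom C v" "Cod C u = Dom C f"
      "Cod C v = Dom C (s \<cdot> t')" "f \<cdot> u = (s \<cdot> t') \<cdot> v" for u v
  proof -
    obtain k where k: "k \<in> Arr C" "Dom C k = Dom C u" "Cod C k = Dom C r" "r \<cdot> k = u" "m \<cdot> k = t' \<cdot> v"
      using pullback_lift[OF pb, of u "t' \<cdot> v"] uv s by auto
    obtain h where h: "h \<in> Arr C" "Dom C h = Dom C k" "Cod C h = Dom C t" "t \<cdot> h = k" "n \<cdot> h = v"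
      using pullback_lift[OF pb', of k v] uv s k by auto
    then show ?thesis using s k by (intro exI[of _ h]) simp
  qed
  show "h = h'" if hh: "h \<in> Arr C" "h' \<in> Arr C" "Dom C h = Dom C h'" "Cod C h = Dom C (r \<cdot> t)"
      "Cod C h' = Dom C (r \<cdot> t)" "(r \<cdot> t) \<cdot> h = (r \<cdot> t) \<cdot> h'" "n \<cdot> h = n \<cdot> h'" for h h'
  proof -
    have "m \<cdot> (t \<cdot> h) = t' \<cdot> (n \<cdot> h)" "m \<cdot> (t \<cdot> h') = t' \<cdot> (n \<cdot> h')"
      by (rule square_comp; use s hh in simp)+
    note e = this
    have "t \<cdot> h = t \<cdot> h'"
      by (rule pullback_unique[OF pb]) (use s hh e in simp_all)
    note e' = this
    show ?thesis by (rule pullback_unique[OF pb']) (use s hh e' in simp_all)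
  qed
qed

lemma pullback_cancel:
  assumes pb: "is_pullback C f s r m" and pb': "is_pullback C f (s \<cdot> t') (r \<cdot> t) n"
    and t: "t \<in> Arr C" "t' \<in> Arr C" "Cod C t = Dom C m" "Cod C t' = Cod C m"
    and sq: "m \<cdot> t = t' \<cdot> n"
  shows "is_pullback C m t' t n"
proof (rule pullbackI)
  note s0 = pullback_square[OF pb]
  have n: "n \<in> Arr C" "Dom C t = Dom C n" "Cod C n = Dom C t'"
    using pullback_square[OF pb'] s0 t by simp_all
  note s = s0 t n
  show "m \<in> Arr C" "t' \<in> Arr C" "t \<in> Arr C" "n \<in> Arr C" "Cod C m = Cod C t'"
    "Dom C t = Dom C n" "Cod C t = Dom C m" "Cod C n = Dom C t'" "m \<cdot> t = t' \<cdot> n"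
    using s sq by simp_all
  show "\<exists>h. h \<in> Arr C \<and> Dom C h = Dom C u \<and> Cod C h = Dom C t \<and> t \<cdot> h = u \<and> n \<cdot> h = v"
    if uv: "u \<in> Arr C" "v \<in> Arr C" "Dom C u = Dom C v" "Cod C u = Dom C m"
      "Cod C v = Dom C t'" "m \<cdot> u = t' \<cdot> v" for u v
  proof -
    have "f \<cdot> (r \<cdot> u) = s \<cdot> (m \<cdot> u)" by (rule square_comp) (use s uv in simp_all)
    then obtain h where h: "h \<in> Arr C" "Dom C h = Dom C u" "Cod C h = Dom C (r \<cdot> t)"
        "(r \<cdot> t) \<cdot> h = r \<cdot> u" "n \<cdot> h = v"
      using pullback_lift[OF pb', of "r \<cdot> u" v] s uv by auto
    have "m \<cdot> (t \<cdot> h) = t' \<cdot> (n \<cdot> h)" by (rule square_comp) (use sq h s in simp_all)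
    note e = this
    have "t \<cdot> h = u" by (rule pullback_unique[OF pb]) (use e h s uv in simp_all)
    then show ?thesis using h s by (intro exI[of _ h]) simp
  qed
  show "h = h'" if hh: "h \<in> Arr C" "h' \<in> Arr C" "Dom C h = Dom C h'" "Cod C h = Dom C t"
      "Cod C h' = Dom C t" "t \<cdot> h = t \<cdot> h'" "n \<cdot> h = n \<cdot> h'" for h h'
    by (rule pullback_unique[OF pb']) (use s hh in simp_all)
qed

lemma pullback_paste_across:
  assumes "is_pullback C f s r m" and "is_pullback C f' s' s m'" and "Cod C f = Dom C f'"
  shows "is_pullback C (f' \<cdot> f) s' r (m' \<cdot> m)"
  using pullback_paste[OF pullback_swap[OF assms(2)] pullback_swap[OF assms(1)]]
    pullback_swap by blast

lemma pullback_cancel_across: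
  assumes "is_pullback C f' s' s m'" and "is_pullback C (f' \<cdot> f) s' r (m' \<cdot> m)"
    and "f \<in> Arr C" "m \<in> Arr C" "Cod C f = Dom C f'" "Cod C m = Dom C m'" "f \<cdot> r = s \<cdot> m"
  shows "is_pullback C f s r m"
proof -
  note s = pullback_square[OF assms(1)]
  have "is_pullback C s f m r"
    by (rule pullback_cancel[OF pullback_swap[OF assms(1)] pullback_swap[OF assms(2)]])
      (use assms s in auto)
  then show ?thesis by (rule pullback_swap)
qed

lemma pullback_ident:
  assumes "f \<in> Arr C"
  shows "is_pullback C f (Ident C (Cod C f)) (Ident C (Dom C f)) f"
  by (rule pullbackI) (use assms in auto)

end

locale pb_category = category C for C :: "('o, 'm) precat" (structure) +
  assumes pullbacks: "has_pullbacks C"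
begin

lemma obtain_pullback:
  assumes "f \<in> Arr C" "g \<in> Arr C" "Cod C f = Cod C g"
  obtains p q where "is_pullback C f g p q"
  using pullbacks assms unfolding has_pullbacks_def by blast

end

section \<open>Adjunctions as universal arrows\<close>

text \<open>This says that \<open>e\<close> can be the component at \<open>b\<close> of the counit of an adjunction whose right adjoint
sends \<open>b\<close> to \<open>c\<close>.\<close>

definition universal_arrow ::
  "('o1, 'm1) precat \<Rightarrow> ('o2, 'm2) precat \<Rightarrow> ('o1, 'm1, 'o2, 'm2) ftor \<Rightarrow> 'o2 \<Rightarrow> 'o1 \<Rightarrow> 'm2 \<Rightarrow> bool"
  where "universal_arrow C D F b c e \<longleftrightarrow> c \<in> Obj C \<and> e \<in> hom D (fob F c) b \<and>
    (\<forall>a \<in> Obj C. \<forall>g \<in> hom D (fob F a) b. \<exists>!h. h \<in> hom C a c \<and> e \<cdot>\<^bsub>D\<^esub> far F h = g)"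

lemma universal_arrow_ex1:
  assumes "universal_arrow C D F b c e" "a \<in> Obj C" "g \<in> hom D (fob F a) b"
  shows "\<exists>!h. h \<in> hom C a c \<and> e \<cdot>\<^bsub>D\<^esub> far F h = g"
  using assms by (simp add: universal_arrow_def)

text \<open>The counit at \<open>b\<close> is the arrow that the hom bijection \<open>\<phi>\<close> sends to the identity of \<open>G b\<close>. Naturality of
\<open>\<phi>\<close> gives \<open>\<phi> (e b \<cdot> F h) = h\<close>, so that the universal property of \<open>e b\<close> is the bijectivity of \<open>\<phi>\<close>.\<close>

lemma adjoint_counit:
  assumes adj: "adjoint C D F G"
  obtains e where "\<And>b. b \<in> Obj D \<Longrightarrow> universal_arrow C D F b (fob G b) (e b)"
    and "\<And>b b' y. y \<in> hom D b b' \<Longrightarrow> e b' \<cdot>\<^bsub>D\<^esub> far F (far G y) = y \<cdot>\<^bsub>D\<^esub> e b"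
proof -
  interpret F: cat_functor C D F using adj by (simp add: adjoint_def)
  interpret G: cat_functor D C G using adj by (simp add: adjoint_def)
  obtain \<phi> where
    bij: "\<And>a b. a \<in> Obj C \<Longrightarrow> b \<in> Obj D \<Longrightarrow>
      bij_betw (\<phi> a b) (hom D (fob F a) b) (hom C a (fob G b))"
    and nat: "\<And>a a' b b' x y g. a \<in> Obj C \<Longrightarrow> a' \<in> Obj C \<Longrightarrow> b \<in> Obj D \<Longrightarrow> b' \<in> Obj D \<Longrightarrow>
      x \<in> hom C a' a \<Longrightarrow> y \<in> hom D b b' \<Longrightarrow> g \<in> hom D (fob F a) b \<Longrightarrow>
      \<phi> a' b' (y \<cdot>\<^bsub>D\<^esub> (g \<cdot>\<^bsub>D\<^esub> far F x)) = far G y \<cdot>\<^bsub>C\<^esub> (\<phi> a b g \<cdot>\<^bsub>C\<^esub> x)"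
    using adj unfolding adjoint_def by blast
  have objs: "a \<in> Obj C \<and> b \<in> Obj C" if "h \<in> hom C a b" for a b h
    using that F.C.dom_obj F.C.cod_obj by (auto simp: hom_def)
  have objs': "a \<in> Obj D \<and> b \<in> Obj D" if "h \<in> hom D a b" for a b h
    using that F.D.dom_obj F.D.cod_obj by (auto simp: hom_def)
  define e where "e b = (SOME g. g \<in> hom D (fob F (fob G b)) b \<and>
    \<phi> (fob G b) b g = Ident C (fob G b))" for b
  have e: "e b \<in> hom D (fob F (fob G b)) b" "\<phi> (fob G b) b (e b) = Ident C (fob G b)"
    if b: "b \<in> Obj D" for b
  proof -
    have "Ident C (fob G b) \<in> \<phi> (fob G b) b ` hom D (fob F (fob G b)) b"
      using bij[of "fob G b" b] b G.fob_obj F.C.ident_hom by (simp add: bij_betw_def)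
    then have "\<exists>g. g \<in> hom D (fob F (fob G b)) b \<and> \<phi> (fob G b) b g = Ident C (fob G b)" by auto
    from someI_ex[OF this] show "e b \<in> hom D (fob F (fob G b)) b"
      "\<phi> (fob G b) b (e b) = Ident C (fob G b)" by (auto simp: e_def)
  qed
  have \<phi>e: "\<phi> a b (e b \<cdot>\<^bsub>D\<^esub> far F h) = h" "e b \<cdot>\<^bsub>D\<^esub> far F h \<in> hom D (fob F a) b"
    if b: "b \<in> Obj D" and h: "h \<in> hom C a (fob G b)" for a b h
  proof -
    have Fh: "far F h \<in> hom D (fob F a) (fob F (fob G b))" by (rule F.far_hom[OF h])
    show eh: "e b \<cdot>\<^bsub>D\<^esub> far F h \<in> hom D (fob F a) b"
      by (rule F.D.comp_hom[OF Fh e(1)[OF b]])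
    have "\<phi> a b (Ident D b \<cdot>\<^bsub>D\<^esub> (e b \<cdot>\<^bsub>D\<^esub> far F h)) =
        far G (Ident D b) \<cdot>\<^bsub>C\<^esub> (\<phi> (fob G b) b (e b) \<cdot>\<^bsub>C\<^esub> h)"
      by (rule nat) (use b h objs[OF h] e F.D.ident_hom in auto)
    then show "\<phi> a b (e b \<cdot>\<^bsub>D\<^esub> far F h) = h"
      using F.D.ident_comp[OF eh] F.C.ident_comp[OF h] e(2)[OF b] G.far_ident[OF b] by simp
  qed
  show thesis
  proof (rule that[of e])
    show "universal_arrow C D F b (fob G b) (e b)" if b: "b \<in> Obj D" for b
      unfolding universal_arrow_def
    proof (intro conjI ballI)
      show "fob G b \<in> Obj C" "e b \<in> hom D (fob F (fob G b)) b"
        using G.fob_obj b e by auto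
      fix a g assume a: "a \<in> Obj C" and g: "g \<in> hom D (fob F a) b"
      have h: "\<phi> a b g \<in> hom C a (fob G b)" using bij[OF a b] g by (auto simp: bij_betw_def)
      show "\<exists>!h. h \<in> hom C a (fob G b) \<and> e b \<cdot>\<^bsub>D\<^esub> far F h = g"
      proof
        have "e b \<cdot>\<^bsub>D\<^esub> far F (\<phi> a b g) = g"
          using bij[OF a b] \<phi>e[OF b h] g by (auto simp: bij_betw_def dest: inj_onD)
        then show "\<phi> a b g \<in> hom C a (fob G b) \<and> e b \<cdot>\<^bsub>D\<^esub> far F (\<phi> a b g) = g" using h by blast
      qed (use \<phi>e[OF b] in auto)
    qed
    show "e b' \<cdot>\<^bsub>D\<^esub> far F (far G y) = y \<cdot>\<^bsub>D\<^esub> e b" if y: "y \<in> hom D b b'" for b b' y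
    proof -
      have b: "b \<in> Obj D" "b' \<in> Obj D" using objs'[OF y] by auto
      have Gy: "far G y \<in> hom C (fob G b) (fob G b')" by (rule G.far_hom[OF y])
      note i = F.C.ident_hom[OF G.fob_obj[OF b(1)]]
      have "e b \<cdot>\<^bsub>D\<^esub> far F (Ident C (fob G b)) = e b"
        using F.far_ident[OF G.fob_obj[OF b(1)]] F.D.comp_ident[OF e(1)[OF b(1)]] by simp
      moreover have "\<phi> (fob G b) b' (y \<cdot>\<^bsub>D\<^esub> (e b \<cdot>\<^bsub>D\<^esub> far F (Ident C (fob G b)))) =
          far G y \<cdot>\<^bsub>C\<^esub> (\<phi> (fob G b) b (e b) \<cdot>\<^bsub>C\<^esub> Ident C (fob G b))"
        by (rule nat) (use b y e i G.fob_obj in auto)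
      ultimately have "\<phi> (fob G b) b' (y \<cdot>\<^bsub>D\<^esub> e b) = far G y"
        using e(2)[OF b(1)] F.C.comp_ident[OF i] F.C.comp_ident[OF Gy] by simp
      moreover have "\<phi> (fob G b) b' (e b' \<cdot>\<^bsub>D\<^esub> far F (far G y)) = far G y"
        by (rule \<phi>e(1)[OF b(2) Gy])
      moreover have "y \<cdot>\<^bsub>D\<^esub> e b \<in> hom D (fob F (fob G b)) b'"
        by (rule F.D.comp_hom[OF e(1)[OF b(1)] y])
      ultimately show ?thesis
        using bij[OF G.fob_obj[OF b(1)] b(2)] \<phi>e(2)[OF b(2) Gy]
        by (metis bij_betw_def inj_onD)
    qed
  qed
qed

text \<open>The object part of the right adjoint is any choice of universal arrows. Its arrow part is then
forced by naturality of the counit, and functoriality follows from this characterisation.\<close>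

lemma adjoint_from_universal_arrows:
  assumes "cat_functor C D F" and u: "\<And>b. b \<in> Obj D \<Longrightarrow> universal_arrow C D F b (c b) (e b)"
  obtains G where "adjoint C D F G" and "\<And>b. fob G b = c b"
    and "\<And>b b' y. y \<in> hom D b b' \<Longrightarrow>
      far G y \<in> hom C (c b) (c b') \<and> e b' \<cdot>\<^bsub>D\<^esub> far F (far G y) = y \<cdot>\<^bsub>D\<^esub> e b"
proof -
  interpret F: cat_functor C D F by fact
  have objs: "a \<in> Obj C" "b \<in> Obj C" if "h \<in> hom C a b" for a b h
    using that F.C.dom_obj F.C.cod_obj by (auto simp: hom_def)
  have objs': "a \<in> Obj D" "b \<in> Obj D" if "h \<in> hom D a b" for a b h
    using that F.D.dom_obj F.D.cod_obj by (auto simp: hom_def)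
  have c: "c b \<in> Obj C" and e: "e b \<in> hom D (fob F (c b)) b" if "b \<in> Obj D" for b
    using u[OF that] by (auto simp: universal_arrow_def)
  define \<phi> where "\<phi> a b g = (THE h. h \<in> hom C a (c b) \<and> e b \<cdot>\<^bsub>D\<^esub> far F h = g)" for a b g
  have ex1: "\<exists>!h. h \<in> hom C a (c b) \<and> e b \<cdot>\<^bsub>D\<^esub> far F h = g"
    if "a \<in> Obj C" "b \<in> Obj D" "g \<in> hom D (fob F a) b" for a b g
    using u[OF that(2)] that by (simp add: universal_arrow_def)
  have \<phi>: "\<phi> a b g \<in> hom C a (c b)" "e b \<cdot>\<^bsub>D\<^esub> far F (\<phi> a b g) = g"
    if "a \<in> Obj C" "b \<in> Obj D" "g \<in> hom D (fob F a) b" for a b g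
    using theI'[OF ex1[OF that]] by (auto simp: \<phi>_def)
  have \<phi>_eq: "\<phi> a b g = h" if "b \<in> Obj D" "h \<in> hom C a (c b)" "e b \<cdot>\<^bsub>D\<^esub> far F h = g" for a b g h
  proof -
    have "g \<in> hom D (fob F a) b"
      using F.D.comp_hom[OF F.far_hom[OF that(2)] e[OF that(1)]] that(3) by simp
    from ex1[OF objs(1)[OF that(2)] that(1) this] show ?thesis
      unfolding \<phi>_def using that by (intro the1_equality) auto
  qed
  define G where "G = \<lparr> fob = c, far = \<lambda>y. \<phi> (c (Dom D y)) (Cod D y) (y \<cdot>\<^bsub>D\<^esub> e (Dom D y)) \<rparr>"
  have far: "far G y = \<phi> (c b) b' (y \<cdot>\<^bsub>D\<^esub> e b)" if "y \<in> hom D b b'" for y b b'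
    using that by (simp add: G_def hom_def)
  have G: "far G y \<in> hom C (c b) (c b')" "e b' \<cdot>\<^bsub>D\<^esub> far F (far G y) = y \<cdot>\<^bsub>D\<^esub> e b"
    if y: "y \<in> hom D b b'" for y b b'
    using \<phi>[OF c[OF objs'(1)[OF y]] objs'(2)[OF y] F.D.comp_hom[OF e[OF objs'(1)[OF y]] y]]
    by (auto simp: far[OF y])
  have assoc_e: "e b' \<cdot>\<^bsub>D\<^esub> far F (k \<cdot>\<^bsub>C\<^esub> h) = (e b' \<cdot>\<^bsub>D\<^esub> far F k) \<cdot>\<^bsub>D\<^esub> far F h"
    if "h \<in> hom C a a'" "k \<in> hom C a' (c b')" "b' \<in> Obj D" for h k a a' b'
    using F.far_comp[OF that(1,2)]
      F.D.comp_assoc[OF F.far_hom[OF that(1)] F.far_hom[OF that(2)] e[OF that(3)]] by simp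
  interpret G: cat_functor D C G
  proof
    show "fob G b \<in> Obj C" if "b \<in> Obj D" for b using c[OF that] by (simp add: G_def)
    show "far G y \<in> hom C (fob G b) (fob G b')" if "y \<in> hom D b b'" for y b b'
      using G(1)[OF that] by (simp add: G_def)
    show "far G (Ident D b) = Ident C (fob G b)" if b: "b \<in> Obj D" for b
    proof -
      note i = F.D.ident_hom[OF b] F.C.ident_hom[OF c[OF b]]
      have "e b \<cdot>\<^bsub>D\<^esub> far F (Ident C (c b)) = Ident D b \<cdot>\<^bsub>D\<^esub> e b"
        using F.far_ident[OF c[OF b]] F.D.comp_ident[OF e[OF b]] F.D.ident_comp[OF e[OF b]] by simp
      from \<phi>_eq[OF b i(2) this] far[OF i(1)] show ?thesis by (simp add: G_def)
    qed
    show "far G (z \<cdot>\<^bsub>D\<^esub> y) = far G z \<cdot>\<^bsub>C\<^esub> far G y"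
      if y: "y \<in> hom D b b'" and z: "z \<in> hom D b' b''" for y z b b' b''
    proof -
      note b = objs'[OF y] objs'(2)[OF z]
      have "e b'' \<cdot>\<^bsub>D\<^esub> far F (far G z \<cdot>\<^bsub>C\<^esub> far G y) = (z \<cdot>\<^bsub>D\<^esub> e b') \<cdot>\<^bsub>D\<^esub> far F (far G y)"
        using assoc_e[OF G(1)[OF y] G(1)[OF z] b(3)] G(2)[OF z] by simp
      also have "\<dots> = z \<cdot>\<^bsub>D\<^esub> (y \<cdot>\<^bsub>D\<^esub> e b)"
        using F.D.comp_assoc[OF F.far_hom[OF G(1)[OF y]] e[OF b(2)] z] G(2)[OF y] by simp
      also have "\<dots> = (z \<cdot>\<^bsub>D\<^esub> y) \<cdot>\<^bsub>D\<^esub> e b"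
        using F.D.comp_assoc[OF e[OF b(1)] y z] by simp
      finally show ?thesis
        using \<phi>_eq[OF b(3) F.C.comp_hom[OF G(1)[OF y] G(1)[OF z]]] far[OF F.D.comp_hom[OF y z]]
        by simp
    qed
  qed
  have "adjoint C D F G"
    unfolding adjoint_def
  proof (intro conjI exI[of _ \<phi>] ballI)
    show "bij_betw (\<phi> a b) (hom D (fob F a) b) (hom C a (fob G b))"
      if ab: "a \<in> Obj C" "b \<in> Obj D" for a b
    proof (rule bij_betw_byWitness[where f' = "\<lambda>h. e b \<cdot>\<^bsub>D\<^esub> far F h"])
      show "\<forall>g\<in>hom D (fob F a) b. e b \<cdot>\<^bsub>D\<^esub> far F (\<phi> a b g) = g" using \<phi>[OF ab] by blast
      show "\<forall>h\<in>hom C a (fob G b). \<phi> a b (e b \<cdot>\<^bsub>D\<^esub> far F h) = h"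
        using \<phi>_eq[OF ab(2)] by (simp add: G_def)
      show "\<phi> a b ` hom D (fob F a) b \<subseteq> hom C a (fob G b)" using \<phi>[OF ab] by (auto simp: G_def)
      show "(\<lambda>h. e b \<cdot>\<^bsub>D\<^esub> far F h) ` hom C a (fob G b) \<subseteq> hom D (fob F a) b"
        using F.D.comp_hom[OF F.far_hom e[OF ab(2)]] by (auto simp: G_def)
    qed
    show "\<phi> a' b' (y \<cdot>\<^bsub>D\<^esub> (g \<cdot>\<^bsub>D\<^esub> far F x)) = far G y \<cdot>\<^bsub>C\<^esub> (\<phi> a b g \<cdot>\<^bsub>C\<^esub> x)"
      if a: "a \<in> Obj C" "a' \<in> Obj C" and b: "b \<in> Obj D" "b' \<in> Obj D"
        and x: "x \<in> hom C a' a" and y: "y \<in> hom D b b'" and g: "g \<in> hom D (fob F a) b"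
      for a a' b b' x y g
    proof (rule \<phi>_eq[OF b(2)])
      note p = \<phi>[OF a(1) b(1) g]
      show "far G y \<cdot>\<^bsub>C\<^esub> (\<phi> a b g \<cdot>\<^bsub>C\<^esub> x) \<in> hom C a' (c b')"
        by (rule F.C.comp_hom[OF F.C.comp_hom[OF x p(1)] G(1)[OF y]])
      have "e b' \<cdot>\<^bsub>D\<^esub> far F (far G y \<cdot>\<^bsub>C\<^esub> (\<phi> a b g \<cdot>\<^bsub>C\<^esub> x)) =
          (y \<cdot>\<^bsub>D\<^esub> e b) \<cdot>\<^bsub>D\<^esub> far F (\<phi> a b g \<cdot>\<^bsub>C\<^esub> x)"
        using assoc_e[OF F.C.comp_hom[OF x p(1)] G(1)[OF y] b(2)] G(2)[OF y] by simp
      also have "\<dots> = y \<cdot>\<^bsub>D\<^esub> (e b \<cdot>\<^bsub>D\<^esub> far F (\<phi> a b g \<cdot>\<^bsub>C\<^esub> x))"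
        by (rule F.D.comp_assoc[OF F.far_hom[OF F.C.comp_hom[OF x p(1)]] e[OF b(1)] y])
      also have "\<dots> = y \<cdot>\<^bsub>D\<^esub> (g \<cdot>\<^bsub>D\<^esub> far F x)"
        using assoc_e[OF x p(1) b(1)] p(2) by simp
      finally show "e b' \<cdot>\<^bsub>D\<^esub> far F (far G y \<cdot>\<^bsub>C\<^esub> (\<phi> a b g \<cdot>\<^bsub>C\<^esub> x)) =
          y \<cdot>\<^bsub>D\<^esub> (g \<cdot>\<^bsub>D\<^esub> far F x)" .
    qed
  qed (fact F.cat_functor_axioms G.cat_functor_axioms)+
  then show thesis using that[of G] G by (simp add: G_def)
qed

section \<open>Exponentiable maps and distributivity pullbacks\<close>

context category
begin

lemma in_hom_slice:
  "g \<in> hom (slice C X) a b \<longleftrightarrow> g = (a, b, snd (snd g)) \<and> a \<in> Arr C \<and> b \<in> Arr C \<and>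
    Cod C a = X \<and> Cod C b = X \<and> snd (snd g) \<in> Arr C \<and> Dom C (snd (snd g)) = Dom C a \<and>
    Cod C (snd (snd g)) = Dom C b \<and> b \<cdot> snd (snd g) = a"
  by (cases g) (auto simp: hom_def slice_def)

lemma in_hom_slice_tuple:
  "(a', b', h) \<in> hom (slice C X) a b \<longleftrightarrow> a' = a \<and> b' = b \<and> a \<in> Arr C \<and> b \<in> Arr C \<and>
    Cod C a = X \<and> Cod C b = X \<and> h \<in> Arr C \<and> Dom C h = Dom C a \<and> Cod C h = Dom C b \<and> b \<cdot> h = a"
  by (auto simp: hom_def slice_def)

lemma hom_sliceE:
  assumes "g \<in> hom (slice C X) a b"
  obtains h where "g = (a, b, h)" "a \<in> Arr C" "b \<in> Arr C" "Cod C a = X" "Cod C b = X"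
    "h \<in> Arr C" "Dom C h = Dom C a" "Cod C h = Dom C b" "b \<cdot> h = a"
  using assms in_hom_slice by blast

lemma slice_comp [simp]: "(b', c, k) \<cdot>\<^bsub>slice C X\<^esub> (a, b, h) = (a, c, k \<cdot> h)"
  by (simp add: slice_def)

lemma slice_sum_simps [simp]:
  "fob (slice_sum C f) a = f \<cdot> a" "far (slice_sum C f) (a, b, h) = (f \<cdot> a, f \<cdot> b, h)"
  by (simp_all add: slice_sum_def)

lemma slice_category: "category (slice C X)"
proof
  show "g \<cdot>\<^bsub>slice C X\<^esub> f \<in> hom (slice C X) a c"
    if fg: "f \<in> hom (slice C X) a b" "g \<in> hom (slice C X) b c" for f g a b c
    by (rule hom_sliceE[OF fg(1)], rule hom_sliceE[OF fg(2)])
      (simp add: in_hom_slice_tuple triangle_comp)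
  show "(h \<cdot>\<^bsub>slice C X\<^esub> g) \<cdot>\<^bsub>slice C X\<^esub> f = h \<cdot>\<^bsub>slice C X\<^esub> (g \<cdot>\<^bsub>slice C X\<^esub> f)"
    if fgh: "f \<in> hom (slice C X) a b" "g \<in> hom (slice C X) b c" "h \<in> hom (slice C X) c d"
    for f g h a b c d
    by (rule hom_sliceE[OF fgh(1)], rule hom_sliceE[OF fgh(2)], rule hom_sliceE[OF fgh(3)]) simp
  show "Ident (slice C X) a \<in> hom (slice C X) a a" if "a \<in> Obj (slice C X)" for a
    using that by (simp add: slice_def hom_def)
  show "f \<cdot>\<^bsub>slice C X\<^esub> Ident (slice C X) a = f" "Ident (slice C X) b \<cdot>\<^bsub>slice C X\<^esub> f = f"
    if f: "f \<in> hom (slice C X) a b" for f a b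
    by (rule hom_sliceE[OF f], simp add: slice_def)+
qed (auto simp: slice_def)

lemma slice_sum_functor:
  assumes f: "f \<in> Arr C"
  shows "cat_functor (slice C (Dom C f)) (slice C (Cod C f)) (slice_sum C f)"
proof (intro cat_functor.intro slice_category cat_functor_axioms.intro)
  let ?A = "slice C (Dom C f)" and ?B = "slice C (Cod C f)"
  show "fob (slice_sum C f) a \<in> Obj ?B" if "a \<in> Obj ?A" for a
    using that f by (simp add: slice_def)
  show "far (slice_sum C f) h \<in> hom ?B (fob (slice_sum C f) a) (fob (slice_sum C f) b)"
    if h: "h \<in> hom ?A a b" for h a b
    by (rule hom_sliceE[OF h]) (use f in \<open>simp add: in_hom_slice_tuple\<close>)
  show "far (slice_sum C f) (Ident ?A a) = Ident ?B (fob (slice_sum C f) a)" if "a \<in> Obj ?A" for a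
    using that f by (simp add: slice_def)
  show "far (slice_sum C f) (g \<cdot>\<^bsub>?A\<^esub> h) = far (slice_sum C f) g \<cdot>\<^bsub>?B\<^esub> far (slice_sum C f) h"
    if gh: "h \<in> hom ?A a b" "g \<in> hom ?A b c" for g h a b c
    by (rule hom_sliceE[OF gh(1)], rule hom_sliceE[OF gh(2)]) (use f in simp)
qed

text \<open>For a functor \<open>\<Delta>\<close> from the slice over the codomain of \<open>f\<close> to the slice over its domain: \<open>\<Delta> b\<close> is one
projection of a pullback of \<open>f\<close> and \<open>b\<close>, the map \<open>k b\<close> is the other one, and \<open>\<Delta>\<close> acts on arrows by the
induced maps.\<close>

definition pullback_functor where
  "pullback_functor f \<Delta> k \<longleftrightarrow> f \<in> Arr C \<and>
    (\<forall>b \<in> Arr C. Cod C b = Cod C f \<longrightarrow> is_pullback C f b (fob \<Delta> b) (k b)) \<and>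
    (\<forall>b b' h. (b, b', h) \<in> hom (slice C (Cod C f)) b b' \<longrightarrow>
      (\<exists>h'. far \<Delta> (b, b', h) = (fob \<Delta> b, fob \<Delta> b', h') \<and> h' \<in> Arr C \<and>
        Dom C h' = Dom C (fob \<Delta> b) \<and> Cod C h' = Dom C (fob \<Delta> b') \<and>
        fob \<Delta> b' \<cdot> h' = fob \<Delta> b \<and> k b' \<cdot> h' = h \<cdot> k b))"

lemma slice_Obj [simp]: "a \<in> Obj (slice C X) \<longleftrightarrow> a \<in> Arr C \<and> Cod C a = X"
  by (auto simp: slice_def)

text \<open>An arrow \<open>\<Sigma>\<^sub>f v \<rightarrow> b\<close> of the slice is a map \<open>w\<close> with \<open>f v = b w\<close>, that is, a cone over the cospan
\<open>(f, b)\<close>. The universal property of the counit at \<open>b\<close> is therefore the one of a pullback.\<close>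

lemma adjoint_pullback_functor:
  assumes f: "f \<in> Arr C"
    and adj: "adjoint (slice C (Dom C f)) (slice C (Cod C f)) (slice_sum C f) \<Delta>"
  obtains k where "pullback_functor f \<Delta> k"
proof -
  let ?A = "slice C (Dom C f)" and ?B = "slice C (Cod C f)"
  interpret \<Delta>: cat_functor ?B ?A \<Delta> using adj by (simp add: adjoint_def)
  obtain e where u: "\<And>b. b \<in> Obj ?B \<Longrightarrow> universal_arrow ?A ?B (slice_sum C f) b (fob \<Delta> b) (e b)"
    and nat: "\<And>b b' y. y \<in> hom ?B b b' \<Longrightarrow>
      e b' \<cdot>\<^bsub>?B\<^esub> far (slice_sum C f) (far \<Delta> y) = y \<cdot>\<^bsub>?B\<^esub> e b"
    using adjoint_counit[OF adj] by metis
  define k where "k b = snd (snd (e b))" for b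
  have \<Delta>b: "fob \<Delta> b \<in> Arr C" "Cod C (fob \<Delta> b) = Dom C f"
    if "b \<in> Arr C" "Cod C b = Cod C f" for b
    using \<Delta>.fob_obj[of b] that by auto
  have e: "e b = (f \<cdot> fob \<Delta> b, b, k b) \<and> k b \<in> Arr C \<and> Dom C (k b) = Dom C (fob \<Delta> b) \<and>
      Cod C (k b) = Dom C b \<and> b \<cdot> k b = f \<cdot> fob \<Delta> b"
    if b: "b \<in> Arr C" "Cod C b = Cod C f" for b
  proof -
    have "e b \<in> hom ?B (fob (slice_sum C f) (fob \<Delta> b)) b"
      using u[of b] b by (simp add: universal_arrow_def)
    then show ?thesis using \<Delta>b[OF b] f by (simp add: in_hom_slice k_def)
  qed
  have "pullback_functor f \<Delta> k"
    unfolding pullback_functor_def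
  proof (intro conjI ballI allI impI f)
    fix b assume b: "b \<in> Arr C" "Cod C b = Cod C f"
    note t = \<Delta>b[OF b] e[OF b] b f
    show "is_pullback C f b (fob \<Delta> b) (k b)"
    proof (rule pullbackI)
      fix v w assume vw: "v \<in> Arr C" "w \<in> Arr C" "Dom C v = Dom C w" "Cod C v = Dom C f"
        "Cod C w = Dom C b" "f \<cdot> v = b \<cdot> w"
      have "(f \<cdot> v, b, w) \<in> hom ?B (fob (slice_sum C f) v) b"
        using vw t by (simp add: in_hom_slice_tuple)
      then have "\<exists>h. h \<in> hom ?A v (fob \<Delta> b) \<and> e b \<cdot>\<^bsub>?B\<^esub> far (slice_sum C f) h = (f \<cdot> v, b, w)"
        using ex1_implies_ex[OF universal_arrow_ex1[OF u[of b], of v "(f \<cdot> v, b, w)"]] b vw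
        by simp
      then obtain h where h: "h \<in> hom ?A v (fob \<Delta> b)"
        "e b \<cdot>\<^bsub>?B\<^esub> far (slice_sum C f) h = (f \<cdot> v, b, w)" by blast
      show "\<exists>h. h \<in> Arr C \<and> Dom C h = Dom C v \<and> Cod C h = Dom C (fob \<Delta> b) \<and>
          fob \<Delta> b \<cdot> h = v \<and> k b \<cdot> h = w"
        by (rule hom_sliceE[OF h(1)]) (use h(2) t in \<open>auto\<close>)
    next
      fix h h' assume hh: "h \<in> Arr C" "h' \<in> Arr C" "Dom C h = Dom C h'"
        "Cod C h = Dom C (fob \<Delta> b)" "Cod C h' = Dom C (fob \<Delta> b)"
        "fob \<Delta> b \<cdot> h = fob \<Delta> b \<cdot> h'" "k b \<cdot> h = k b \<cdot> h'"
      define v where "v = fob \<Delta> b \<cdot> h"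
      have v: "v \<in> Arr C" "Cod C v = Dom C f" using hh t by (auto simp: v_def)
      have "(f \<cdot> v, b, k b \<cdot> h) \<in> hom ?B (fob (slice_sum C f) v) b"
        using v hh t by (simp add: in_hom_slice_tuple v_def) (rule square_comp; simp)
      then have ex1: "\<exists>!l. l \<in> hom ?A v (fob \<Delta> b) \<and>
          e b \<cdot>\<^bsub>?B\<^esub> far (slice_sum C f) l = (f \<cdot> v, b, k b \<cdot> h)"
        using universal_arrow_ex1[OF u[of b], of v "(f \<cdot> v, b, k b \<cdot> h)"] b v by auto
      have "(v, fob \<Delta> b, h) \<in> hom ?A v (fob \<Delta> b)" "(v, fob \<Delta> b, h') \<in> hom ?A v (fob \<Delta> b)"
        using hh t v by (simp_all add: in_hom_slice_tuple v_def)
      moreover have "e b \<cdot>\<^bsub>?B\<^esub> far (slice_sum C f) (v, fob \<Delta> b, h) = (f \<cdot> v, b, k b \<cdot> h)"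
        "e b \<cdot>\<^bsub>?B\<^esub> far (slice_sum C f) (v, fob \<Delta> b, h') = (f \<cdot> v, b, k b \<cdot> h)"
        using hh t v by (simp_all add: v_def)
      ultimately have "(v, fob \<Delta> b, h) = (v, fob \<Delta> b, h')" using ex1 by blast
      then show "h = h'" by simp
    qed (use t in simp_all)
  next
    fix b b' h assume h: "(b, b', h) \<in> hom ?B b b'"
    then have b: "b \<in> Arr C" "Cod C b = Cod C f" "b' \<in> Arr C" "Cod C b' = Cod C f"
      by (auto simp: in_hom_slice_tuple)
    show "\<exists>h'. far \<Delta> (b, b', h) = (fob \<Delta> b, fob \<Delta> b', h') \<and> h' \<in> Arr C \<and>
        Dom C h' = Dom C (fob \<Delta> b) \<and> Cod C h' = Dom C (fob \<Delta> b') \<and>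
        fob \<Delta> b' \<cdot> h' = fob \<Delta> b \<and> k b' \<cdot> h' = h \<cdot> k b"
    proof (rule hom_sliceE[OF \<Delta>.far_hom[OF h]])
      fix h' assume h': "far \<Delta> (b, b', h) = (fob \<Delta> b, fob \<Delta> b', h')" "h' \<in> Arr C"
        "Dom C h' = Dom C (fob \<Delta> b)" "Cod C h' = Dom C (fob \<Delta> b')" "fob \<Delta> b' \<cdot> h' = fob \<Delta> b"
      have "k b' \<cdot> h' = h \<cdot> k b"
        using nat[OF h] e[OF b(1,2)] e[OF b(3,4)] h'(1) by simp
      then show ?thesis using h' by blast
    qed
  qed
  then show thesis by (rule that)
qed

text \<open>A distributivity pullback around \<open>(f, x)\<close> is a terminal object of the category with objects
\<open>dist_cone\<close> and morphisms \<open>dist_cone_mor\<close>. In the definition of \<open>dist_pullback\<close> uniqueness is demanded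
of the component \<open>t\<close> only, because \<open>s\<close> is determined by \<open>t\<close> (see \<open>dist_pullback_unique\<close>).\<close>

definition dist_cone where
  "dist_cone f x p q r \<longleftrightarrow> x \<in> Arr C \<and> p \<in> Arr C \<and> Cod C p = Dom C x \<and> Cod C x = Dom C f \<and>
    is_pullback C f r (x \<cdot> p) q"

definition dist_cone_mor where
  "dist_cone_mor p' q' r' p q r s t \<longleftrightarrow> s \<in> Arr C \<and> t \<in> Arr C \<and>
    Dom C s = Dom C p' \<and> Cod C s = Dom C p \<and> Dom C t = Dom C r' \<and> Cod C t = Dom C r \<and>
    p \<cdot> s = p' \<and> q \<cdot> s = t \<cdot> q' \<and> r \<cdot> t = r'"

definition dist_pullback where
  "dist_pullback f x p q r \<longleftrightarrow> dist_cone f x p q r \<and>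
    (\<forall>p' q' r'. dist_cone f x p' q' r' \<longrightarrow>
      (\<exists>s t. dist_cone_mor p' q' r' p q r s t) \<and>
      (\<forall>s t s' t'. dist_cone_mor p' q' r' p q r s t \<longrightarrow> dist_cone_mor p' q' r' p q r s' t' \<longrightarrow> t = t'))"

definition has_dist_pullbacks where
  "has_dist_pullbacks f \<longleftrightarrow> f \<in> Arr C \<and>
    (\<forall>x \<in> Arr C. Cod C x = Dom C f \<longrightarrow> (\<exists>p q r. dist_pullback f x p q r))"

lemma dist_coneD:
  assumes "dist_cone f x p q r"
  shows "x \<in> Arr C" "p \<in> Arr C" "Cod C p = Dom C x" "Cod C x = Dom C f" "f \<in> Arr C" "q \<in> Arr C"
    "r \<in> Arr C" "Cod C f = Cod C r" "Cod C q = Dom C r" "Dom C p = Dom C q" "f \<cdot> (x \<cdot> p) = r \<cdot> q"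
    "is_pullback C f r (x \<cdot> p) q"
  using assms pullback_square[of f r "x \<cdot> p" q] unfolding dist_cone_def
  by (elim conjE; simp)+

lemma dist_pullback_lift:
  assumes "dist_pullback f x p q r" "dist_cone f x p' q' r'"
  obtains s t where "s \<in> Arr C" "t \<in> Arr C" "Dom C s = Dom C p'" "Cod C s = Dom C p"
    "Dom C t = Dom C r'" "Cod C t = Dom C r" "p \<cdot> s = p'" "q \<cdot> s = t \<cdot> q'" "r \<cdot> t = r'"
  using assms unfolding dist_pullback_def dist_cone_mor_def by blast

lemma dist_pullback_unique:
  assumes "dist_pullback f x p q r" "dist_cone f x p' q' r'"
    "dist_cone_mor p' q' r' p q r s t" "dist_cone_mor p' q' r' p q r s' t'"
  shows "s = s'" "t = t'"
proof -
  show t: "t = t'" using assms unfolding dist_pullback_def by blast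
  have c: "dist_cone f x p q r" using assms(1) by (simp add: dist_pullback_def)
  note d = dist_coneD[OF c] dist_coneD[OF assms(2)]
  note m = assms(3,4)[unfolded dist_cone_mor_def]
  show "s = s'"
    by (rule pullback_unique[OF d(12)]) (use d(1-10) m t in simp_all)
qed

text \<open>The distributivity pullback around \<open>(f, x)\<close> is \<open>\<Pi> x\<close>, together with its pullback along \<open>f\<close> and the counit
\<open>\<Delta> (\<Pi> x) \<rightarrow> x\<close>: a distributivity cone with third component \<open>r'\<close> amounts to an arrow \<open>\<Delta> r' \<rightarrow> x\<close> of the
slice, once its pullback square is identified with the one chosen by \<open>\<Delta>\<close>.\<close>

lemma exponentiable_dist_pullbacks:
  assumes "exponentiable C f"
  shows "has_dist_pullbacks f"
  unfolding has_dist_pullbacks_def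
proof (intro conjI ballI impI)
  show f: "f \<in> Arr C" using assms by (simp add: exponentiable_def)
  fix x assume x: "x \<in> Arr C" "Cod C x = Dom C f"
  let ?A = "slice C (Dom C f)" and ?B = "slice C (Cod C f)"
  obtain \<Delta> \<Pi> where adj: "adjoint ?A ?B (slice_sum C f) \<Delta>" "adjoint ?B ?A \<Delta> \<Pi>"
    using assms by (auto simp: exponentiable_def)
  obtain k where k: "pullback_functor f \<Delta> k" using adjoint_pullback_functor[OF f adj(1)] .
  obtain e where u: "universal_arrow ?B ?A \<Delta> x (fob \<Pi> x) e"
    using adjoint_counit[OF adj(2)] x slice_Obj by metis
  define r where "r = fob \<Pi> x"
  have pb: "is_pullback C f b (fob \<Delta> b) (k b)" if "b \<in> Arr C" "Cod C b = Cod C f" for b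
    using k that by (simp add: pullback_functor_def)
  have r: "r \<in> Arr C" "Cod C r = Cod C f" using u by (auto simp: universal_arrow_def r_def)
  have "e \<in> hom ?A (fob \<Delta> r) x" using u by (simp add: universal_arrow_def r_def)
  then obtain p where p: "e = (fob \<Delta> r, x, p)" "p \<in> Arr C" "Dom C p = Dom C (fob \<Delta> r)"
    "Cod C p = Dom C x" "x \<cdot> p = fob \<Delta> r" by (rule hom_sliceE)
  note pbr = pb[OF r] and sr = pullback_square[OF pb[OF r]]
  have cone: "dist_cone f x p (k r) r" using p x pbr by (simp add: dist_cone_def)
  have "dist_pullback f x p (k r) r"
    unfolding dist_pullback_def
  proof (intro conjI allI impI)
    show "dist_cone f x p (k r) r" by (fact cone)
    fix p' q' r' assume c': "dist_cone f x p' q' r'"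
    note d' = dist_coneD[OF c']
    have r': "r' \<in> Arr C" "Cod C r' = Cod C f" using d' by auto
    note pbr' = pb[OF r'] and sr' = pullback_square[OF pb[OF r']]
    \<comment> \<open>The maps \<open>i\<close> and \<open>j\<close> compare the pullback of the cone with the one chosen by \<open>\<Delta>\<close>.\<close>
    obtain i where i: "i \<in> Arr C" "Dom C i = Dom C (fob \<Delta> r')" "Cod C i = Dom C p'"
        "x \<cdot> (p' \<cdot> i) = fob \<Delta> r'" "q' \<cdot> i = k r'"
      using pullback_lift[OF d'(12), of "fob \<Delta> r'" "k r'"] d'(1-10) sr' by auto
    obtain j where j: "j \<in> Arr C" "Dom C j = Dom C p'" "Cod C j = Dom C (fob \<Delta> r')"
        "fob \<Delta> r' \<cdot> j = x \<cdot> p'" "k r' \<cdot> j = q'"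
      using pullback_lift[OF pbr', of "x \<cdot> p'" q'] d'(1-11) sr' by auto
    have e: "x \<cdot> (p' \<cdot> (i \<cdot> j)) = x \<cdot> p'" "q' \<cdot> (i \<cdot> j) = q'"
      using triangle_comp[of "x \<cdot> p'" i "fob \<Delta> r'" j] triangle_comp[OF i(5), of j] d'(1-10) i j
      by simp_all
    have ij: "i \<cdot> j = Ident C (Dom C p')"
      by (rule pullback_unique[OF d'(12)]) (use d'(1-10) i j e in simp_all)
    have "(fob \<Delta> r', x, p' \<cdot> i) \<in> hom ?A (fob \<Delta> r') x"
      using x d' i sr' by (simp add: in_hom_slice_tuple)
    then have ex1: "\<exists>!h. h \<in> hom ?B r' r \<and> e \<cdot>\<^bsub>?A\<^esub> far \<Delta> h = (fob \<Delta> r', x, p' \<cdot> i)"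
      using universal_arrow_ex1[OF u, of r'] r' unfolding r_def by auto
    show "\<exists>s t. dist_cone_mor p' q' r' p (k r) r s t"
    proof -
      obtain h where h: "h \<in> hom ?B r' r" "e \<cdot>\<^bsub>?A\<^esub> far \<Delta> h = (fob \<Delta> r', x, p' \<cdot> i)"
        using ex1 by blast
      obtain t where t: "h = (r', r, t)" "t \<in> Arr C" "Dom C t = Dom C r'" "Cod C t = Dom C r"
        "r \<cdot> t = r'" using h(1) by (rule hom_sliceE)
      obtain h' where h': "far \<Delta> h = (fob \<Delta> r', fob \<Delta> r, h')" "h' \<in> Arr C"
        "Dom C h' = Dom C (fob \<Delta> r')" "Cod C h' = Dom C (fob \<Delta> r)" "fob \<Delta> r \<cdot> h' = fob \<Delta> r'"
        "k r \<cdot> h' = t \<cdot> k r'"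
        using k h(1) unfolding pullback_functor_def t(1) by metis
      have ph: "p \<cdot> h' = p' \<cdot> i" using h(2) h'(1) p(1) by simp
      have "p \<cdot> (h' \<cdot> j) = p'"
        using triangle_comp[OF ph, of j] p h' j i ij d' by simp
      moreover have "k r \<cdot> (h' \<cdot> j) = t \<cdot> q'"
        using square_comp[OF h'(6), of j] t sr sr' h' j r by simp
      ultimately have "dist_cone_mor p' q' r' p (k r) r (h' \<cdot> j) t"
        using t h' j p by (simp add: dist_cone_mor_def)
      then show ?thesis by blast
    qed
    show "t = t2" if m: "dist_cone_mor p' q' r' p (k r) r s t"
      and m2: "dist_cone_mor p' q' r' p (k r) r s2 t2" for s t s2 t2
    proof -
      have *: "(r', r, t) \<in> hom ?B r' r \<and> e \<cdot>\<^bsub>?A\<^esub> far \<Delta> (r', r, t) = (fob \<Delta> r', x, p' \<cdot> i)"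
        if m: "dist_cone_mor p' q' r' p (k r) r s t" for s t
      proof -
        note m = m[unfolded dist_cone_mor_def]
        have t: "(r', r, t) \<in> hom ?B r' r" using m r r' by (simp add: in_hom_slice_tuple)
        obtain h' where h': "far \<Delta> (r', r, t) = (fob \<Delta> r', fob \<Delta> r, h')" "h' \<in> Arr C"
          "Dom C h' = Dom C (fob \<Delta> r')" "Cod C h' = Dom C (fob \<Delta> r)" "fob \<Delta> r \<cdot> h' = fob \<Delta> r'"
          "k r \<cdot> h' = t \<cdot> k r'"
          using k t unfolding pullback_functor_def by metis
        have e1: "fob \<Delta> r \<cdot> (s \<cdot> i) = fob \<Delta> r'"
        proof -
          have "p \<cdot> (s \<cdot> i) = p' \<cdot> i" using m i p by (simp add: triangle_comp[of p s p'])
          then have "(x \<cdot> p) \<cdot> (s \<cdot> i) = fob \<Delta> r'" using m i p(2-4) x d'(1-4) by simp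
          then show ?thesis by (simp only: p(5))
        qed
        have e2: "k r \<cdot> (s \<cdot> i) = t \<cdot> k r'"
          using square_comp[of "k r" s t q' i] m i sr p d'(1-10) by simp
        have "h' = s \<cdot> i"
          by (rule pullback_unique[OF pbr]) (use h' e1 e2 m i p in simp_all)
        then have "p \<cdot> h' = p' \<cdot> i" using m i p by (simp add: triangle_comp[of p s p'])
        then show ?thesis using t h' p(1) by simp
      qed
      show ?thesis using ex1 *[OF m] *[OF m2] by blast
    qed
  qed
  then show "\<exists>p q r. dist_pullback f x p q r" by blast
qed

end

context pb_category
begin

lemma pullback_functor_exists:
  assumes f: "f \<in> Arr C"
  obtains \<Delta> k where "adjoint (slice C (Dom C f)) (slice C (Cod C f)) (slice_sum C f) \<Delta>"
    "pullback_functor f \<Delta> k"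
proof -
  let ?A = "slice C (Dom C f)" and ?B = "slice C (Cod C f)"
  have "\<exists>pq. b \<in> Arr C \<and> Cod C b = Cod C f \<longrightarrow> is_pullback C f b (fst pq) (snd pq)" for b
    using obtain_pullback[OF f] by (metis fst_conv snd_conv)
  then obtain pq where pq: "\<And>b. b \<in> Arr C \<and> Cod C b = Cod C f \<longrightarrow>
      is_pullback C f b (fst (pq b)) (snd (pq b))" by metis
  define c k where "c b = fst (pq b)" and "k b = snd (pq b)" for b
  have pb: "is_pullback C f b (c b) (k b)" if "b \<in> Arr C" "Cod C b = Cod C f" for b
    using pq that by (simp add: c_def k_def)
  have "universal_arrow ?A ?B (slice_sum C f) b (c b) (f \<cdot> c b, b, k b)" if b: "b \<in> Obj ?B" for b
    unfolding universal_arrow_def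
  proof (intro conjI ballI)
    have b: "b \<in> Arr C" "Cod C b = Cod C f" using b by auto
    note s = pullback_square[OF pb[OF b]]
    show "c b \<in> Obj ?A" using s by simp
    show "(f \<cdot> c b, b, k b) \<in> hom ?B (fob (slice_sum C f) (c b)) b"
      using s b by (simp add: in_hom_slice_tuple)
    fix a g assume "a \<in> Obj ?A" and g: "g \<in> hom ?B (fob (slice_sum C f) a) b"
    then have a: "a \<in> Arr C" "Cod C a = Dom C f" by auto
    obtain v where v: "g = (f \<cdot> a, b, v)" "v \<in> Arr C" "Dom C v = Dom C a" "Cod C v = Dom C b"
      "b \<cdot> v = f \<cdot> a" by (rule hom_sliceE[OF g]) (use a f in simp)
    obtain h where h: "h \<in> Arr C" "Dom C h = Dom C a" "Cod C h = Dom C (c b)" "c b \<cdot> h = a"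
        "k b \<cdot> h = v"
      using pullback_lift[OF pb[OF b], of a v] a v by auto
    show "\<exists>!h. h \<in> hom ?A a (c b) \<and> (f \<cdot> c b, b, k b) \<cdot>\<^bsub>?B\<^esub> far (slice_sum C f) h = g"
    proof (rule ex1I[of _ "(a, c b, h)"])
      show "(a, c b, h) \<in> hom ?A a (c b) \<and>
          (f \<cdot> c b, b, k b) \<cdot>\<^bsub>?B\<^esub> far (slice_sum C f) (a, c b, h) = g"
        using h a s v by (simp add: in_hom_slice_tuple)
      fix l assume l: "l \<in> hom ?A a (c b) \<and> (f \<cdot> c b, b, k b) \<cdot>\<^bsub>?B\<^esub> far (slice_sum C f) l = g"
      then obtain l' where l': "l = (a, c b, l')" "l' \<in> Arr C" "Dom C l' = Dom C a"
        "Cod C l' = Dom C (c b)" "c b \<cdot> l' = a" by (blast elim: hom_sliceE)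
      have "l' = h" by (rule pullback_unique[OF pb[OF b]]) (use l l' h v in simp_all)
      then show "l = (a, c b, h)" using l' by simp
    qed
  qed
  then obtain \<Delta> where \<Delta>: "adjoint ?A ?B (slice_sum C f) \<Delta>" "\<And>b. fob \<Delta> b = c b"
    "\<And>b b' y. y \<in> hom ?B b b' \<Longrightarrow> far \<Delta> y \<in> hom ?A (c b) (c b') \<and>
      (f \<cdot> c b', b', k b') \<cdot>\<^bsub>?B\<^esub> far (slice_sum C f) (far \<Delta> y) = y \<cdot>\<^bsub>?B\<^esub> (f \<cdot> c b, b, k b)"
    using adjoint_from_universal_arrows[OF slice_sum_functor[OF f], of c "\<lambda>b. (f \<cdot> c b, b, k b)"]
    by metis
  have "pullback_functor f \<Delta> k"
    unfolding pullback_functor_def \<Delta>(2)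
  proof (intro conjI ballI allI impI f)
    fix b b' h assume h: "(b, b', h) \<in> hom ?B b b'"
    have far: "far \<Delta> (b, b', h) \<in> hom ?A (c b) (c b')"
      "(f \<cdot> c b', b', k b') \<cdot>\<^bsub>?B\<^esub> far (slice_sum C f) (far \<Delta> (b, b', h)) =
        (b, b', h) \<cdot>\<^bsub>?B\<^esub> (f \<cdot> c b, b, k b)" using \<Delta>(3)[OF h] by auto
    show "\<exists>h'. far \<Delta> (b, b', h) = (c b, c b', h') \<and> h' \<in> Arr C \<and>
        Dom C h' = Dom C (c b) \<and> Cod C h' = Dom C (c b') \<and> c b' \<cdot> h' = c b \<and> k b' \<cdot> h' = h \<cdot> k b"
      by (rule hom_sliceE[OF far(1)]) (use far(2) in auto)
  qed (use pb in blast)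
  then show thesis using that \<Delta>(1) by blast
qed

text \<open>Conversely, if the cone \<open>(p, q, r)\<close> is a distributivity pullback around \<open>(f, x)\<close>, then \<open>p\<close> gives, after
the identification \<open>j\<close> of the chosen pullback of \<open>r\<close> with the given one, a universal arrow from the
pullback functor to \<open>x\<close>. Thus \<open>\<Pi> x = r\<close>.\<close>

lemma dist_pullbacks_exponentiable:
  assumes "has_dist_pullbacks f"
  shows "exponentiable C f"
proof -
  have f: "f \<in> Arr C" using assms by (simp add: has_dist_pullbacks_def)
  let ?A = "slice C (Dom C f)" and ?B = "slice C (Cod C f)"
  obtain \<Delta> k where adj: "adjoint ?A ?B (slice_sum C f) \<Delta>" and k: "pullback_functor f \<Delta> k"
    by (rule pullback_functor_exists[OF f])
  have pb: "is_pullback C f b (fob \<Delta> b) (k b)" if "b \<in> Arr C" "Cod C b = Cod C f" for b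
    using k that by (simp add: pullback_functor_def)
  have "\<exists>r e. universal_arrow ?B ?A \<Delta> x r e" if x: "x \<in> Obj ?A" for x
  proof -
    have x: "x \<in> Arr C" "Cod C x = Dom C f" using x by auto
    obtain p q r where d: "dist_pullback f x p q r"
      using assms x unfolding has_dist_pullbacks_def by blast
    then have c: "dist_cone f x p q r" by (simp add: dist_pullback_def)
    note D = dist_coneD[OF c]
    have r: "r \<in> Arr C" "Cod C r = Cod C f" using D by simp_all
    note sr = pullback_square[OF pb[OF r]]
    obtain j where j: "j \<in> Arr C" "Dom C j = Dom C (fob \<Delta> r)" "Cod C j = Dom C p"
        "x \<cdot> (p \<cdot> j) = fob \<Delta> r" "q \<cdot> j = k r"
      using pullback_lift[OF D(12), of "fob \<Delta> r" "k r"] D(1-10) sr by auto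
    have "universal_arrow ?B ?A \<Delta> x r (fob \<Delta> r, x, p \<cdot> j)"
      unfolding universal_arrow_def
    proof (intro conjI ballI)
      show "r \<in> Obj ?B" using r by simp
      show "(fob \<Delta> r, x, p \<cdot> j) \<in> hom ?A (fob \<Delta> r) x"
        using x sr j D(1-10) by (simp add: in_hom_slice_tuple)
      fix b g assume "b \<in> Obj ?B" and g: "g \<in> hom ?A (fob \<Delta> b) x"
      then have b: "b \<in> Arr C" "Cod C b = Cod C f" by auto
      note sb = pullback_square[OF pb[OF b]]
      obtain g' where g': "g = (fob \<Delta> b, x, g')" "g' \<in> Arr C" "Dom C g' = Dom C (fob \<Delta> b)"
        "Cod C g' = Dom C x" "x \<cdot> g' = fob \<Delta> b" using g by (rule hom_sliceE)
      have cb: "dist_cone f x g' (k b) b" using g' x pb[OF b] by (simp add: dist_cone_def)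
      have mor: "dist_cone_mor g' (k b) b p q r s t \<Longrightarrow> p \<cdot> (j \<cdot> h') = g'"
        if h': "h' \<in> Arr C" "Dom C h' = Dom C (fob \<Delta> b)" "Cod C h' = Dom C (fob \<Delta> r)"
          "fob \<Delta> r \<cdot> h' = fob \<Delta> b" "k r \<cdot> h' = t \<cdot> k b" for s t h'
      proof -
        assume m: "dist_cone_mor g' (k b) b p q r s t"
        note m = m[unfolded dist_cone_mor_def]
        have e1: "x \<cdot> (p \<cdot> (j \<cdot> h')) = fob \<Delta> b" "q \<cdot> (j \<cdot> h') = t \<cdot> k b"
          using triangle_comp[of "x \<cdot> p" j "fob \<Delta> r" h'] triangle_comp[OF j(5), of h'] D(1-10) j h'
          by simp_all
        have "j \<cdot> h' = s"
          by (rule pullback_unique[OF D(12)]) (use m h' j D(1-10) e1 g' in simp_all)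
        then show "p \<cdot> (j \<cdot> h') = g'" using m by simp
      qed
      obtain s t where st: "s \<in> Arr C" "t \<in> Arr C" "Dom C s = Dom C g'" "Cod C s = Dom C p"
        "Dom C t = Dom C b" "Cod C t = Dom C r" "p \<cdot> s = g'" "q \<cdot> s = t \<cdot> k b" "r \<cdot> t = b"
        by (rule dist_pullback_lift[OF d cb])
      have far: "\<exists>h'. far \<Delta> (b, r, t) = (fob \<Delta> b, fob \<Delta> r, h') \<and> h' \<in> Arr C \<and>
          Dom C h' = Dom C (fob \<Delta> b) \<and> Cod C h' = Dom C (fob \<Delta> r) \<and>
          fob \<Delta> r \<cdot> h' = fob \<Delta> b \<and> k r \<cdot> h' = t \<cdot> k b"
        if "(b, r, t) \<in> hom ?B b r" for t
        using k that unfolding pullback_functor_def by blast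
      show "\<exists>!h. h \<in> hom ?B b r \<and> (fob \<Delta> r, x, p \<cdot> j) \<cdot>\<^bsub>?A\<^esub> far \<Delta> h = g"
      proof (rule ex1I[of _ "(b, r, t)"])
        have t: "(b, r, t) \<in> hom ?B b r" using st b r by (simp add: in_hom_slice_tuple)
        obtain h' where h': "far \<Delta> (b, r, t) = (fob \<Delta> b, fob \<Delta> r, h')" "h' \<in> Arr C"
          "Dom C h' = Dom C (fob \<Delta> b)" "Cod C h' = Dom C (fob \<Delta> r)" "fob \<Delta> r \<cdot> h' = fob \<Delta> b"
          "k r \<cdot> h' = t \<cdot> k b" using far[OF t] by blast
        have "p \<cdot> (j \<cdot> h') = g'"
          by (rule mor[OF h'(2-6)]) (use st in \<open>simp add: dist_cone_mor_def\<close>)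
        then show "(b, r, t) \<in> hom ?B b r \<and>
            (fob \<Delta> r, x, p \<cdot> j) \<cdot>\<^bsub>?A\<^esub> far \<Delta> (b, r, t) = g"
          using t h' g' j D(1-10) by simp
        fix l assume l: "l \<in> hom ?B b r \<and> (fob \<Delta> r, x, p \<cdot> j) \<cdot>\<^bsub>?A\<^esub> far \<Delta> l = g"
        obtain t2 where t2: "l = (b, r, t2)" "t2 \<in> Arr C" "Dom C t2 = Dom C b"
          "Cod C t2 = Dom C r" "r \<cdot> t2 = b" by (rule hom_sliceE[OF conjunct1[OF l]])
        have "(b, r, t2) \<in> hom ?B b r" using l t2(1) by simp
        from far[OF this] obtain h2 where h2: "far \<Delta> (b, r, t2) = (fob \<Delta> b, fob \<Delta> r, h2)"
          "h2 \<in> Arr C" "Dom C h2 = Dom C (fob \<Delta> b)" "Cod C h2 = Dom C (fob \<Delta> r)"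
          "fob \<Delta> r \<cdot> h2 = fob \<Delta> b" "k r \<cdot> h2 = t2 \<cdot> k b" by blast
        have "p \<cdot> (j \<cdot> h2) = g'" using l h2 g' t2(1) j D(1-10) by simp
        moreover have "q \<cdot> (j \<cdot> h2) = t2 \<cdot> k b"
          using triangle_comp[OF j(5), of h2] j h2 D(1-10) by simp
        ultimately have "dist_cone_mor g' (k b) b p q r (j \<cdot> h2) t2"
          using t2 j h2 g' by (simp add: dist_cone_mor_def)
        moreover have "dist_cone_mor g' (k b) b p q r s t" using st by (simp add: dist_cone_mor_def)
        ultimately have "t2 = t" using dist_pullback_unique(2)[OF d cb] by blast
        then show "l = (b, r, t)" using t2 by simp
      qed
    qed
    then show ?thesis by blast
  qed
  then have "\<exists>re. x \<in> Obj ?A \<longrightarrow> universal_arrow ?B ?A \<Delta> x (fst re) (snd re)" for x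
    by (metis fst_conv snd_conv)
  then obtain re where re: "\<And>x. x \<in> Obj ?A \<Longrightarrow> universal_arrow ?B ?A \<Delta> x (fst (re x)) (snd (re x))"
    by metis
  have "cat_functor ?B ?A \<Delta>" using adj by (simp add: adjoint_def)
  then obtain \<Pi> where "adjoint ?B ?A \<Delta> \<Pi>"
    by (rule adjoint_from_universal_arrows[of ?B ?A \<Delta> "\<lambda>x. fst (re x)" "\<lambda>x. snd (re x)"])
      (use re in auto)
  then show ?thesis using f adj unfolding exponentiable_def by blast
qed

lemma exponentiable_iff: "exponentiable C f \<longleftrightarrow> has_dist_pullbacks f"
  using exponentiable_dist_pullbacks dist_pullbacks_exponentiable by blast

end

subsection \<open>Closure of exponentiable maps under composition and pullback\<close>

context pb_category
begin

lemma dist_pullbackI: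
  assumes "dist_cone f x p q r"
    and "\<And>p' q' r'. dist_cone f x p' q' r' \<Longrightarrow> \<exists>s t. dist_cone_mor p' q' r' p q r s t"
    and "\<And>p' q' r' s t s' t'. dist_cone f x p' q' r' \<Longrightarrow> dist_cone_mor p' q' r' p q r s t \<Longrightarrow>
      dist_cone_mor p' q' r' p q r s' t' \<Longrightarrow> t = t'"
  shows "dist_pullback f x p q r"
  using assms unfolding dist_pullback_def by blast

lemma dist_cone_morD:
  assumes "dist_cone_mor p' q' r' p q r s t"
  shows "s \<in> Arr C" "t \<in> Arr C" "Dom C s = Dom C p'" "Cod C s = Dom C p" "Dom C t = Dom C r'"
    "Cod C t = Dom C r" "p \<cdot> s = p'" "q \<cdot> s = t \<cdot> q'" "r \<cdot> t = r'"
  using assms by (simp_all add: dist_cone_mor_def)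

text \<open>In a distributivity cone \<open>(p, q, r)\<close> around \<open>(1, x)\<close> the map \<open>q\<close> is invertible, being a pullback of an
identity. So the cone is determined by the map \<open>p i\<close> from \<open>r\<close> to \<open>x\<close>, where \<open>i\<close> is the
inverse of \<open>q\<close>, and \<open>x\<close> with two identities is a distributivity pullback.\<close>

lemma exponentiable_ident:
  assumes X: "X \<in> Obj C"
  shows "exponentiable C (Ident C X)"
  unfolding exponentiable_iff has_dist_pullbacks_def
proof (intro conjI ballI impI)
  show "Ident C X \<in> Arr C" using X by simp
  fix x assume x: "x \<in> Arr C" "Cod C x = Dom C (Ident C X)"
  then have xX: "Cod C x = X" using X by simp
  let ?Z = "Ident C (Dom C x)"
  have "dist_pullback (Ident C X) x ?Z ?Z x"
  proof (rule dist_pullbackI)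
    show "dist_cone (Ident C X) x ?Z ?Z x"
      using pullback_swap[OF pullback_ident[of x]] x xX X by (simp add: dist_cone_def)
  next
    fix p q r assume c: "dist_cone (Ident C X) x p q r"
    note D = dist_coneD[OF c]
    have xp: "x \<cdot> p = r \<cdot> q" using D X xX by simp
    obtain i where i: "i \<in> Arr C" "Dom C i = Dom C r" "Cod C i = Dom C p"
        "x \<cdot> (p \<cdot> i) = r" "q \<cdot> i = Ident C (Dom C r)"
      using pullback_lift[OF D(12), of r "Ident C (Dom C r)"] D(1-10) X by auto
    have e: "x \<cdot> (p \<cdot> (i \<cdot> q)) = r \<cdot> q" "q \<cdot> (i \<cdot> q) = q"
      using triangle_comp[of "x \<cdot> p" i r q] triangle_comp[OF i(5), of q] D(1-10) i by simp_all
    have iq: "i \<cdot> q = Ident C (Dom C p)"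
      by (rule pullback_unique[OF D(12)]) (use D(1-10) i e xp in simp_all)
    have "dist_cone_mor p q r ?Z ?Z x p (p \<cdot> i)"
      using D(1-10) i iq by (simp add: dist_cone_mor_def)
    then show "\<exists>s t. dist_cone_mor p q r ?Z ?Z x s t" by blast
    have t: "t = p \<cdot> i" if "dist_cone_mor p q r ?Z ?Z x s t" for s t
    proof -
      note m = dist_cone_morD[OF that]
      have "t \<cdot> q = p" using m D(1-10) by auto
      then have "t \<cdot> (q \<cdot> i) = p \<cdot> i"
        using triangle_comp[of t q p i] m D(1-10) i by simp
      then show ?thesis using i(5) m D(1-10) by simp
    qed
    show "t = t'" if "dist_cone_mor p q r ?Z ?Z x s t" "dist_cone_mor p q r ?Z ?Z x s' t'"
      for s t s' t' using t[OF that(1)] t[OF that(2)] by simp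
  qed
  then show "\<exists>p q r. dist_pullback (Ident C X) x p q r" by blast
qed

text \<open>Form the distributivity pullback \<open>(p1, q1, r1)\<close> around \<open>(f, x)\<close>, then \<open>(p2, q2, r2)\<close> around \<open>(g, r1)\<close>, and
paste them along the pullback \<open>(a, b)\<close> of \<open>q1\<close> and \<open>p2\<close>. A cone around \<open>(g f, x)\<close> decomposes in the same
way, because a pullback along \<open>g f\<close> is a pullback along \<open>f\<close> of a pullback along \<open>g\<close>.\<close>

lemma exponentiable_comp:
  assumes f: "exponentiable C f" and g: "exponentiable C g" and fg: "Cod C f = Dom C g"
  shows "exponentiable C (g \<cdot> f)"
  unfolding exponentiable_iff has_dist_pullbacks_def
proof (intro conjI ballI impI)
  have fa: "f \<in> Arr C" "g \<in> Arr C" using f g by (auto simp: exponentiable_def)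
  then show "g \<cdot> f \<in> Arr C" using fg by simp
  fix x assume x: "x \<in> Arr C" "Cod C x = Dom C (g \<cdot> f)"
  then have xf: "Cod C x = Dom C f" using fa fg by simp
  obtain p1 q1 r1 where d1: "dist_pullback f x p1 q1 r1"
    using f x xf unfolding exponentiable_iff has_dist_pullbacks_def by blast
  then have c1: "dist_cone f x p1 q1 r1" by (simp add: dist_pullback_def)
  note D1 = dist_coneD[OF c1]
  obtain p2 q2 r2 where d2: "dist_pullback g r1 p2 q2 r2"
    using g D1(7,8) fg unfolding exponentiable_iff has_dist_pullbacks_def by metis
  then have c2: "dist_cone g r1 p2 q2 r2" by (simp add: dist_pullback_def)
  note D2 = dist_coneD[OF c2]
  obtain a b where ab: "is_pullback C q1 p2 a b"
    using obtain_pullback[of q1 p2] D1(1-10) D2(1-10) by auto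
  note sab = pullback_square[OF ab]
  have pb_ab: "is_pullback C f (r1 \<cdot> p2) (x \<cdot> (p1 \<cdot> a)) b"
    using pullback_paste[OF D1(12) ab] D1(1-10) sab by simp
  have pb3: "is_pullback C (g \<cdot> f) r2 (x \<cdot> (p1 \<cdot> a)) (q2 \<cdot> b)"
    by (rule pullback_paste_across[OF pb_ab D2(12) fg])
  have "dist_pullback (g \<cdot> f) x (p1 \<cdot> a) (q2 \<cdot> b) r2"
  proof (rule dist_pullbackI)
    show "dist_cone (g \<cdot> f) x (p1 \<cdot> a) (q2 \<cdot> b) r2"
      using D1(1-10) sab x pb3 by (simp add: dist_cone_def)
  next
    fix p q r assume c: "dist_cone (g \<cdot> f) x p q r"
    note D = dist_coneD[OF c]
    have cr: "Cod C r = Cod C g" using D fa fg by simp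
    obtain w q'' where W: "is_pullback C g r w q''"
      using obtain_pullback[of g r] D fa cr by metis
    note sW = pullback_square[OF W]
    obtain q' where q': "q' \<in> Arr C" "Dom C q' = Dom C p" "Cod C q' = Dom C w"
        "w \<cdot> q' = f \<cdot> (x \<cdot> p)" "q'' \<cdot> q' = q"
      using pullback_lift[OF W, of "f \<cdot> (x \<cdot> p)" q] D(1-4,6-11) fa fg by auto
    have pb': "is_pullback C f w (x \<cdot> p) q'"
      by (rule pullback_cancel_across[OF W]) (use D(12) q' fa fg sW in simp_all)
    have c1': "dist_cone f x p q' w" using pb' D(1-3) xf by (simp add: dist_cone_def)
    obtain s1 t1 where st1: "s1 \<in> Arr C" "t1 \<in> Arr C" "Dom C s1 = Dom C p" "Cod C s1 = Dom C p1"
      "Dom C t1 = Dom C w" "Cod C t1 = Dom C r1" "p1 \<cdot> s1 = p" "q1 \<cdot> s1 = t1 \<cdot> q'" "r1 \<cdot> t1 = w"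
      by (rule dist_pullback_lift[OF d1 c1'])
    have c2': "dist_cone g r1 t1 q'' r" using W st1 D2(1-4) by (simp add: dist_cone_def)
    obtain s2 t2 where st2: "s2 \<in> Arr C" "t2 \<in> Arr C" "Dom C s2 = Dom C t1" "Cod C s2 = Dom C p2"
      "Dom C t2 = Dom C r" "Cod C t2 = Dom C r2" "p2 \<cdot> s2 = t1" "q2 \<cdot> s2 = t2 \<cdot> q''" "r2 \<cdot> t2 = r"
      by (rule dist_pullback_lift[OF d2 c2'])
    have "q1 \<cdot> s1 = p2 \<cdot> (s2 \<cdot> q')"
      using triangle_comp[OF st2(7), of q'] st1 st2 D2(1-10) q' by simp
    then obtain s where s: "s \<in> Arr C" "Dom C s = Dom C s1" "Cod C s = Dom C a" "a \<cdot> s = s1"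
        "b \<cdot> s = s2 \<cdot> q'"
      using pullback_lift[OF ab, of s1 "s2 \<cdot> q'"] st1 st2 D1(1-10) D2(1-10) q' by auto
    have "q2 \<cdot> (s2 \<cdot> q') = t2 \<cdot> q"
      using square_comp[OF st2(8), of q'] st1 st2 D2(1-10) q' sW by simp
    then have "dist_cone_mor p q r (p1 \<cdot> a) (q2 \<cdot> b) r2 s t2"
      using s st1 st2 sab D1(1-10) D2(1-10) by (simp add: dist_cone_mor_def)
    then show "\<exists>s t. dist_cone_mor p q r (p1 \<cdot> a) (q2 \<cdot> b) r2 s t" by blast
    have t: "t = t2" if "dist_cone_mor p q r (p1 \<cdot> a) (q2 \<cdot> b) r2 s t" for s t
    proof -
      have m: "s \<in> Arr C" "t \<in> Arr C" "Dom C s = Dom C p" "Cod C s = Dom C b"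
        "Dom C t = Dom C r" "Cod C t = Dom C r2" "p1 \<cdot> (a \<cdot> s) = p" "q2 \<cdot> (b \<cdot> s) = t \<cdot> q" "r2 \<cdot> t = r"
        using dist_cone_morD[OF that] sab D1(1-10) D2(1-10) by simp_all
      have "g \<cdot> w = r2 \<cdot> (t \<cdot> q'')"
        using triangle_comp[OF m(9), of q''] m sW D2(1-10) by simp
      \<comment> \<open>The morphism into the pasted cone is split at the pullback \<open>w\<close> of \<open>r\<close> along \<open>g\<close>.\<close>
      then obtain s2' where s2': "s2' \<in> Arr C" "Dom C s2' = Dom C w" "Cod C s2' = Dom C p2"
          "r1 \<cdot> (p2 \<cdot> s2') = w" "q2 \<cdot> s2' = t \<cdot> q''"
        using pullback_lift[OF D2(12), of w "t \<cdot> q''"] sW m D2(1-10) by auto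
      have e1: "q2 \<cdot> (s2' \<cdot> q') = t \<cdot> q"
        using square_comp[OF s2'(5), of q'] s2' q' sW m D2(1-10) by simp
      have e2: "r1 \<cdot> (p2 \<cdot> (s2' \<cdot> q')) = f \<cdot> (x \<cdot> p)"
        using triangle_comp[of "r1 \<cdot> p2" s2' w q'] s2' q' D2(1-10) by simp
      have "r1 \<cdot> (p2 \<cdot> (b \<cdot> s)) = r1 \<cdot> (q1 \<cdot> (a \<cdot> s))"
        using square_comp[OF sab(9), of s] m sab D1(1-10) D2(1-10) by simp
      also have "\<dots> = f \<cdot> (x \<cdot> (p1 \<cdot> (a \<cdot> s)))"
        using square_comp[of f "x \<cdot> p1" r1 q1 "a \<cdot> s"] m sab D1(1-11) by simp
      finally have e3: "r1 \<cdot> (p2 \<cdot> (b \<cdot> s)) = f \<cdot> (x \<cdot> p)" using m by simp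
      have bs: "b \<cdot> s = s2' \<cdot> q'"
        by (rule pullback_unique[OF D2(12)]) (use m s2' q' sab D1(1-10) D2(1-10) e1 e2 e3 in simp_all)
      have "q1 \<cdot> (a \<cdot> s) = p2 \<cdot> (b \<cdot> s)"
        using square_comp[OF sab(9), of s] m sab by simp
      then have "dist_cone_mor p q' w p1 q1 r1 (a \<cdot> s) (p2 \<cdot> s2')"
        using m s2' sab D1(1-10) D2(1-10) q' bs by (simp add: dist_cone_mor_def)
      moreover have "dist_cone_mor p q' w p1 q1 r1 s1 t1" using st1 by (simp add: dist_cone_mor_def)
      ultimately have "p2 \<cdot> s2' = t1" using dist_pullback_unique(2)[OF d1 c1'] by blast
      then have "dist_cone_mor t1 q'' r p2 q2 r2 s2' t"
        using m s2' st1 by (simp add: dist_cone_mor_def)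
      moreover have "dist_cone_mor t1 q'' r p2 q2 r2 s2 t2"
        using st2 by (simp add: dist_cone_mor_def)
      ultimately show ?thesis using dist_pullback_unique(2)[OF d2 c2'] by blast
    qed
    show "t = t'" if "dist_cone_mor p q r (p1 \<cdot> a) (q2 \<cdot> b) r2 s t"
      "dist_cone_mor p q r (p1 \<cdot> a) (q2 \<cdot> b) r2 s' t'" for s t s' t'
      using t[OF that(1)] t[OF that(2)] by simp
  qed
  then show "\<exists>p q r. dist_pullback (g \<cdot> f) x p q r" by blast
qed

text \<open>Let \<open>f'\<close> be the pullback of \<open>f\<close> along \<open>g\<close>. A cone around \<open>(f', x)\<close> with third component \<open>u\<close> is a cone
around \<open>(f, g' x)\<close> with third component \<open>g u\<close>, hence a map \<open>t\<close> into the distributivity pullback \<open>Y\<close>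
around \<open>(f, g' x)\<close>. But a general \<open>t\<close> over \<open>g u\<close> describes a map that lies over \<open>P\<close>, the pullback of \<open>f\<close>
and \<open>g\<close>, only after composition with \<open>g'\<close>. The two maps into \<open>P\<close> that have to agree correspond to two maps
\<open>b t\<close> and \<open>d u\<close> into the distributivity pullback \<open>W\<close> around \<open>(f, g')\<close>. So the wanted object
is the pullback of \<open>b\<close> and \<open>d\<close>, where \<open>b : Y \<rightarrow> W\<close> is induced by \<open>x\<close> and \<open>d\<close> by the pullback square
itself.\<close>

lemma exponentiable_pullback:
  assumes f: "exponentiable C f" and pb: "is_pullback C f g g' f'"
  shows "exponentiable C f'"
  unfolding exponentiable_iff has_dist_pullbacks_def
proof (intro conjI ballI impI)
  note S = pullback_square[OF pb]
  show "f' \<in> Arr C" by (fact S)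
  fix x assume x: "x \<in> Arr C" "Cod C x = Dom C f'"
  then have xg: "Cod C x = Dom C g'" using S by simp
  obtain pY qY rY where dY: "dist_pullback f (g' \<cdot> x) pY qY rY"
    using f x xg S(1-8) unfolding exponentiable_iff has_dist_pullbacks_def by force
  then have cY: "dist_cone f (g' \<cdot> x) pY qY rY" by (simp add: dist_pullback_def)
  obtain pW qW rW where dW: "dist_pullback f g' pW qW rW"
    using f S(1-8) unfolding exponentiable_iff has_dist_pullbacks_def by blast
  then have cW: "dist_cone f g' pW qW rW" by (simp add: dist_pullback_def)
  note DY = dist_coneD[OF cY] and DW = dist_coneD[OF cW]
  have DY3: "Cod C pY = Dom C x" using DY(3) x xg S by simp
  have cYW: "dist_cone f g' (x \<cdot> pY) qY rY"
    using DY(2,12) DY3 S(1-8) x xg by (simp add: dist_cone_def)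
  obtain a b where ab: "a \<in> Arr C" "b \<in> Arr C" "Dom C a = Dom C pY" "Cod C a = Dom C pW"
    "Dom C b = Dom C rY" "Cod C b = Dom C rW" "pW \<cdot> a = x \<cdot> pY" "qW \<cdot> a = b \<cdot> qY" "rW \<cdot> b = rY"
    by (rule dist_pullback_lift[OF dW cYW]) (use DY(2) DY3 x in simp)
  have cB: "dist_cone f g' (Ident C (Dom C g')) f' g"
    using pb S(1-8) by (simp add: dist_cone_def)
  obtain c d where cd: "c \<in> Arr C" "d \<in> Arr C" "Dom C c = Dom C g'" "Cod C c = Dom C pW"
    "Dom C d = Dom C g" "Cod C d = Dom C rW" "pW \<cdot> c = Ident C (Dom C g')" "qW \<cdot> c = d \<cdot> f'"
    "rW \<cdot> d = g"
    by (rule dist_pullback_lift[OF dW cB]) (use S in simp)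
  obtain n1 n2 where N: "is_pullback C b d n1 n2"
    using obtain_pullback[of b d] ab cd by auto
  note SN = pullback_square[OF N]
  obtain l q where Q: "is_pullback C f' n2 l q"
    using obtain_pullback[of f' n2] S SN cd by auto
  note SQ = pullback_square[OF Q]
  have n2: "Cod C n2 = Dom C g" "Cod C n1 = Dom C rY" "Cod C l = Dom C g'" "Cod C f' = Dom C g"
    using SN ab cd SQ S by simp_all
  note T = SN(3,4,6) SQ(3,4,6,8) n2 S(2-4,6,7) ab(1-6) cd(1-6) DW(2,3,6,7,9,10) DY(2,6,7,9,10)
    DY3 x(1) xg
  have fg'l: "f \<cdot> (g' \<cdot> l) = g \<cdot> (n2 \<cdot> q)"
    using square_comp[OF S(9), of l] SQ(9) T S(1,5,8) by simp
  have "rY \<cdot> n1 = rW \<cdot> (b \<cdot> n1)" using triangle_comp[OF ab(9), of n1] T by simp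
  also have "\<dots> = g \<cdot> n2" using SN(9) triangle_comp[OF cd(9), of n2] T by simp
  finally have "rY \<cdot> (n1 \<cdot> q) = g \<cdot> (n2 \<cdot> q)"
    using square_comp[of rY n1 g n2 q] T by simp
  then obtain s where s: "s \<in> Arr C" "Dom C s = Dom C q" "Cod C s = Dom C pY"
      "g' \<cdot> (x \<cdot> (pY \<cdot> s)) = g' \<cdot> l" "qY \<cdot> s = n1 \<cdot> q"
    using pullback_lift[OF DY(12), of "g' \<cdot> l" "n1 \<cdot> q"] fg'l T S(1) DY(3) by auto
  have as_cl: "a \<cdot> s = c \<cdot> l"
  proof (rule pullback_unique[OF DW(12)])
    have "(g' \<cdot> pW) \<cdot> (a \<cdot> s) = g' \<cdot> (x \<cdot> (pY \<cdot> s))"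
      using triangle_comp[OF ab(7), of s] T s by simp
    also have "\<dots> = (g' \<cdot> pW) \<cdot> (c \<cdot> l)"
      using triangle_comp[OF cd(7), of l] T s by simp
    finally show "(g' \<cdot> pW) \<cdot> (a \<cdot> s) = (g' \<cdot> pW) \<cdot> (c \<cdot> l)" .
    have "qW \<cdot> (a \<cdot> s) = b \<cdot> (n1 \<cdot> q)"
      using square_comp[OF ab(8), of s] T s by simp
    also have "\<dots> = d \<cdot> (n2 \<cdot> q)" using square_comp[OF SN(9), of q] T by simp
    also have "\<dots> = qW \<cdot> (c \<cdot> l)" using square_comp[OF cd(8), of l] SQ(9) T by simp
    finally show "qW \<cdot> (a \<cdot> s) = qW \<cdot> (c \<cdot> l)" .
  qed (use T s in simp_all)
  have l: "x \<cdot> (pY \<cdot> s) = l"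
    using triangle_comp[OF ab(7), of s] triangle_comp[OF cd(7), of l] as_cl T s by simp
  have "dist_pullback f' x (pY \<cdot> s) q n2"
  proof (rule dist_pullbackI)
    show "dist_cone f' x (pY \<cdot> s) q n2"
      using Q T s l x by (simp add: dist_cone_def)
  next
    fix p' q' u assume c': "dist_cone f' x p' q' u"
    note D' = dist_coneD[OF c']
    have U: "u \<in> Arr C" "Cod C u = Dom C g" using D' n2 by simp_all
    have pbU: "is_pullback C f (g \<cdot> u) (g' \<cdot> (x \<cdot> p')) q'"
      by (rule pullback_paste[OF pb D'(12)])
    have cY': "dist_cone f (g' \<cdot> x) p' q' (g \<cdot> u)"
      using pbU D'(1-3) T S(1,8) by (simp add: dist_cone_def)
    have cW': "dist_cone f g' (x \<cdot> p') q' (g \<cdot> u)"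
      using pbU D'(1-3) T S(1,8) by (simp add: dist_cone_def)
    \<comment> \<open>Both sides are the map into \<open>W\<close> that classifies the cone around \<open>(f, g')\<close> with first component \<open>x p'\<close>.\<close>
    have key: "b \<cdot> t = d \<cdot> u" if m: "dist_cone_mor p' q' (g \<cdot> u) pY qY rY s' t" for s' t
    proof -
      note m = dist_cone_morD[OF m]
      have tt: "Dom C t = Dom C u" "Cod C t = Dom C rY" using m U T by simp_all
      have "pW \<cdot> (a \<cdot> s') = x \<cdot> p'" "qW \<cdot> (a \<cdot> s') = b \<cdot> (t \<cdot> q')" "rW \<cdot> (b \<cdot> t) = g \<cdot> u"
        using triangle_comp[OF ab(7), of s'] square_comp[OF ab(8), of s'] triangle_comp[OF ab(9), of t]
          m T by simp_all
      then have "dist_cone_mor (x \<cdot> p') q' (g \<cdot> u) pW qW rW (a \<cdot> s') (b \<cdot> t)"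
        using m tt T U D'(1-10) by (simp add: dist_cone_mor_def)
      moreover have "pW \<cdot> (c \<cdot> (x \<cdot> p')) = x \<cdot> p'" "qW \<cdot> (c \<cdot> (x \<cdot> p')) = d \<cdot> (u \<cdot> q')"
          "rW \<cdot> (d \<cdot> u) = g \<cdot> u"
        using triangle_comp[OF cd(7), of "x \<cdot> p'"] square_comp[OF cd(8), of "x \<cdot> p'"]
          triangle_comp[OF cd(9), of u] D' T U by simp_all
      then have "dist_cone_mor (x \<cdot> p') q' (g \<cdot> u) pW qW rW (c \<cdot> (x \<cdot> p')) (d \<cdot> u)"
        using T U D'(1-3,6,7,9,10) by (simp add: dist_cone_mor_def)
      ultimately show ?thesis using dist_pullback_unique(2)[OF dW cW'] by blast
    qed
    show "\<exists>s0 t0. dist_cone_mor p' q' u (pY \<cdot> s) q n2 s0 t0"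
    proof -
      obtain s' t where st: "s' \<in> Arr C" "t \<in> Arr C" "Dom C s' = Dom C p'" "Cod C s' = Dom C pY"
        "Dom C t = Dom C (g \<cdot> u)" "Cod C t = Dom C rY" "pY \<cdot> s' = p'" "qY \<cdot> s' = t \<cdot> q'"
        "rY \<cdot> t = g \<cdot> u"
        by (rule dist_pullback_lift[OF dY cY'])
      have tu: "Dom C t = Dom C u" using st(5) U T by simp
      have "b \<cdot> t = d \<cdot> u" by (rule key) (use st in \<open>simp add: dist_cone_mor_def\<close>)
      then obtain n where n: "n \<in> Arr C" "Dom C n = Dom C u" "Cod C n = Dom C n2" "n1 \<cdot> n = t"
          "n2 \<cdot> n = u"
        using pullback_lift[OF N, of t u] st(1-4,6) tu U T by auto
      have "f' \<cdot> (x \<cdot> p') = n2 \<cdot> (n \<cdot> q')"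
        using triangle_comp[OF n(5), of q'] n D'(6,7,9,11) T by simp
      then obtain s0 where s0: "s0 \<in> Arr C" "Dom C s0 = Dom C p'" "Cod C s0 = Dom C q"
          "l \<cdot> s0 = x \<cdot> p'" "q \<cdot> s0 = n \<cdot> q'"
        using pullback_lift[OF Q, of "x \<cdot> p'" "n \<cdot> q'"] n D'(1-10) T by auto
      have e1: "g' \<cdot> (x \<cdot> (pY \<cdot> (s \<cdot> s0))) = g' \<cdot> (x \<cdot> p')"
        using triangle_comp[of "x \<cdot> pY" s l s0] l s s0 T by simp
      have "qY \<cdot> (s \<cdot> s0) = n1 \<cdot> (n \<cdot> q')" using square_comp[OF s(5), of s0] s s0 T by simp
      also have "\<dots> = t \<cdot> q'" using triangle_comp[OF n(4), of q'] n D'(6,7,9) T by simp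
      finally have e2: "qY \<cdot> (s \<cdot> s0) = t \<cdot> q'" .
      have "s \<cdot> s0 = s'"
        by (rule pullback_unique[OF DY(12)])
          (use st(1-4,6-8) s s0 e1 e2 T triangle_comp[OF st(7), simplified] in simp_all)
      then have "dist_cone_mor p' q' u (pY \<cdot> s) q n2 s0 n"
        using s s0 n T st(7) by (simp add: dist_cone_mor_def)
      then show ?thesis by blast
    qed
    show "t0 = t0'" if m0: "dist_cone_mor p' q' u (pY \<cdot> s) q n2 s0 t0"
      and m0': "dist_cone_mor p' q' u (pY \<cdot> s) q n2 s0' t0'" for s0 t0 s0' t0'
    proof -
      have *: "t0 \<in> Arr C \<and> Dom C t0 = Dom C u \<and> Cod C t0 = Dom C n2 \<and> n2 \<cdot> t0 = u \<and>
          dist_cone_mor p' q' (g \<cdot> u) pY qY rY (s \<cdot> s0) (n1 \<cdot> t0)"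
        if "dist_cone_mor p' q' u (pY \<cdot> s) q n2 s0 t0" for s0 t0
      proof -
        have m: "s0 \<in> Arr C" "t0 \<in> Arr C" "Dom C s0 = Dom C p'" "Cod C s0 = Dom C q"
          "Dom C t0 = Dom C u" "Cod C t0 = Dom C n2" "pY \<cdot> (s \<cdot> s0) = p'" "q \<cdot> s0 = t0 \<cdot> q'"
          "n2 \<cdot> t0 = u" using dist_cone_morD[OF that] s T by simp_all
        have e1: "qY \<cdot> (s \<cdot> s0) = n1 \<cdot> (t0 \<cdot> q')"
          using square_comp[OF s(5), of s0] s m T by simp
        have "rY \<cdot> (n1 \<cdot> t0) = rW \<cdot> (b \<cdot> (n1 \<cdot> t0))"
          using triangle_comp[OF ab(9), of "n1 \<cdot> t0"] m T by simp
        also have "\<dots> = rW \<cdot> (d \<cdot> (n2 \<cdot> t0))" using square_comp[OF SN(9), of t0] m T by simp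
        also have "\<dots> = g \<cdot> u" using triangle_comp[OF cd(9), of u] m T U by simp
        finally have "rY \<cdot> (n1 \<cdot> t0) = g \<cdot> u" .
        then show ?thesis using m e1 s T U D'(6,7,9) by (simp add: dist_cone_mor_def)
      qed
      have "n1 \<cdot> t0 = n1 \<cdot> t0'"
        using dist_pullback_unique(2)[OF dY cY'] *[OF m0] *[OF m0'] by blast
      then show ?thesis
        by (intro pullback_unique[OF N, of t0 t0']) (use *[OF m0] *[OF m0'] T in simp_all)
    qed
  qed
  then show "\<exists>p q r. dist_pullback f' x p q r" by blast
qed

end

section \<open>Cells into a polynomial\<close>

text \<open>A cell into a polynomial \<open>p\<close> is a map \<open>cq\<close> together with a pullback square \<open>(cr, cs)\<close> from \<open>cq\<close> to the
middle map of \<open>p\<close>. The names follow the components \<open>q\<^sub>2\<close>, \<open>r\<close>, \<open>s\<close> of subdivided composites.\<close>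

record 'm cell =
  cq :: 'm
  cr :: 'm
  cs :: 'm

context pb_category
begin

definition poly :: "'m polynomial \<Rightarrow> bool" where "poly p \<longleftrightarrow> (\<exists>X Y. is_polynomial C X Y p)"

definition cell :: "'m polynomial \<Rightarrow> 'm cell \<Rightarrow> bool" where
  "cell p c \<longleftrightarrow> poly p \<and> is_pullback C (poly2 p) (cs c) (cr c) (cq c)"

definition lft :: "'m polynomial \<Rightarrow> 'm cell \<Rightarrow> 'm" where "lft p c = poly1 p \<cdot> cr c"

definition rgt :: "'m polynomial \<Rightarrow> 'm cell \<Rightarrow> 'm" where "rgt p c = poly3 p \<cdot> cs c"

definition cell_mor :: "'m cell \<Rightarrow> 'm cell \<Rightarrow> 'm \<Rightarrow> 'm \<Rightarrow> bool" where
  "cell_mor c d t t' \<longleftrightarrow> t \<in> Arr C \<and> t' \<in> Arr C \<and> Dom C t = Dom C (cq c) \<and> Cod C t = Dom C (cq d) \<and>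
    Dom C t' = Dom C (cs c) \<and> Cod C t' = Dom C (cs d) \<and>
    cq d \<cdot> t = t' \<cdot> cq c \<and> cr d \<cdot> t = cr c \<and> cs d \<cdot> t' = cs c"

definition matched :: "'m polynomial \<Rightarrow> 'm polynomial \<Rightarrow> 'm cell \<Rightarrow> 'm cell \<Rightarrow> bool" where
  "matched p q c d \<longleftrightarrow> cell p c \<and> cell q d \<and> rgt p c = lft q d"

text \<open>Terminality among the matched pairs of cells, with the morphisms \<open>(t0, t1, t2)\<close> of subdivided
composites.\<close>

definition universal_pair :: "'m polynomial \<Rightarrow> 'm polynomial \<Rightarrow> 'm cell \<Rightarrow> 'm cell \<Rightarrow> bool" where
  "universal_pair p q y1 y2 \<longleftrightarrow> matched p q y1 y2 \<and>
    (\<forall>c d. matched p q c d \<longrightarrow>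
      (\<exists>t0 t1 t2. cell_mor c y1 t0 t1 \<and> cell_mor d y2 t1 t2) \<and>
      (\<forall>t0 t1 t2 u0 u1 u2. cell_mor c y1 t0 t1 \<longrightarrow> cell_mor d y2 t1 t2 \<longrightarrow>
        cell_mor c y1 u0 u1 \<longrightarrow> cell_mor d y2 u1 u2 \<longrightarrow> t0 = u0 \<and> t1 = u1 \<and> t2 = u2))"

lemma polyD:
  assumes "poly p"
  shows "poly1 p \<in> Arr C" "poly2 p \<in> Arr C" "poly3 p \<in> Arr C" "Dom C (poly1 p) = Dom C (poly2 p)"
    "Cod C (poly2 p) = Dom C (poly3 p)" "exponentiable C (poly2 p)"
proof -
  obtain X Y where p: "is_polynomial C X Y p" using assms by (auto simp: poly_def)
  then show "exponentiable C (poly2 p)" by (simp add: is_polynomial_def)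
  with p show "poly1 p \<in> Arr C" "poly2 p \<in> Arr C" "poly3 p \<in> Arr C"
    "Dom C (poly1 p) = Dom C (poly2 p)" "Cod C (poly2 p) = Dom C (poly3 p)"
    by (simp_all add: is_polynomial_def exponentiable_def)
qed

lemma cellD:
  assumes "cell p c"
  shows "cq c \<in> Arr C" "cr c \<in> Arr C" "cs c \<in> Arr C" "Dom C (cr c) = Dom C (cq c)"
    "Cod C (cr c) = Dom C (poly2 p)" "Cod C (cs c) = Dom C (poly3 p)" "Cod C (cq c) = Dom C (cs c)"
    "poly2 p \<cdot> cr c = cs c \<cdot> cq c" "is_pullback C (poly2 p) (cs c) (cr c) (cq c)" "poly p"
  using assms pullback_square[of "poly2 p" "cs c" "cr c" "cq c"] polyD[of p] unfolding cell_def
  by (elim conjE; simp)+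

lemmas cell_type = cellD(1-7) cellD(10)[THEN polyD(1)] cellD(10)[THEN polyD(2)]
  cellD(10)[THEN polyD(3)] cellD(10)[THEN polyD(4)] cellD(10)[THEN polyD(5)]

lemma boundary_type:
  assumes "cell p c"
  shows "lft p c \<in> Arr C" "rgt p c \<in> Arr C" "Dom C (lft p c) = Dom C (cq c)"
    "Dom C (rgt p c) = Dom C (cs c)" "Cod C (lft p c) = Cod C (poly1 p)"
    "Cod C (rgt p c) = Cod C (poly3 p)"
  using cell_type[OF assms] by (simp_all add: lft_def rgt_def)

lemma cell_morD:
  assumes "cell_mor c d t t'"
  shows "t \<in> Arr C" "t' \<in> Arr C" "Dom C t = Dom C (cq c)" "Cod C t = Dom C (cq d)"
    "Dom C t' = Dom C (cs c)" "Cod C t' = Dom C (cs d)"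
    "cq d \<cdot> t = t' \<cdot> cq c" "cr d \<cdot> t = cr c" "cs d \<cdot> t' = cs c"
  using assms by (simp_all add: cell_mor_def)

lemma cell_mor_comp:
  assumes "cell p c" "cell p d" "cell p e" and m: "cell_mor c d t t'" and n: "cell_mor d e u u'"
  shows "cell_mor c e (u \<cdot> t) (u' \<cdot> t')"
proof -
  note T = cell_type[OF assms(1)] cell_type[OF assms(2)] cell_type[OF assms(3)] cell_morD[OF m]
    cell_morD[OF n]
  have "cq e \<cdot> (u \<cdot> t) = u' \<cdot> (t' \<cdot> cq c)"
    using square_comp[OF cell_morD(7)[OF n], of t] T by simp
  moreover have "cr e \<cdot> (u \<cdot> t) = cr c" "cs e \<cdot> (u' \<cdot> t') = cs c"
    using triangle_comp[OF cell_morD(8)[OF n], of t] triangle_comp[OF cell_morD(9)[OF n], of t'] T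
    by simp_all
  ultimately show ?thesis using T by (simp add: cell_mor_def)
qed

lemma cell_mor_pullback:
  assumes "cell p c" "cell p d" and m: "cell_mor c d t t'"
  shows "is_pullback C (cq d) t' t (cq c)"
  by (rule pullback_cancel[OF cellD(9)[OF assms(2)]])
    (use cellD(9)[OF assms(1)] cell_morD[OF m] cell_type[OF assms(2)] in simp_all)

lemma cell_mor_unique:
  assumes "cell p d" "cell_mor c d t t'" "cell_mor c d u t'"
  shows "t = u"
  by (rule pullback_unique[OF cellD(9)[OF assms(1)]])
    (use cell_type[OF assms(1)] cell_morD[OF assms(2)] cell_morD[OF assms(3)] in simp_all)

lemma matchedD:
  assumes "matched p q c d"
  shows "cell p c" "cell q d" "rgt p c = lft q d" "Dom C (cs c) = Dom C (cq d)"
    "Cod C (poly3 p) = Cod C (poly1 q)"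
proof -
  show cd: "cell p c" "cell q d" "rgt p c = lft q d" using assms by (auto simp: matched_def)
  show "Dom C (cs c) = Dom C (cq d)" "Cod C (poly3 p) = Cod C (poly1 q)"
    using boundary_type(3-6)[OF cd(1)] boundary_type(3-6)[OF cd(2)] cd(3) by metis+
qed

text \<open>A matched pair \<open>(c, d)\<close> gives a map \<open>k\<close> from the object in the middle to the pullback \<open>P\<close> of \<open>poly3 p\<close> and
\<open>poly1 q\<close>, and \<open>(k, cq d, cs d)\<close> is then a distributivity cone around \<open>(poly2 q, \<pi>2)\<close>. So \<open>d\<close> is
classified by a distributivity pullback. The remaining part of \<open>c\<close> is recovered by pulling \<open>poly2 p\<close> back
along the induced map to its codomain.\<close>

lemma universal_pair_exists:
  assumes p: "poly p" and q: "poly q" and pq: "Cod C (poly3 p) = Cod C (poly1 q)"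
  shows "\<exists>y1 y2. universal_pair p q y1 y2"
proof -
  note Tp = polyD(1-5)[OF p] and Tq = polyD(1-5)[OF q]
  obtain \<pi>1 \<pi>2 where P: "is_pullback C (poly3 p) (poly1 q) \<pi>1 \<pi>2"
    using obtain_pullback Tp Tq pq by blast
  note SP = pullback_square[OF P]
  obtain \<epsilon> e r where d: "dist_pullback (poly2 q) \<pi>2 \<epsilon> e r"
    using polyD(6)[OF q] SP Tq unfolding exponentiable_iff has_dist_pullbacks_def by force
  then have c: "dist_cone (poly2 q) \<pi>2 \<epsilon> e r" by (simp add: dist_pullback_def)
  note D = dist_coneD[OF c]
  obtain h1 h2 where H: "is_pullback C (poly2 p) (\<pi>1 \<cdot> \<epsilon>) h1 h2"
    using obtain_pullback[of "poly2 p" "\<pi>1 \<cdot> \<epsilon>"] Tp SP D(1-3) by auto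
  note SH = pullback_square[OF H]
  define y1 y2 where "y1 = \<lparr> cq = h2, cr = h1, cs = \<pi>1 \<cdot> \<epsilon> \<rparr>"
    and "y2 = \<lparr> cq = e, cr = \<pi>2 \<cdot> \<epsilon>, cs = r \<rparr>"
  have y: "cell p y1" "cell q y2"
    using p q H D(12) by (simp_all add: cell_def y1_def y2_def)
  have "rgt p y1 = lft q y2"
    using square_comp[OF SP(9), of \<epsilon>] SP D(1-3) Tq by (simp add: rgt_def lft_def y1_def y2_def)
  then have ym: "matched p q y1 y2" using y by (simp add: matched_def)
  note Ty = cell_type[OF y(1)] cell_type[OF y(2)]
  have fill: "(\<exists>t0 t1 t2. cell_mor c y1 t0 t1 \<and> cell_mor d y2 t1 t2) \<and>
      (\<forall>t0 t1 t2 u0 u1 u2. cell_mor c y1 t0 t1 \<longrightarrow> cell_mor d y2 t1 t2 \<longrightarrow>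
        cell_mor c y1 u0 u1 \<longrightarrow> cell_mor d y2 u1 u2 \<longrightarrow> t0 = u0 \<and> t1 = u1 \<and> t2 = u2)"
    if m: "matched p q c d" for c d
  proof (intro conjI allI impI)
    note Tc = cell_type[OF matchedD(1)[OF m]] and Td = cell_type[OF matchedD(2)[OF m]]
    obtain k where k: "k \<in> Arr C" "Dom C k = Dom C (cs c)" "Cod C k = Dom C \<pi>1" "\<pi>1 \<cdot> k = cs c"
        "\<pi>2 \<cdot> k = cr d"
      using pullback_lift[OF P, of "cs c" "cr d"] Tc Td matchedD(3,4)[OF m] Tq
      by (auto simp: lft_def rgt_def)
    have c': "dist_cone (poly2 q) \<pi>2 k (cq d) (cs d)"
      using k cellD(9)[OF matchedD(2)[OF m]] D SP by (simp add: dist_cone_def)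
    have mor: "dist_cone_mor k (cq d) (cs d) \<epsilon> e r t1 t2"
      if "cell_mor c y1 t0 t1" "cell_mor d y2 t1 t2" for t0 t1 t2
    proof -
      note t = cell_morD[OF that(1)] cell_morD[OF that(2)]
      have t': "t1 \<in> Arr C" "Dom C t1 = Dom C (cs c)" "Cod C t1 = Dom C e"
        using t Ty by (simp_all add: y1_def y2_def)
      have "\<pi>1 \<cdot> (\<epsilon> \<cdot> t1) = cs c" "\<pi>2 \<cdot> (\<epsilon> \<cdot> t1) = cr d"
        using t(8,9,17) t' D(1-10) SP by (simp_all add: y1_def y2_def)
      then have "\<epsilon> \<cdot> t1 = k"
        using k t' D(1-10) SP(3-8) by (intro pullback_unique[OF P, of "\<epsilon> \<cdot> t1" k]) simp_all
      then show ?thesis using t t' k D(1-10) by (simp add: dist_cone_mor_def y2_def)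
    qed
    show "t1 = u1" "t2 = u2" "t0 = u0"
      if "cell_mor c y1 t0 t1" "cell_mor d y2 t1 t2" "cell_mor c y1 u0 u1" "cell_mor d y2 u1 u2"
      for t0 t1 t2 u0 u1 u2
    proof -
      show *: "t1 = u1" "t2 = u2"
        using dist_pullback_unique[OF d c' mor[OF that(1,2)] mor[OF that(3,4)]] by auto
      show "t0 = u0" using cell_mor_unique[OF y(1) that(1)] that(3) * by simp
    qed
    obtain s t where st: "s \<in> Arr C" "t \<in> Arr C" "Dom C s = Dom C k" "Cod C s = Dom C \<epsilon>"
      "Dom C t = Dom C (cs d)" "Cod C t = Dom C r" "\<epsilon> \<cdot> s = k" "e \<cdot> s = t \<cdot> cq d" "r \<cdot> t = cs d"
      by (rule dist_pullback_lift[OF d c'])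
    have s': "\<pi>1 \<cdot> (\<epsilon> \<cdot> s) = cs c" "\<pi>2 \<cdot> (\<epsilon> \<cdot> s) = cr d" using st k by simp_all
    have "poly2 p \<cdot> cr c = (\<pi>1 \<cdot> \<epsilon>) \<cdot> (s \<cdot> cq c)"
      using triangle_comp[of "\<pi>1 \<cdot> \<epsilon>" s "cs c" "cq c"] s'(1) st(1-4) k(2) SP D(1-10) Tc
        cellD(8)[OF matchedD(1)[OF m]] by simp
    then obtain t0 where t0: "t0 \<in> Arr C" "Dom C t0 = Dom C (cr c)" "Cod C t0 = Dom C h1"
        "h1 \<cdot> t0 = cr c" "h2 \<cdot> t0 = s \<cdot> cq c"
      using pullback_lift[OF H, of "cr c" "s \<cdot> cq c"] st(1-4) k(2) SP D(1-10) Tc by auto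
    have "cell_mor c y1 t0 s" "cell_mor d y2 s t"
      using t0 st s' k(2) Ty Tc Td matchedD(4)[OF m] SH D(1-10) SP
      by (simp_all add: cell_mor_def y1_def y2_def)
    then show "\<exists>t0 t1 t2. cell_mor c y1 t0 t1 \<and> cell_mor d y2 t1 t2" by blast
  qed
  then show ?thesis using ym unfolding universal_pair_def by blast
qed

subsection \<open>Subdivided composites of two polynomials\<close>

definition sdc_of ::
  "'m polynomial \<Rightarrow> 'm polynomial \<Rightarrow> 'm cell \<Rightarrow> 'm cell \<Rightarrow> ('o, 'm) sdc" where
  "sdc_of p q c d = \<lparr> sY = [Dom C (cq c), Dom C (cs c), Dom C (cs d)], sq1 = lft p c,
    sq2 = [cq c, cq d], sq3 = rgt q d, sr = [cr c, cr d], ss = [cs c, cs d] \<rparr>"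

lemma all_less_two: "(\<forall>i < Suc (Suc 0). P i) \<longleftrightarrow> P 0 \<and> P (Suc 0)"
  by (auto simp: less_Suc_eq)

lemma all_le_two: "(\<forall>i \<le> Suc (Suc 0). P i) \<longleftrightarrow> P 0 \<and> P (Suc 0) \<and> P (Suc (Suc 0))"
  by (auto simp: le_Suc_eq)

text \<open>The data of a subdivided composite of two polynomials that are not part of the two cells, namely the
objects and the two outer legs, are determined by the cells.\<close>

lemma is_sdc_pair_iff:
  assumes p: "poly p" and q: "poly q"
  shows "is_sdc C [p, q] S \<longleftrightarrow> (\<exists>c d. matched p q c d \<and> S = sdc_of p q c d)"
proof
  assume S: "is_sdc C [p, q] S"
  have "length (sY S) = 3" "length (sq2 S) = 2" "length (sr S) = 2" "length (ss S) = 2"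
    using S by (auto simp: is_sdc_def Let_def)
  then obtain Y0 Y1 Y2 m1 m2 r1 r2 s1 s2 where L: "sY S = [Y0, Y1, Y2]" "sq2 S = [m1, m2]"
    "sr S = [r1, r2]" "ss S = [s1, s2]"
    by (auto simp: length_Suc_conv numeral_3_eq_3 numeral_2_eq_2)
  let ?c = "\<lparr> cq = m1, cr = r1, cs = s1 \<rparr>" and ?d = "\<lparr> cq = m2, cr = r2, cs = s2 \<rparr>"
  have "matched p q ?c ?d \<and> S = sdc_of p q ?c ?d"
    using S p q L unfolding is_sdc_def Let_def
    by (auto simp: all_less_two matched_def cell_def rgt_def lft_def sdc_of_def hom_def)
  then show "\<exists>c d. matched p q c d \<and> S = sdc_of p q c d" by blast
next
  assume "\<exists>c d. matched p q c d \<and> S = sdc_of p q c d"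
  then obtain c d where m: "matched p q c d" and S: "S = sdc_of p q c d" by blast
  note T = cell_type[OF matchedD(1)[OF m]] cell_type[OF matchedD(2)[OF m]] matchedD(4)[OF m]
    boundary_type[OF matchedD(1)[OF m]] boundary_type[OF matchedD(2)[OF m]]
  show "is_sdc C [p, q] S"
    unfolding is_sdc_def Let_def S
    using T cellD(9)[OF matchedD(1)[OF m]] cellD(9)[OF matchedD(2)[OF m]] matchedD(3)[OF m]
    by (simp add: all_less_two sdc_of_def hom_def lft_def rgt_def)
qed

lemma is_sdc_mor_pair_iff:
  assumes m: "matched p q c d" and n: "matched p q c' d'"
    and f: "tsrc f = sdc_of p q c d" "ttgt f = sdc_of p q c' d'"
  shows "is_sdc_mor C 2 f \<longleftrightarrow>
    (\<exists>t0 t1 t2. tarr f = [t0, t1, t2] \<and> cell_mor c c' t0 t1 \<and> cell_mor d d' t1 t2)"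
proof -
  note T = cell_type[OF matchedD(1)[OF m]] cell_type[OF matchedD(2)[OF m]] matchedD(4)[OF m]
    cell_type[OF matchedD(1)[OF n]] cell_type[OF matchedD(2)[OF n]] matchedD(4)[OF n]
  have *: "is_sdc_mor C 2 f \<longleftrightarrow> cell_mor c c' t0 t1 \<and> cell_mor d d' t1 t2"
    if t: "tarr f = [t0, t1, t2]" for t0 t1 t2
  proof -
    have "is_sdc_mor C 2 f \<longleftrightarrow>
      (t0 \<in> Arr C \<and> Dom C t0 = Dom C (cq c) \<and> Cod C t0 = Dom C (cq c')) \<and>
      (t1 \<in> Arr C \<and> Dom C t1 = Dom C (cs c) \<and> Cod C t1 = Dom C (cs c')) \<and>
      (t2 \<in> Arr C \<and> Dom C t2 = Dom C (cs d) \<and> Cod C t2 = Dom C (cs d')) \<and>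
      lft p c = lft p c' \<cdot> t0 \<and> rgt q d = rgt q d' \<cdot> t2 \<and>
      (cq c' \<cdot> t0 = t1 \<cdot> cq c \<and> cr c = cr c' \<cdot> t0 \<and> cs c = cs c' \<cdot> t1) \<and>
      (cq d' \<cdot> t1 = t2 \<cdot> cq d \<and> cr d = cr d' \<cdot> t1 \<and> cs d = cs d' \<cdot> t2)"
      (is "_ \<longleftrightarrow> ?R")
      by (simp add: is_sdc_mor_def t f sdc_of_def hom_def numeral_2_eq_2 all_less_two all_le_two
          cong: conj_cong)
    also have "?R \<longleftrightarrow> cell_mor c c' t0 t1 \<and> cell_mor d d' t1 t2" (is "_ \<longleftrightarrow> ?M")
    proof
      assume R: ?R
      then show ?M unfolding cell_mor_def using matchedD(4)[OF m] matchedD(4)[OF n] by metis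
    next
      assume M: ?M
      note M1 = cell_morD[OF conjunct1[OF M]] and M2 = cell_morD[OF conjunct2[OF M]]
      have "lft p c' \<cdot> t0 = lft p c" "rgt q d' \<cdot> t2 = rgt q d"
        using M1 M2 T by (simp_all add: lft_def rgt_def)
      then show ?R using M1 M2 by metis
    qed
    finally show ?thesis .
  qed
  have "is_sdc_mor C 2 f \<Longrightarrow> length (tarr f) = 3" by (simp add: is_sdc_mor_def Let_def)
  then have "is_sdc_mor C 2 f \<Longrightarrow> \<exists>t0 t1 t2. tarr f = [t0, t1, t2]"
    by (auto simp: length_Suc_conv numeral_3_eq_3)
  then show ?thesis using * by blast
qed

lemma hom_sdc_pair_iff:
  assumes p: "poly p" and q: "poly q" and m: "matched p q c d" and y: "matched p q c' d'"
  shows "f \<in> hom (SdC C [p, q]) (sdc_of p q c d) (sdc_of p q c' d') \<longleftrightarrow>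
    (\<exists>t0 t1 t2. f = \<lparr> tsrc = sdc_of p q c d, ttgt = sdc_of p q c' d', tarr = [t0, t1, t2] \<rparr> \<and>
      cell_mor c c' t0 t1 \<and> cell_mor d d' t1 t2)"
proof -
  have eq: "f = \<lparr> tsrc = a, ttgt = b, tarr = l \<rparr> \<longleftrightarrow> tsrc f = a \<and> ttgt f = b \<and> tarr f = l" for a b l
    by (cases f) auto
  have "is_sdc C [p, q] (sdc_of p q c d)" "is_sdc C [p, q] (sdc_of p q c' d')"
    using is_sdc_pair_iff[OF p q] m y by blast+
  then have "f \<in> hom (SdC C [p, q]) (sdc_of p q c d) (sdc_of p q c' d') \<longleftrightarrow>
      tsrc f = sdc_of p q c d \<and> ttgt f = sdc_of p q c' d' \<and> is_sdc_mor C 2 f"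
    by (auto simp: SdC_def hom_def numeral_2_eq_2)
  also have "\<dots> \<longleftrightarrow> tsrc f = sdc_of p q c d \<and> ttgt f = sdc_of p q c' d' \<and>
      (\<exists>t0 t1 t2. tarr f = [t0, t1, t2] \<and> cell_mor c c' t0 t1 \<and> cell_mor d d' t1 t2)"
    using is_sdc_mor_pair_iff[OF m y] by blast
  finally show ?thesis unfolding eq by blast
qed

lemma terminal_pair_iff:
  assumes p: "poly p" and q: "poly q" and y: "matched p q y1 y2"
  shows "terminal (SdC C [p, q]) (sdc_of p q y1 y2) \<longleftrightarrow> universal_pair p q y1 y2"
proof -
  let ?S = "SdC C [p, q]" and ?T = "sdc_of p q y1 y2"
  have Obj: "S \<in> Obj ?S \<longleftrightarrow> (\<exists>c d. matched p q c d \<and> S = sdc_of p q c d)" for S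
    using is_sdc_pair_iff[OF p q] by (simp add: SdC_def)
  note hom = hom_sdc_pair_iff[OF p q _ y]
  have "terminal ?S ?T \<longleftrightarrow> (\<forall>c d. matched p q c d \<longrightarrow> (\<exists>!f. f \<in> hom ?S (sdc_of p q c d) ?T))"
  proof -
    have "(\<forall>S \<in> Obj ?S. P S) \<longleftrightarrow> (\<forall>c d. matched p q c d \<longrightarrow> P (sdc_of p q c d))" for P
      unfolding Ball_def Obj by metis
    moreover have "?T \<in> Obj ?S" using Obj y by blast
    ultimately show ?thesis by (simp add: terminal_def)
  qed
  also have "\<dots> \<longleftrightarrow> (\<forall>c d. matched p q c d \<longrightarrow>
      (\<exists>t0 t1 t2. cell_mor c y1 t0 t1 \<and> cell_mor d y2 t1 t2) \<and>
      (\<forall>t0 t1 t2 u0 u1 u2. cell_mor c y1 t0 t1 \<longrightarrow> cell_mor d y2 t1 t2 \<longrightarrow>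
        cell_mor c y1 u0 u1 \<longrightarrow> cell_mor d y2 u1 u2 \<longrightarrow> t0 = u0 \<and> t1 = u1 \<and> t2 = u2))"
    (is "_ \<longleftrightarrow> (\<forall>c d. _ \<longrightarrow> ?E c d \<and> ?U c d)")
  proof (intro all_cong1 imp_cong refl)
    fix c d assume m: "matched p q c d"
    show "(\<exists>!f. f \<in> hom ?S (sdc_of p q c d) ?T) \<longleftrightarrow> ?E c d \<and> ?U c d" (is "?L \<longleftrightarrow> _")
    proof
      assume L: ?L
      have "?E c d" using L hom[OF m] by blast
      moreover have "?U c d"
      proof (intro allI impI)
        fix t0 t1 t2 u0 u1 u2 assume "cell_mor c y1 t0 t1" "cell_mor d y2 t1 t2"
          "cell_mor c y1 u0 u1" "cell_mor d y2 u1 u2"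
        then have "\<lparr> tsrc = sdc_of p q c d, ttgt = ?T, tarr = [t0, t1, t2] \<rparr> =
            \<lparr> tsrc = sdc_of p q c d, ttgt = ?T, tarr = [u0, u1, u2] \<rparr>"
          using L hom[OF m] by blast
        then show "t0 = u0 \<and> t1 = u1 \<and> t2 = u2" by simp
      qed
      ultimately show "?E c d \<and> ?U c d" by blast
    next
      assume R: "?E c d \<and> ?U c d"
      then obtain t0 t1 t2 where t: "cell_mor c y1 t0 t1" "cell_mor d y2 t1 t2" by blast
      show ?L
      proof (rule ex1I)
        show "\<lparr> tsrc = sdc_of p q c d, ttgt = ?T, tarr = [t0, t1, t2] \<rparr> \<in> hom ?S (sdc_of p q c d) ?T"
          using t hom[OF m] by blast
        fix f assume "f \<in> hom ?S (sdc_of p q c d) ?T"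
        then show "f = \<lparr> tsrc = sdc_of p q c d, ttgt = ?T, tarr = [t0, t1, t2] \<rparr>"
          using t R hom[OF m] by blast
      qed
    qed
  qed
  finally show ?thesis using y by (simp add: universal_pair_def)
qed

end

section \<open>Cartesian morphisms acting on cells\<close>

context category
begin

lemma pullback_iso:
  assumes "m \<in> Arr C" "a \<in> Arr C" "b \<in> Arr C" "n \<in> Arr C" "a' \<in> Arr C" "b' \<in> Arr C"
    "Cod C b = Dom C m" "Cod C m = Cod C a" "Dom C b = Dom C n" "Cod C n = Dom C a"
    "Dom C a' = Cod C a" "Cod C a' = Dom C a" "Dom C b' = Cod C b" "Cod C b' = Dom C b"
    and sq: "m \<cdot> b = a \<cdot> n" and a': "a' \<cdot> a = Ident C (Dom C a)"
    and b': "b' \<cdot> b = Ident C (Dom C b)" "b \<cdot> b' = Ident C (Cod C b)"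
  shows "is_pullback C m a b n"
proof (rule pullbackI)
  note T = assms(1-14)
  show "\<exists>h. h \<in> Arr C \<and> Dom C h = Dom C u \<and> Cod C h = Dom C b \<and> b \<cdot> h = u \<and> n \<cdot> h = v"
    if u: "u \<in> Arr C" "v \<in> Arr C" "Dom C u = Dom C v" "Cod C u = Dom C m" "Cod C v = Dom C a"
      "m \<cdot> u = a \<cdot> v" for u v
  proof (intro exI[of _ "b' \<cdot> u"] conjI)
    show e: "b \<cdot> (b' \<cdot> u) = u" using triangle_comp[OF b'(2), of u] u T by simp
    have "a \<cdot> (n \<cdot> (b' \<cdot> u)) = m \<cdot> (b \<cdot> (b' \<cdot> u))"
      using square_comp[OF sq, of "b' \<cdot> u"] u T by simp
    then have "a' \<cdot> (a \<cdot> (n \<cdot> (b' \<cdot> u))) = a' \<cdot> (a \<cdot> v)" using u e by simp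
    then show "n \<cdot> (b' \<cdot> u) = v"
      using triangle_comp[OF a', of "n \<cdot> (b' \<cdot> u)"] triangle_comp[OF a', of v] u T by simp
  qed (use u T in simp_all)
  show "h = h'" if h: "h \<in> Arr C" "h' \<in> Arr C" "Dom C h = Dom C h'" "Cod C h = Dom C b"
      "Cod C h' = Dom C b" "b \<cdot> h = b \<cdot> h'" for h h'
  proof -
    have "b' \<cdot> (b \<cdot> k) = k" if "k \<in> Arr C" "Cod C k = Dom C b" for k
      using triangle_comp[OF b'(1), of k] that T by simp
    then show ?thesis using h by metis
  qed
qed (use assms in simp_all)

end

context pb_category
begin

definition id_cell :: "'m polynomial \<Rightarrow> 'm cell" where
  "id_cell p = \<lparr> cq = poly2 p, cr = Ident C (Dom C (poly2 p)), cs = Ident C (Cod C (poly2 p)) \<rparr>"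

definition act :: "'m cart_mor \<Rightarrow> 'm cell \<Rightarrow> 'm cell" where
  "act \<alpha> c = \<lparr> cq = cq c, cr = cart0 \<alpha> \<cdot> cr c, cs = cart1 \<alpha> \<cdot> cs c \<rparr>"

text \<open>A cartesian morphism \<open>p \<rightarrow> p'\<close> is the same as a cell into \<open>p'\<close> that has the middle map and the boundaries
of \<open>p\<close>.\<close>

definition cart :: "'m cart_mor \<Rightarrow> 'm polynomial \<Rightarrow> 'm polynomial \<Rightarrow> bool" where
  "cart \<alpha> p p' \<longleftrightarrow> poly p \<and> csrc \<alpha> = p \<and> ctgt \<alpha> = p' \<and>
    cell p' \<lparr> cq = poly2 p, cr = cart0 \<alpha>, cs = cart1 \<alpha> \<rparr> \<and>
    poly1 p' \<cdot> cart0 \<alpha> = poly1 p \<and> poly3 p' \<cdot> cart1 \<alpha> = poly3 p"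

definition mor_of :: "'m polynomial \<Rightarrow> 'm polynomial \<Rightarrow> 'm cell \<Rightarrow> 'm cart_mor" where
  "mor_of p p' c = \<lparr> csrc = p, ctgt = p', cart0 = cr c, cart1 = cs c \<rparr>"

definition vcomp :: "'m cart_mor \<Rightarrow> 'm cart_mor \<Rightarrow> 'm cart_mor" where
  "vcomp \<beta> \<alpha> = \<lparr> csrc = csrc \<alpha>, ctgt = ctgt \<beta>, cart0 = cart0 \<beta> \<cdot> cart0 \<alpha>,
    cart1 = cart1 \<beta> \<cdot> cart1 \<alpha> \<rparr>"

definition cart_id :: "'m polynomial \<Rightarrow> 'm cart_mor" where
  "cart_id p = mor_of p p (id_cell p)"

definition cart_iso :: "'m cart_mor \<Rightarrow> 'm polynomial \<Rightarrow> 'm polynomial \<Rightarrow> bool" where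
  "cart_iso \<alpha> p p' \<longleftrightarrow> cart \<alpha> p p' \<and>
    (\<exists>\<beta>. cart \<beta> p' p \<and> vcomp \<beta> \<alpha> = cart_id p \<and> vcomp \<alpha> \<beta> = cart_id p')"

lemma id_cell_cell [simp]:
  assumes "poly p" shows "cell p (id_cell p)"
  using assms polyD[OF assms] pullback_ident[of "poly2 p"] by (simp add: cell_def id_cell_def)

lemma id_cell_sel [simp]: "cq (id_cell p) = poly2 p"
  by (simp add: id_cell_def)

lemma id_cell_boundary [simp]:
  assumes "poly p" shows "lft p (id_cell p) = poly1 p" "rgt p (id_cell p) = poly3 p"
  using polyD[OF assms] by (simp_all add: lft_def rgt_def id_cell_def)

text \<open>The cells into \<open>p\<close> form a category with the identity cell as terminal object; this is what makes a
cartesian morphism determined by its value there.\<close>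

lemma cell_mor_to_id:
  assumes "cell p c" shows "cell_mor c (id_cell p) (cr c) (cs c)"
  using cell_type[OF assms] cellD(8)[OF assms] by (simp add: cell_mor_def id_cell_def)

lemma cartD:
  assumes "cart \<alpha> p p'"
  shows "poly p" "poly p'" "csrc \<alpha> = p" "ctgt \<alpha> = p'" "cart0 \<alpha> \<in> Arr C" "cart1 \<alpha> \<in> Arr C"
    "Dom C (cart0 \<alpha>) = Dom C (poly2 p)" "Cod C (cart0 \<alpha>) = Dom C (poly2 p')"
    "Dom C (cart1 \<alpha>) = Dom C (poly3 p)" "Cod C (cart1 \<alpha>) = Dom C (poly3 p')"
    "poly1 p' \<cdot> cart0 \<alpha> = poly1 p" "poly3 p' \<cdot> cart1 \<alpha> = poly3 p"
    "is_pullback C (poly2 p') (cart1 \<alpha>) (cart0 \<alpha>) (poly2 p)"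
  using assms cellD[of p' "\<lparr> cq = poly2 p, cr = cart0 \<alpha>, cs = cart1 \<alpha> \<rparr>"] polyD(5)[of p]
  unfolding cart_def by (elim conjE; simp)+

lemma cart_mor_of:
  assumes "poly p" "cell p' c" "cq c = poly2 p" "lft p' c = poly1 p" "rgt p' c = poly3 p"
  shows "cart (mor_of p p' c) p p'"
proof -
  have "\<lparr> cq = poly2 p, cr = cr c, cs = cs c \<rparr> = c" using assms(3) by (cases c) simp
  then have "cell p' \<lparr> cq = poly2 p, cr = cr c, cs = cs c \<rparr>" using assms(2) by (rule ssubst)
  then show ?thesis using assms by (simp add: cart_def mor_of_def lft_def rgt_def)
qed

lemma cart_id: "poly p \<Longrightarrow> cart (cart_id p) p p"
  unfolding cart_id_def by (rule cart_mor_of) auto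

lemma act_cell:
  assumes \<alpha>: "cart \<alpha> p p'" and c: "cell p c"
  shows "cell p' (act \<alpha> c)" "cq (act \<alpha> c) = cq c" "lft p' (act \<alpha> c) = lft p c"
    "rgt p' (act \<alpha> c) = rgt p c" "Dom C (cs (act \<alpha> c)) = Dom C (cs c)"
proof -
  note A = cartD[OF \<alpha>] and T = cell_type[OF c]
  show "cell p' (act \<alpha> c)"
    using pullback_paste[OF A(13) cellD(9)[OF c]] A(2) by (simp add: cell_def act_def)
  show "lft p' (act \<alpha> c) = lft p c" "rgt p' (act \<alpha> c) = rgt p c"
    using triangle_comp[OF A(11), of "cr c"] triangle_comp[OF A(12), of "cs c"] A T polyD[OF A(2)]
    by (simp_all add: lft_def rgt_def act_def)
qed (use cartD[OF \<alpha>] cell_type[OF c] in \<open>simp_all add: act_def\<close>)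

lemma act_mor:
  assumes \<alpha>: "cart \<alpha> p p'" and "cell p c" "cell p d" and m: "cell_mor c d t t'"
  shows "cell_mor (act \<alpha> c) (act \<alpha> d) t t'"
  using cartD[OF \<alpha>] cell_type[OF assms(2)] cell_type[OF assms(3)] cell_morD[OF m]
  by (simp add: cell_mor_def act_def)

lemma act_matched:
  assumes "cart \<alpha> p p'" "cart \<beta> q q'" "matched p q c d"
  shows "matched p' q' (act \<alpha> c) (act \<beta> d)"
  using act_cell[OF assms(1)] act_cell[OF assms(2)] matchedD[OF assms(3)] by (simp add: matched_def)

lemma act_vcomp:
  assumes "cart \<alpha> p p'" "cart \<beta> p' p''" "cell p c"
  shows "act (vcomp \<beta> \<alpha>) c = act \<beta> (act \<alpha> c)"
  using cartD[OF assms(1)] cartD[OF assms(2)] cell_type[OF assms(3)]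
  by (simp add: act_def vcomp_def)

lemma act_id [simp]: "cell p c \<Longrightarrow> act (cart_id p) c = c"
  using cell_type[of p c] by (cases c) (simp add: act_def cart_id_def mor_of_def id_cell_def)

lemma act_id_cell:
  assumes "cart \<alpha> p p'"
  shows "act \<alpha> (id_cell p) = \<lparr> cq = poly2 p, cr = cart0 \<alpha>, cs = cart1 \<alpha> \<rparr>"
  using cartD[OF assms] polyD[OF cartD(1)[OF assms]] by (simp add: act_def id_cell_def)

lemma cart_eqI:
  assumes "cart \<alpha> p p'" "cart \<beta> p p'" "act \<alpha> (id_cell p) = act \<beta> (id_cell p)"
  shows "\<alpha> = \<beta>"
  using assms act_id_cell[OF assms(1)] act_id_cell[OF assms(2)] cartD(3,4)[OF assms(1)]
    cartD(3,4)[OF assms(2)] by (auto intro: cart_mor.equality)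

lemma cart_vcomp:
  assumes \<alpha>: "cart \<alpha> p p'" and \<beta>: "cart \<beta> p' p''"
  shows "cart (vcomp \<beta> \<alpha>) p p''"
proof -
  note c = id_cell_cell[OF cartD(1)[OF \<alpha>]]
  note d = act_cell[OF \<alpha> c] and e = act_cell[OF \<beta> act_cell(1)[OF \<alpha> c]]
  have "vcomp \<beta> \<alpha> = mor_of p p'' (act \<beta> (act \<alpha> (id_cell p)))"
    using act_id_cell[OF \<alpha>] cartD[OF \<alpha>] cartD[OF \<beta>] by (simp add: vcomp_def mor_of_def act_def)
  then show ?thesis using cartD(1)[OF \<alpha>] d e by (simp add: cart_mor_of)
qed

text \<open>Let \<open>\<kappa>\<close> and \<open>\<kappa>'\<close> be two families of cells with the same middle maps and boundaries. If \<open>\<kappa>\<close> takes the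
identity cell of \<open>p\<close> as its value at \<open>e\<close>, then \<open>\<kappa>' e\<close> is a cartesian morphism. It carries \<open>\<kappa>\<close> to \<open>\<kappa>'\<close>,
because the morphism from \<open>\<kappa> d\<close> to the identity cell is also a morphism from \<open>\<kappa>' d\<close> to \<open>\<kappa>' e\<close>.\<close>

lemma comparison:
  assumes p: "poly p"
    and \<kappa>: "\<And>d. d \<in> D \<Longrightarrow> cell p (\<kappa> d) \<and> cell p' (\<kappa>' d) \<and> cq (\<kappa>' d) = cq (\<kappa> d) \<and>
      lft p' (\<kappa>' d) = lft p (\<kappa> d) \<and> rgt p' (\<kappa>' d) = rgt p (\<kappa> d)"
    and e: "e \<in> D" "\<kappa> e = id_cell p"
    and mor: "\<And>d t t'. d \<in> D \<Longrightarrow> cell_mor (\<kappa> d) (\<kappa> e) t t' \<Longrightarrow> cell_mor (\<kappa>' d) (\<kappa>' e) t t'"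
  shows "cart (mor_of p p' (\<kappa>' e)) p p' \<and> (\<forall>d \<in> D. act (mor_of p p' (\<kappa>' e)) (\<kappa> d) = \<kappa>' d)"
proof (intro conjI ballI)
  show "cart (mor_of p p' (\<kappa>' e)) p p'" using \<kappa>[OF e(1)] e(2) p by (intro cart_mor_of) auto
  fix d assume d: "d \<in> D"
  have "cell_mor (\<kappa>' d) (\<kappa>' e) (cr (\<kappa> d)) (cs (\<kappa> d))"
    using mor[OF d] cell_mor_to_id[of p "\<kappa> d"] \<kappa>[OF d] e(2) by simp
  then show "act (mor_of p p' (\<kappa>' e)) (\<kappa> d) = \<kappa>' d"
    using \<kappa>[OF d] cell_morD(8,9) by (auto intro!: cell.equality simp: act_def mor_of_def)
qed

text \<open>In the symmetric situation the comparisons in both directions exist, and they are mutually inverse since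
their composites fix the identity cells. The associator and both unitors are instances.\<close>

lemma comparison_iso:
  assumes p: "poly p" "poly p'"
    and \<kappa>: "\<And>d. d \<in> D \<Longrightarrow> cell p (\<kappa> d) \<and> cell p' (\<kappa>' d) \<and> cq (\<kappa>' d) = cq (\<kappa> d) \<and>
      lft p' (\<kappa>' d) = lft p (\<kappa> d) \<and> rgt p' (\<kappa>' d) = rgt p (\<kappa> d)"
    and surj: "\<exists>e \<in> D. \<kappa> e = id_cell p" "\<exists>e \<in> D. \<kappa>' e = id_cell p'"
    and mor: "\<And>d e t t'. d \<in> D \<Longrightarrow> e \<in> D \<Longrightarrow>
      cell_mor (\<kappa> d) (\<kappa> e) t t' \<longleftrightarrow> cell_mor (\<kappa>' d) (\<kappa>' e) t t'"
  shows "\<exists>\<alpha>. cart_iso \<alpha> p p' \<and> (\<forall>d \<in> D. act \<alpha> (\<kappa> d) = \<kappa>' d)"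
proof -
  obtain e e' where e: "e \<in> D" "\<kappa> e = id_cell p" and e': "e' \<in> D" "\<kappa>' e' = id_cell p'"
    using surj by blast
  define \<alpha> \<beta> where "\<alpha> = mor_of p p' (\<kappa>' e)" and "\<beta> = mor_of p' p (\<kappa> e')"
  have "cart \<alpha> p p' \<and> (\<forall>d \<in> D. act \<alpha> (\<kappa> d) = \<kappa>' d)"
    unfolding \<alpha>_def
  proof (rule comparison[where D = D and \<kappa> = \<kappa> and \<kappa>' = \<kappa>' and e = e, OF p(1) \<kappa> e])
    show "cell_mor (\<kappa>' d) (\<kappa>' e) t t'" if "d \<in> D" "cell_mor (\<kappa> d) (\<kappa> e) t t'" for d t t'
      using mor[OF that(1) e(1)] that(2) by blast
  qed
  then have \<alpha>: "cart \<alpha> p p'" "\<And>d. d \<in> D \<Longrightarrow> act \<alpha> (\<kappa> d) = \<kappa>' d" by blast+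
  have "cart \<beta> p' p \<and> (\<forall>d \<in> D. act \<beta> (\<kappa>' d) = \<kappa> d)"
    unfolding \<beta>_def
  proof (rule comparison[where D = D and \<kappa> = \<kappa>' and \<kappa>' = \<kappa> and e = e', OF p(2) _ e'])
    show "cell p' (\<kappa>' d) \<and> cell p (\<kappa> d) \<and> cq (\<kappa> d) = cq (\<kappa>' d) \<and>
        lft p (\<kappa> d) = lft p' (\<kappa>' d) \<and> rgt p (\<kappa> d) = rgt p' (\<kappa>' d)" if "d \<in> D" for d
      using \<kappa>[OF that] by simp
    show "cell_mor (\<kappa> d) (\<kappa> e') t t'" if "d \<in> D" "cell_mor (\<kappa>' d) (\<kappa>' e') t t'" for d t t'
      using mor[OF that(1) e'(1)] that(2) by blast
  qed
  then have \<beta>: "cart \<beta> p' p" "\<And>d. d \<in> D \<Longrightarrow> act \<beta> (\<kappa>' d) = \<kappa> d" by blast+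
  have "vcomp \<beta> \<alpha> = cart_id p"
    by (rule cart_eqI[OF cart_vcomp[OF \<alpha>(1) \<beta>(1)] cart_id[OF p(1)]])
      (use act_vcomp[OF \<alpha>(1) \<beta>(1), of "id_cell p"] \<alpha>(2)[OF e(1)] \<beta>(2)[OF e(1)] e(2) p in simp)
  moreover have "vcomp \<alpha> \<beta> = cart_id p'"
    by (rule cart_eqI[OF cart_vcomp[OF \<beta>(1) \<alpha>(1)] cart_id[OF p(2)]])
      (use act_vcomp[OF \<beta>(1) \<alpha>(1), of "id_cell p'"] \<alpha>(2)[OF e'(1)] \<beta>(2)[OF e'(1)] e'(2) p in simp)
  ultimately show ?thesis using \<alpha> \<beta>(1) unfolding cart_iso_def by blast
qed

end

section \<open>Composition of polynomials and pairing of cells\<close>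

locale poly_choice = pb_category C for C :: "('o, 'm) precat" (structure) +
  fixes T :: "'m polynomial list \<Rightarrow> ('o, 'm) sdc"
  assumes choice: "terminal_choice C T"
begin

definition seq :: "'m polynomial \<Rightarrow> 'm polynomial \<Rightarrow> bool" where
  "seq p q \<longleftrightarrow> poly p \<and> poly q \<and> Cod C (poly3 p) = Cod C (poly1 q)"

definition y1 :: "'m polynomial \<Rightarrow> 'm polynomial \<Rightarrow> 'm cell" where
  "y1 p q = \<lparr> cq = sq2 (T [p, q]) ! 0, cr = sr (T [p, q]) ! 0, cs = ss (T [p, q]) ! 0 \<rparr>"

definition y2 :: "'m polynomial \<Rightarrow> 'm polynomial \<Rightarrow> 'm cell" where
  "y2 p q = \<lparr> cq = sq2 (T [p, q]) ! 1, cr = sr (T [p, q]) ! 1, cs = ss (T [p, q]) ! 1 \<rparr>"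

abbreviation pcomp :: "'m polynomial \<Rightarrow> 'm polynomial \<Rightarrow> 'm polynomial" where
  "pcomp p q \<equiv> poly_comp C T [p, q]"

text \<open>The outer components of the unique morphism from \<open>(c, d)\<close> to the chosen terminal subdivided composite,
whose two cells are \<open>y1\<close> and \<open>y2\<close>. By pasting, they exhibit the composite of the middle maps as a pullback
of the middle map of the composite polynomial.\<close>

definition legs :: "'m polynomial \<Rightarrow> 'm polynomial \<Rightarrow> 'm cell \<Rightarrow> 'm cell \<Rightarrow> 'm \<times> 'm" where
  "legs p q c d = (SOME (t0, t2). \<exists>t1. cell_mor c (y1 p q) t0 t1 \<and> cell_mor d (y2 p q) t1 t2)"

definition pair :: "'m polynomial \<Rightarrow> 'm polynomial \<Rightarrow> 'm cell \<Rightarrow> 'm cell \<Rightarrow> 'm cell" where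
  "pair p q c d = \<lparr> cq = cq d \<cdot> cq c, cr = fst (legs p q c d), cs = snd (legs p q c d) \<rparr>"

lemma composable_iff: "composable C [p, q] \<longleftrightarrow> seq p q"
  by (auto simp: composable_def seq_def poly_def less_Suc_eq)

lemma chosen_universal:
  assumes "seq p q"
  shows "T [p, q] = sdc_of p q (y1 p q) (y2 p q)" "universal_pair p q (y1 p q) (y2 p q)"
proof -
  have p: "poly p" "poly q" using assms by (auto simp: seq_def)
  have t: "terminal (SdC C [p, q]) (T [p, q])"
    using choice assms by (simp add: terminal_choice_def composable_iff)
  then have "is_sdc C [p, q] (T [p, q])" by (simp add: terminal_def SdC_def)
  then obtain c d where cd: "matched p q c d" "T [p, q] = sdc_of p q c d"
    using is_sdc_pair_iff[OF p] by blast
  then have "y1 p q = c" "y2 p q = d" by (simp_all add: y1_def y2_def sdc_of_def)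
  then show "T [p, q] = sdc_of p q (y1 p q) (y2 p q)" "universal_pair p q (y1 p q) (y2 p q)"
    using cd t terminal_pair_iff[OF p] by auto
qed

lemma matched_seq: "matched p q c d \<Longrightarrow> seq p q"
  using matchedD[of p q c d] cellD(10) by (auto simp: seq_def)

lemma y_matched: "seq p q \<Longrightarrow> matched p q (y1 p q) (y2 p q)"
  using chosen_universal by (simp add: universal_pair_def)

lemma pcomp_eq:
  assumes "seq p q"
  shows "pcomp p q = \<lparr> poly1 = lft p (y1 p q), poly2 = cq (y2 p q) \<cdot> cq (y1 p q),
    poly3 = rgt q (y2 p q) \<rparr>"
  using chosen_universal(1)[OF assms] by (simp add: poly_comp_def ass_def ass_poly_def sdc_of_def)

lemma pcomp_sel:
  assumes "seq p q"
  shows "poly1 (pcomp p q) = lft p (y1 p q)" "poly2 (pcomp p q) = cq (y2 p q) \<cdot> cq (y1 p q)"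
    "poly3 (pcomp p q) = rgt q (y2 p q)"
  using pcomp_eq[OF assms] by simp_all

lemma pcomp_poly:
  assumes s: "seq p q"
  shows "poly (pcomp p q)" "Cod C (poly1 (pcomp p q)) = Cod C (poly1 p)"
    "Cod C (poly3 (pcomp p q)) = Cod C (poly3 q)"
proof -
  note m = y_matched[OF s]
  note c = matchedD(1)[OF m] and d = matchedD(2)[OF m]
  note T = cell_type[OF c] cell_type[OF d] matchedD(4)[OF m] boundary_type[OF c] boundary_type[OF d]
  have "exponentiable C (cq (y2 p q) \<cdot> cq (y1 p q))"
    by (rule exponentiable_comp)
      (use exponentiable_pullback[OF polyD(6)[OF cellD(10)[OF c]] cellD(9)[OF c]]
        exponentiable_pullback[OF polyD(6)[OF cellD(10)[OF d]] cellD(9)[OF d]] T in simp_all)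
  then show "poly (pcomp p q)" "Cod C (poly1 (pcomp p q)) = Cod C (poly1 p)"
    "Cod C (poly3 (pcomp p q)) = Cod C (poly3 q)"
    using T by (simp_all add: poly_def is_polynomial_def pcomp_sel[OF s])
qed

lemma pairE:
  assumes m: "matched p q c d"
  obtains t0 t1 t2 where "cell_mor c (y1 p q) t0 t1" "cell_mor d (y2 p q) t1 t2"
    "pair p q c d = \<lparr> cq = cq d \<cdot> cq c, cr = t0, cs = t2 \<rparr>"
proof -
  have "\<exists>t0 t1 t2. cell_mor c (y1 p q) t0 t1 \<and> cell_mor d (y2 p q) t1 t2"
    using chosen_universal(2)[OF matched_seq[OF m]] m by (simp add: universal_pair_def)
  then have "\<exists>x. (\<lambda>(t0, t2). \<exists>t1. cell_mor c (y1 p q) t0 t1 \<and> cell_mor d (y2 p q) t1 t2) x" by auto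
  then have "(\<lambda>(t0, t2). \<exists>t1. cell_mor c (y1 p q) t0 t1 \<and> cell_mor d (y2 p q) t1 t2) (legs p q c d)"
    unfolding legs_def by (rule someI_ex)
  then show thesis using that by (auto simp: pair_def split: prod.splits)
qed

lemma pair_eqI:
  assumes m: "matched p q c d" and "cell_mor c (y1 p q) t0 t1" "cell_mor d (y2 p q) t1 t2"
  shows "pair p q c d = \<lparr> cq = cq d \<cdot> cq c, cr = t0, cs = t2 \<rparr>"
proof -
  obtain u0 u1 u2 where u: "cell_mor c (y1 p q) u0 u1" "cell_mor d (y2 p q) u1 u2"
    "pair p q c d = \<lparr> cq = cq d \<cdot> cq c, cr = u0, cs = u2 \<rparr>" by (rule pairE[OF m])
  have "u0 = t0 \<and> u2 = t2"
    using chosen_universal(2)[OF matched_seq[OF m]] m u(1,2) assms(2,3)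
    unfolding universal_pair_def by blast
  then show ?thesis using u(3) by simp
qed

lemma pair_cell:
  assumes m: "matched p q c d"
  shows "cell (pcomp p q) (pair p q c d)" "lft (pcomp p q) (pair p q c d) = lft p c"
    "rgt (pcomp p q) (pair p q c d) = rgt q d" "cq (pair p q c d) = cq d \<cdot> cq c"
    "Dom C (cs (pair p q c d)) = Dom C (cs d)"
proof -
  note s = matched_seq[OF m]
  note y = y_matched[OF s]
  obtain t0 t1 t2 where t: "cell_mor c (y1 p q) t0 t1" "cell_mor d (y2 p q) t1 t2"
    "pair p q c d = \<lparr> cq = cq d \<cdot> cq c, cr = t0, cs = t2 \<rparr>" by (rule pairE[OF m])
  note c = matchedD(1)[OF m] matchedD(1)[OF y] and d = matchedD(2)[OF m] matchedD(2)[OF y]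
  note T = cell_type[OF c(1)] cell_type[OF c(2)] cell_type[OF d(1)] cell_type[OF d(2)]
    matchedD(4)[OF m] matchedD(4)[OF y]
  have "is_pullback C (cq (y2 p q) \<cdot> cq (y1 p q)) t2 t0 (cq d \<cdot> cq c)"
    by (rule pullback_paste_across[OF cell_mor_pullback[OF c t(1)] cell_mor_pullback[OF d t(2)]])
      (use T in simp)
  then show "cell (pcomp p q) (pair p q c d)"
    using pcomp_poly[OF s] by (simp add: cell_def pcomp_sel[OF s] t(3))
  show "lft (pcomp p q) (pair p q c d) = lft p c" "rgt (pcomp p q) (pair p q c d) = rgt q d"
    using cell_morD[OF t(1)] cell_morD[OF t(2)] T
    by (simp_all add: lft_def rgt_def pcomp_sel[OF s] t(3))
  show "cq (pair p q c d) = cq d \<cdot> cq c" "Dom C (cs (pair p q c d)) = Dom C (cs d)"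
    using cell_morD[OF t(2)] by (simp_all add: t(3))
qed

text \<open>From right to left this is uniqueness of morphisms into the terminal subdivided composite. From
left to right, the component \<open>t1\<close> is obtained from the square of \<open>d'\<close> over \<open>y2\<close>, which is a pullback by
cancellation; the same pullback property shows that \<open>t1\<close> is compatible with the middle maps
of \<open>c\<close> and \<open>c'\<close>.\<close>

lemma pair_mor_iff:
  assumes m: "matched p q c d" and n: "matched p q c' d'"
  shows "cell_mor (pair p q c d) (pair p q c' d') t0 t2 \<longleftrightarrow>
    (\<exists>t1. cell_mor c c' t0 t1 \<and> cell_mor d d' t1 t2)"
proof -
  note s = matched_seq[OF m]
  note y = y_matched[OF s]
  obtain u0 u1 u2 where u: "cell_mor c (y1 p q) u0 u1" "cell_mor d (y2 p q) u1 u2"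
    "pair p q c d = \<lparr> cq = cq d \<cdot> cq c, cr = u0, cs = u2 \<rparr>" by (rule pairE[OF m])
  obtain v0 v1 v2 where v: "cell_mor c' (y1 p q) v0 v1" "cell_mor d' (y2 p q) v1 v2"
    "pair p q c' d' = \<lparr> cq = cq d' \<cdot> cq c', cr = v0, cs = v2 \<rparr>" by (rule pairE[OF n])
  note c = matchedD(1)[OF m] matchedD(1)[OF n] matchedD(1)[OF y]
    and d = matchedD(2)[OF m] matchedD(2)[OF n] matchedD(2)[OF y]
  note T = cell_type[OF c(1)] cell_type[OF c(2)] cell_type[OF c(3)] cell_type[OF d(1)]
    cell_type[OF d(2)] cell_type[OF d(3)] matchedD(4)[OF m] matchedD(4)[OF n] matchedD(4)[OF y]
  note U = cell_morD[OF u(1)] cell_morD[OF u(2)] and V = cell_morD[OF v(1)] cell_morD[OF v(2)]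
  show ?thesis
  proof
    assume "\<exists>t1. cell_mor c c' t0 t1 \<and> cell_mor d d' t1 t2"
    then obtain t1 where t: "cell_mor c c' t0 t1" "cell_mor d d' t1 t2" by blast
    note W = cell_morD[OF t(1)] cell_morD[OF t(2)]
    have "pair p q c d = \<lparr> cq = cq d \<cdot> cq c, cr = v0 \<cdot> t0, cs = v2 \<cdot> t2 \<rparr>"
      by (rule pair_eqI[OF m cell_mor_comp[OF c t(1) v(1)] cell_mor_comp[OF d t(2) v(2)]])
    moreover have "cq d' \<cdot> (cq c' \<cdot> t0) = t2 \<cdot> (cq d \<cdot> cq c)"
      using square_comp[OF W(16), of "cq c"] W T by simp
    ultimately show "cell_mor (pair p q c d) (pair p q c' d') t0 t2"
      using W V T v(3) by (simp add: cell_mor_def)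
  next
    assume "cell_mor (pair p q c d) (pair p q c' d') t0 t2"
    then have W: "t0 \<in> Arr C" "t2 \<in> Arr C" "Dom C t0 = Dom C (cq c)" "Cod C t0 = Dom C (cq c')"
      "Dom C t2 = Dom C (cs d)" "Cod C t2 = Dom C (cs d')"
      "cq d' \<cdot> (cq c' \<cdot> t0) = t2 \<cdot> (cq d \<cdot> cq c)" "v0 \<cdot> t0 = u0" "v2 \<cdot> t2 = u2"
      using U V T cell_morD[of "pair p q c d" "pair p q c' d'" t0 t2] by (simp_all add: u(3) v(3))
    have pb: "is_pullback C (cq (y2 p q)) v2 v1 (cq d')"
      by (rule cell_mor_pullback[OF d(2,3) v(2)])
    have "cq (y2 p q) \<cdot> u1 = v2 \<cdot> (t2 \<cdot> cq d)"
      using U(16) W(9) triangle_comp[OF W(9), of "cq d"] W(1-6) V(11,14,15) T by simp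
    then obtain t1 where t1: "t1 \<in> Arr C" "Dom C t1 = Dom C u1" "Cod C t1 = Dom C v1"
        "v1 \<cdot> t1 = u1" "cq d' \<cdot> t1 = t2 \<cdot> cq d"
      using pullback_lift[OF pb, of u1 "t2 \<cdot> cq d"] U(1-6,10-15) V(1-6,10-15) W(1-6) T by auto
    have t1': "Dom C t1 = Dom C (cq d)" "Cod C t1 = Dom C (cq d')"
      using t1(2,3) U V by simp_all
    have "cr d' \<cdot> t1 = cr d"
      using triangle_comp[OF V(17), of t1] t1(1,4) t1' U(17) V(10-15) T by simp
    moreover have "cs d' \<cdot> t2 = cs d"
      using triangle_comp[OF V(18), of t2] W(1-6,9) U(18) V(10-15) T by simp
    moreover have "cs c' \<cdot> t1 = cs c"
      using triangle_comp[OF V(9), of t1] t1(1,4) t1' U(9) V(1-6) T by simp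
    moreover have "cr c' \<cdot> t0 = cr c"
      using triangle_comp[OF V(8), of t0] W(1-6,8) U(8) V(1-6) T by simp
    moreover have "cq c' \<cdot> t0 = t1 \<cdot> cq c"
    proof (rule pullback_unique[OF pb])
      have "v1 \<cdot> (cq c' \<cdot> t0) = cq (y1 p q) \<cdot> u0"
        using square_comp[OF V(7), of t0] W(1-6,8) V(1-6) T by simp
      also have "\<dots> = v1 \<cdot> (t1 \<cdot> cq c)"
        using triangle_comp[OF t1(4), of "cq c"] U(7) t1(1) t1' V(1-6,10-15) T by simp
      finally show "v1 \<cdot> (cq c' \<cdot> t0) = v1 \<cdot> (t1 \<cdot> cq c)" .
      show "cq d' \<cdot> (cq c' \<cdot> t0) = cq d' \<cdot> (t1 \<cdot> cq c)"
        using square_comp[OF t1(5), of "cq c"] W(1-7) t1(1) t1' T by simp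
    qed (use W(1-6) t1(1) t1' V(1-6,10-15) T in simp_all)
    ultimately show "\<exists>t1. cell_mor c c' t0 t1 \<and> cell_mor d d' t1 t2"
      using W(1-6) t1(1,5) t1' T by (intro exI[of _ t1]) (simp add: cell_mor_def)
  qed
qed

text \<open>The middle map of the composite polynomial factors through the object between \<open>y1\<close> and \<open>y2\<close>. Pulling
the second factor back along \<open>cs e\<close> splits the middle map of \<open>e\<close> in two, and the pullback squares over the
two factors, pasted with \<open>y1\<close> and \<open>y2\<close>, are the required cells.\<close>

lemma pair_surj:
  assumes s: "seq p q" and e: "cell (pcomp p q) e"
  obtains c d where "matched p q c d" "pair p q c d = e"
proof -
  note y = y_matched[OF s]
  note c = matchedD(1)[OF y] and d = matchedD(2)[OF y]
  note T = cell_type[OF c] cell_type[OF d] matchedD(4)[OF y]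
  have E: "cq e \<in> Arr C" "cr e \<in> Arr C" "cs e \<in> Arr C" "Dom C (cr e) = Dom C (cq e)"
    "Cod C (cr e) = Dom C (cq (y1 p q))" "Cod C (cs e) = Dom C (cs (y2 p q))"
    "Cod C (cq e) = Dom C (cs e)"
    using cell_type[OF e] T by (simp_all add: pcomp_sel[OF s] rgt_def)
  have pbe: "is_pullback C (cq (y2 p q) \<cdot> cq (y1 p q)) (cs e) (cr e) (cq e)"
    using cellD(9)[OF e] by (simp add: pcomp_sel[OF s])
  obtain t1 m2 where M: "is_pullback C (cq (y2 p q)) (cs e) t1 m2"
    using obtain_pullback[of "cq (y2 p q)" "cs e"] E T by auto
  note SM = pullback_square[OF M]
  have "cq (y2 p q) \<cdot> (cq (y1 p q) \<cdot> cr e) = cs e \<cdot> cq e"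
    using pullback_square(9)[OF pbe] E T by simp
  then obtain m1 where m1: "m1 \<in> Arr C" "Dom C m1 = Dom C (cq e)" "Cod C m1 = Dom C t1"
      "t1 \<cdot> m1 = cq (y1 p q) \<cdot> cr e" "m2 \<cdot> m1 = cq e"
    using pullback_lift[OF M, of "cq (y1 p q) \<cdot> cr e" "cq e"] E T by auto
  have pb1: "is_pullback C (cq (y1 p q)) t1 (cr e) m1"
    by (rule pullback_cancel_across[OF M]) (use pbe m1 T SM E in simp_all)
  define c' d' where "c' = \<lparr> cq = m1, cr = cr (y1 p q) \<cdot> cr e, cs = cs (y1 p q) \<cdot> t1 \<rparr>"
    and "d' = \<lparr> cq = m2, cr = cr (y2 p q) \<cdot> t1, cs = cs (y2 p q) \<cdot> cs e \<rparr>"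
  have c': "cell p c'"
    using pullback_paste[OF cellD(9)[OF c] pb1] cellD(10)[OF c] by (simp add: cell_def c'_def)
  have d': "cell q d'"
    using pullback_paste[OF cellD(9)[OF d] M] cellD(10)[OF d] by (simp add: cell_def d'_def)
  have "poly3 p \<cdot> (cs (y1 p q) \<cdot> t1) = poly1 q \<cdot> (cr (y2 p q) \<cdot> t1)"
    using square_comp[of "poly3 p" "cs (y1 p q)" "poly1 q" "cr (y2 p q)" t1] matchedD(3)[OF y] SM T
    by (simp add: lft_def rgt_def)
  then have m: "matched p q c' d'"
    using c' d' by (simp add: matched_def c'_def d'_def lft_def rgt_def)
  have "pair p q c' d' = \<lparr> cq = cq d' \<cdot> cq c', cr = cr e, cs = cs e \<rparr>"
  proof (rule pair_eqI[OF m])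
    show "cell_mor c' (y1 p q) (cr e) t1" "cell_mor d' (y2 p q) t1 (cs e)"
      using E T SM m1 by (simp_all add: cell_mor_def c'_def d'_def)
  qed
  also have "\<dots> = e" using m1 by (cases e) (simp add: c'_def d'_def)
  finally show thesis using that m by blast
qed

lemma seq_pcomp:
  assumes "seq p q" "seq q r"
  shows "seq (pcomp p q) r" "seq p (pcomp q r)"
  using assms pcomp_poly[OF assms(1)] pcomp_poly[OF assms(2)] by (auto simp: seq_def)

lemma matched_pair_left:
  assumes "matched p q c d" "matched q r d e"
  shows "matched (pcomp p q) r (pair p q c d) e"
  using pair_cell[OF assms(1)] matchedD[OF assms(2)] by (simp add: matched_def)

lemma matched_pair_right:
  assumes "matched p q c d" "matched q r d e"
  shows "matched p (pcomp q r) c (pair q r d e)"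
  using pair_cell[OF assms(2)] matchedD[OF assms(1)] by (simp add: matched_def)

lemma pair_right_surj:
  assumes "seq p q" "seq q r" and e: "cell (pcomp p (pcomp q r)) e"
  obtains c1 c2 c3 where "matched p q c1 c2" "matched q r c2 c3"
    "pair p (pcomp q r) c1 (pair q r c2 c3) = e"
proof -
  obtain c1 d where m: "matched p (pcomp q r) c1 d" "pair p (pcomp q r) c1 d = e"
    by (rule pair_surj[OF seq_pcomp(2)[OF assms(1,2)] e])
  obtain c2 c3 where n: "matched q r c2 c3" "pair q r c2 c3 = d"
    by (rule pair_surj[OF assms(2) matchedD(2)[OF m(1)]])
  have "matched p q c1 c2"
    using matchedD[OF m(1)] matchedD[OF n(1)] pair_cell[OF n(1)] n(2) by (simp add: matched_def)
  then show thesis using that m n by blast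
qed

lemma pair_left_surj:
  assumes "seq p q" "seq q r" and e: "cell (pcomp (pcomp p q) r) e"
  obtains c1 c2 c3 where "matched p q c1 c2" "matched q r c2 c3"
    "pair (pcomp p q) r (pair p q c1 c2) c3 = e"
proof -
  obtain d c3 where m: "matched (pcomp p q) r d c3" "pair (pcomp p q) r d c3 = e"
    by (rule pair_surj[OF seq_pcomp(1)[OF assms(1,2)] e])
  obtain c1 c2 where n: "matched p q c1 c2" "pair p q c1 c2 = d"
    by (rule pair_surj[OF assms(1) matchedD(1)[OF m(1)]])
  have "matched q r c2 c3"
    using matchedD[OF m(1)] matchedD[OF n(1)] pair_cell[OF n(1)] n(2) by (simp add: matched_def)
  then show thesis using that m n by blast
qed

section \<open>Horizontal composition\<close>

abbreviation hc :: "'m cart_mor \<Rightarrow> 'm cart_mor \<Rightarrow> 'm cart_mor" where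
  "hc \<alpha> \<beta> \<equiv> cart_hcomp C T [\<alpha>, \<beta>]"

lemma seq_cart:
  assumes "cart \<alpha> p p'" "cart \<beta> q q'" "seq p q"
  shows "seq p' q'"
  by (rule matched_seq[OF act_matched[OF assms(1,2) y_matched[OF assms(3)]]])

text \<open>Pushing the chosen subdivided composite forward along \<open>\<alpha>\<close> and \<open>\<beta>\<close> means acting on its two cells.\<close>

lemma hc_eq:
  assumes \<alpha>: "cart \<alpha> p p'" and \<beta>: "cart \<beta> q q'" and s: "seq p q"
  shows "hc \<alpha> \<beta> = mor_of (pcomp p q) (pcomp p' q') (pair p' q' (act \<alpha> (y1 p q)) (act \<beta> (y2 p q)))"
proof -
  let ?c = "act \<alpha> (y1 p q)" and ?d = "act \<beta> (y2 p q)"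
  note s' = seq_cart[OF \<alpha> \<beta> s]
  note y = y_matched[OF s] and y' = y_matched[OF s']
  note m = act_matched[OF \<alpha> \<beta> y]
  note a = act_cell[OF \<alpha> matchedD(1)[OF y]] and b = act_cell[OF \<beta> matchedD(2)[OF y]]
  note T = chosen_universal(1)[OF s] chosen_universal(1)[OF s']
  have p': "poly p'" "poly q'" using cartD[OF \<alpha>] cartD[OF \<beta>] by auto
  have push: "sdc_push C [\<alpha>, \<beta>] (T [p, q]) = sdc_of p' q' ?c ?d"
    unfolding T using a b by (simp add: sdc_push_def sdc_of_def) (simp add: act_def)
  obtain t0 t1 t2 where t: "cell_mor ?c (y1 p' q') t0 t1" "cell_mor ?d (y2 p' q') t1 t2"
    "pair p' q' ?c ?d = \<lparr> cq = cq ?d \<cdot> cq ?c, cr = t0, cs = t2 \<rparr>" by (rule pairE[OF m])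
  define u where "u = \<lparr> tsrc = sdc_of p' q' ?c ?d, ttgt = T [p', q'], tarr = [t0, t1, t2] \<rparr>"
  have hom: "f \<in> hom (SdC C [p', q']) (sdc_of p' q' ?c ?d) (T [p', q']) \<longleftrightarrow> f = u" for f
  proof -
    have "f \<in> hom (SdC C [p', q']) (sdc_of p' q' ?c ?d) (T [p', q']) \<longleftrightarrow>
        (\<exists>u0 u1 u2. f = \<lparr> tsrc = sdc_of p' q' ?c ?d, ttgt = T [p', q'], tarr = [u0, u1, u2] \<rparr> \<and>
          cell_mor ?c (y1 p' q') u0 u1 \<and> cell_mor ?d (y2 p' q') u1 u2)"
      using hom_sdc_pair_iff[OF p' m y'] T(2) by simp
    moreover have "t0 = u0 \<and> t1 = u1 \<and> t2 = u2"
      if "cell_mor ?c (y1 p' q') u0 u1" "cell_mor ?d (y2 p' q') u1 u2" for u0 u1 u2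
      using chosen_universal(2)[OF s'] m t(1,2) that unfolding universal_pair_def by blast
    ultimately show ?thesis using t(1,2) unfolding u_def by blast
  qed
  have "hc \<alpha> \<beta> = far (ass C) u"
    using cartD(3,4)[OF \<alpha>] cartD(3,4)[OF \<beta>]
    by (simp add: cart_hcomp_def sdc_functor_def push hom)
  moreover have "ass_poly C (sdc_of p' q' ?c ?d) = pcomp p q"
    using a b by (simp add: pcomp_eq[OF s] ass_poly_def sdc_of_def)
  ultimately show ?thesis by (simp add: ass_def u_def mor_of_def t(3) poly_comp_def)
qed

lemma hc_cart:
  assumes \<alpha>: "cart \<alpha> p p'" and \<beta>: "cart \<beta> q q'" and s: "seq p q"
  shows "cart (hc \<alpha> \<beta>) (pcomp p q) (pcomp p' q')"
  unfolding hc_eq[OF assms]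
proof (rule cart_mor_of)
  note y = y_matched[OF s]
  note m = act_matched[OF \<alpha> \<beta> y]
  note a = act_cell[OF \<alpha> matchedD(1)[OF y]] and b = act_cell[OF \<beta> matchedD(2)[OF y]]
  let ?e = "pair p' q' (act \<alpha> (y1 p q)) (act \<beta> (y2 p q))"
  show "poly (pcomp p q)" using pcomp_poly[OF s] by simp
  show "cell (pcomp p' q') ?e" "cq ?e = poly2 (pcomp p q)" "lft (pcomp p' q') ?e = poly1 (pcomp p q)"
    "rgt (pcomp p' q') ?e = poly3 (pcomp p q)"
    using pair_cell[OF m] a b by (simp_all add: pcomp_sel[OF s])
qed

text \<open>The morphism \<open>(t0, t1, t2)\<close> that defines the pairing of \<open>c\<close> and \<open>d\<close> is also one from the cells acted on by
\<open>\<alpha>\<close> and \<open>\<beta>\<close> to the corresponding images of \<open>y1\<close> and \<open>y2\<close>, and pairing is functorial.\<close>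

lemma act_hc:
  assumes \<alpha>: "cart \<alpha> p p'" and \<beta>: "cart \<beta> q q'" and n: "matched p q c d"
  shows "act (hc \<alpha> \<beta>) (pair p q c d) = pair p' q' (act \<alpha> c) (act \<beta> d)"
proof -
  note s = matched_seq[OF n]
  note y = y_matched[OF s]
  note m = act_matched[OF \<alpha> \<beta> y] and k = act_matched[OF \<alpha> \<beta> n]
  let ?e = "pair p' q' (act \<alpha> (y1 p q)) (act \<beta> (y2 p q))"
  obtain t0 t1 t2 where t: "cell_mor c (y1 p q) t0 t1" "cell_mor d (y2 p q) t1 t2"
    "pair p q c d = \<lparr> cq = cq d \<cdot> cq c, cr = t0, cs = t2 \<rparr>" by (rule pairE[OF n])
  have "cell_mor (pair p' q' (act \<alpha> c) (act \<beta> d)) ?e t0 t2"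
    using pair_mor_iff[OF k m] act_mor[OF \<alpha> matchedD(1)[OF n] matchedD(1)[OF y] t(1)]
      act_mor[OF \<beta> matchedD(2)[OF n] matchedD(2)[OF y] t(2)] by blast
  then have "cr (pair p' q' (act \<alpha> c) (act \<beta> d)) = cr ?e \<cdot> t0"
    "cs (pair p' q' (act \<alpha> c) (act \<beta> d)) = cs ?e \<cdot> t2" by (simp_all add: cell_mor_def)
  moreover have "cq (pair p' q' (act \<alpha> c) (act \<beta> d)) = cq d \<cdot> cq c"
    using pair_cell(4)[OF k] by (simp add: act_def)
  ultimately show ?thesis
    by (auto intro!: cell.equality simp: t(3) hc_eq[OF \<alpha> \<beta> s] mor_of_def act_def[of "mor_of _ _ _"]
        act_def[of "\<lparr> csrc = _, ctgt = _, cart0 = _, cart1 = _ \<rparr>"])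
qed

text \<open>It suffices to compare two cartesian morphisms on the identity cell, and that cell is a pairing.\<close>

lemma cart_eq_on_pairs:
  assumes s: "seq p q" and "cart \<alpha> (pcomp p q) r" "cart \<beta> (pcomp p q) r"
    and e: "\<And>c d. matched p q c d \<Longrightarrow> act \<alpha> (pair p q c d) = act \<beta> (pair p q c d)"
  shows "\<alpha> = \<beta>"
proof (rule cart_eqI[OF assms(2,3)])
  obtain c d where "matched p q c d" "pair p q c d = id_cell (pcomp p q)"
    using pair_surj[OF s id_cell_cell[OF pcomp_poly(1)[OF s]]] .
  then show "act \<alpha> (id_cell (pcomp p q)) = act \<beta> (id_cell (pcomp p q))" using e by metis
qed

lemma cart_eq_on_triples:
  assumes s: "seq p q" "seq q r"
    and "cart \<alpha> (pcomp p (pcomp q r)) w" "cart \<beta> (pcomp p (pcomp q r)) w"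
    and e: "\<And>c1 c2 c3. matched p q c1 c2 \<Longrightarrow> matched q r c2 c3 \<Longrightarrow>
      act \<alpha> (pair p (pcomp q r) c1 (pair q r c2 c3)) = act \<beta> (pair p (pcomp q r) c1 (pair q r c2 c3))"
  shows "\<alpha> = \<beta>"
proof (rule cart_eqI[OF assms(3,4)])
  have "poly (pcomp p (pcomp q r))" using pcomp_poly(1)[OF seq_pcomp(2)[OF s]] .
  then obtain c1 c2 c3 where "matched p q c1 c2" "matched q r c2 c3"
    "pair p (pcomp q r) c1 (pair q r c2 c3) = id_cell (pcomp p (pcomp q r))"
    using pair_right_surj[OF s id_cell_cell] by blast
  then show "act \<alpha> (id_cell (pcomp p (pcomp q r))) = act \<beta> (id_cell (pcomp p (pcomp q r)))"
    using e by metis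
qed

lemma hc_id:
  assumes s: "seq p q"
  shows "hc (cart_id p) (cart_id q) = cart_id (pcomp p q)"
proof -
  have p: "poly p" "poly q" using s by (auto simp: seq_def)
  show ?thesis
  proof (rule cart_eq_on_pairs[OF s hc_cart[OF cart_id[OF p(1)] cart_id[OF p(2)] s]
        cart_id[OF pcomp_poly(1)[OF s]]])
    fix c d assume m: "matched p q c d"
    show "act (hc (cart_id p) (cart_id q)) (pair p q c d) = act (cart_id (pcomp p q)) (pair p q c d)"
      using act_hc[OF cart_id[OF p(1)] cart_id[OF p(2)] m] matchedD[OF m] pair_cell(1)[OF m] by simp
  qed
qed

lemma hc_vcomp:
  assumes \<alpha>: "cart \<alpha> p p'" "cart \<alpha>' p' p''" and \<beta>: "cart \<beta> q q'" "cart \<beta>' q' q''" and s: "seq p q"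
  shows "hc (vcomp \<alpha>' \<alpha>) (vcomp \<beta>' \<beta>) = vcomp (hc \<alpha>' \<beta>') (hc \<alpha> \<beta>)"
proof (rule cart_eq_on_pairs[OF s hc_cart[OF cart_vcomp[OF \<alpha>] cart_vcomp[OF \<beta>] s]])
  note s' = seq_cart[OF \<alpha>(1) \<beta>(1) s]
  note h = hc_cart[OF \<alpha>(1) \<beta>(1) s] hc_cart[OF \<alpha>(2) \<beta>(2) s']
  show "cart (vcomp (hc \<alpha>' \<beta>') (hc \<alpha> \<beta>)) (pcomp p q) (pcomp p'' q'')" by (rule cart_vcomp[OF h])
  fix c d assume m: "matched p q c d"
  note k = act_matched[OF \<alpha>(1) \<beta>(1) m]
  show "act (hc (vcomp \<alpha>' \<alpha>) (vcomp \<beta>' \<beta>)) (pair p q c d) =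
      act (vcomp (hc \<alpha>' \<beta>') (hc \<alpha> \<beta>)) (pair p q c d)"
    using act_hc[OF cart_vcomp[OF \<alpha>] cart_vcomp[OF \<beta>] m] act_vcomp[OF h pair_cell(1)[OF m]]
      act_hc[OF \<alpha>(1) \<beta>(1) m] act_hc[OF \<alpha>(2) \<beta>(2) k] act_vcomp[OF \<alpha> matchedD(1)[OF m]]
      act_vcomp[OF \<beta> matchedD(2)[OF m]] by simp
qed

section \<open>Associativity\<close>

text \<open>The polynomials are listed in the order in which they are applied, so \<open>pcomp p (pcomp q r)\<close> is the
composite \<open>(r q) p\<close>, and the associator goes from it to \<open>r (q p)\<close>.\<close>

definition assoc_spec where
  "assoc_spec p q r \<alpha> \<longleftrightarrow> cart_iso \<alpha> (pcomp p (pcomp q r)) (pcomp (pcomp p q) r) \<and>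
    (\<forall>c1 c2 c3. matched p q c1 c2 \<longrightarrow> matched q r c2 c3 \<longrightarrow>
      act \<alpha> (pair p (pcomp q r) c1 (pair q r c2 c3)) = pair (pcomp p q) r (pair p q c1 c2) c3)"

definition assoc :: "'m polynomial \<Rightarrow> 'm polynomial \<Rightarrow> 'm polynomial \<Rightarrow> 'm cart_mor" where
  "assoc p q r = (SOME \<alpha>. assoc_spec p q r \<alpha>)"

lemma cart_isoD: "cart_iso \<alpha> p p' \<Longrightarrow> cart \<alpha> p p'"
  by (simp add: cart_iso_def)

text \<open>Both ways of pairing three cells have as morphisms the triples of morphisms that agree in the two middle
objects, and both reach every cell, in particular the identity cell.\<close>

lemma assoc:
  assumes s: "seq p q" "seq q r"
  shows "cart_iso (assoc p q r) (pcomp p (pcomp q r)) (pcomp (pcomp p q) r)"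
    and "\<And>c1 c2 c3. matched p q c1 c2 \<Longrightarrow> matched q r c2 c3 \<Longrightarrow>
      act (assoc p q r) (pair p (pcomp q r) c1 (pair q r c2 c3)) =
      pair (pcomp p q) r (pair p q c1 c2) c3"
proof -
  let ?p = "pcomp p (pcomp q r)" and ?p' = "pcomp (pcomp p q) r"
  define D where "D = {(c1, c2, c3). matched p q c1 c2 \<and> matched q r c2 c3}"
  define \<kappa> \<kappa>' where "\<kappa> = (\<lambda>(c1, c2, c3). pair p (pcomp q r) c1 (pair q r c2 c3))"
    and "\<kappa>' = (\<lambda>(c1, c2, c3). pair (pcomp p q) r (pair p q c1 c2) c3)"
  have P: "poly ?p" "poly ?p'"
    using pcomp_poly(1)[OF seq_pcomp(2)[OF s]] pcomp_poly(1)[OF seq_pcomp(1)[OF s]] by auto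
  have "\<exists>\<alpha>. cart_iso \<alpha> ?p ?p' \<and> (\<forall>d \<in> D. act \<alpha> (\<kappa> d) = \<kappa>' d)"
  proof (rule comparison_iso[OF P])
    fix d assume "d \<in> D"
    then obtain c1 c2 c3 where d: "d = (c1, c2, c3)" and m: "matched p q c1 c2" "matched q r c2 c3"
      by (auto simp: D_def)
    note l = pair_cell[OF matched_pair_left[OF m]] and r = pair_cell[OF matched_pair_right[OF m]]
    show "cell ?p (\<kappa> d) \<and> cell ?p' (\<kappa>' d) \<and> cq (\<kappa>' d) = cq (\<kappa> d) \<and>
        lft ?p' (\<kappa>' d) = lft ?p (\<kappa> d) \<and> rgt ?p' (\<kappa>' d) = rgt ?p (\<kappa> d)"
      using l r pair_cell[OF m(1)] pair_cell[OF m(2)] cell_type[OF matchedD(1)[OF m(1)]]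
        cell_type[OF matchedD(1)[OF m(2)]] cell_type[OF matchedD(2)[OF m(2)]]
        matchedD(4)[OF m(1)] matchedD(4)[OF m(2)] by (simp add: d \<kappa>_def \<kappa>'_def)
  next
    obtain c1 c2 c3 where "matched p q c1 c2" "matched q r c2 c3"
      "pair p (pcomp q r) c1 (pair q r c2 c3) = id_cell ?p"
      by (rule pair_right_surj[OF s id_cell_cell[OF P(1)]])
    then show "\<exists>e \<in> D. \<kappa> e = id_cell ?p"
      by (intro bexI[of _ "(c1, c2, c3)"]) (auto simp: D_def \<kappa>_def)
  next
    obtain c1 c2 c3 where "matched p q c1 c2" "matched q r c2 c3"
      "pair (pcomp p q) r (pair p q c1 c2) c3 = id_cell ?p'"
      by (rule pair_left_surj[OF s id_cell_cell[OF P(2)]])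
    then show "\<exists>e \<in> D. \<kappa>' e = id_cell ?p'"
      by (intro bexI[of _ "(c1, c2, c3)"]) (auto simp: D_def \<kappa>'_def)
  next
    fix d e t t' assume "d \<in> D" "e \<in> D"
    then obtain c1 c2 c3 d1 d2 d3 where d: "d = (c1, c2, c3)" "e = (d1, d2, d3)"
      and m: "matched p q c1 c2" "matched q r c2 c3" "matched p q d1 d2" "matched q r d2 d3"
      by (auto simp: D_def)
    have "cell_mor (\<kappa> d) (\<kappa> e) t t' \<longleftrightarrow>
        (\<exists>u v. cell_mor c1 d1 t u \<and> cell_mor c2 d2 u v \<and> cell_mor c3 d3 v t')"
      using pair_mor_iff[OF matched_pair_right[OF m(1,2)] matched_pair_right[OF m(3,4)]]
        pair_mor_iff[OF m(2,4)] by (auto simp: d \<kappa>_def)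
    also have "\<dots> \<longleftrightarrow> cell_mor (\<kappa>' d) (\<kappa>' e) t t'"
      using pair_mor_iff[OF matched_pair_left[OF m(1,2)] matched_pair_left[OF m(3,4)]]
        pair_mor_iff[OF m(1,3)] by (auto simp: d \<kappa>'_def)
    finally show "cell_mor (\<kappa> d) (\<kappa> e) t t' \<longleftrightarrow> cell_mor (\<kappa>' d) (\<kappa>' e) t t'" .
  qed
  then obtain \<alpha> where "assoc_spec p q r \<alpha>"
    unfolding assoc_spec_def D_def \<kappa>_def \<kappa>'_def by auto
  then have "assoc_spec p q r (assoc p q r)" unfolding assoc_def by (rule someI)
  then show "cart_iso (assoc p q r) ?p ?p'"
    "\<And>c1 c2 c3. matched p q c1 c2 \<Longrightarrow> matched q r c2 c3 \<Longrightarrow>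
      act (assoc p q r) (pair p (pcomp q r) c1 (pair q r c2 c3)) =
      pair (pcomp p q) r (pair p q c1 c2) c3" unfolding assoc_spec_def by blast+
qed

lemmas assoc_cart = assoc(1)[THEN cart_isoD]

lemma assoc_natural:
  assumes a: "cart a p p'" and b: "cart b q q'" and c: "cart c r r'" and s: "seq p q" "seq q r"
  shows "vcomp (assoc p' q' r') (hc a (hc b c)) = vcomp (hc (hc a b) c) (assoc p q r)"
proof -
  note s' = seq_cart[OF a b s(1)] seq_cart[OF b c s(2)]
  note L = hc_cart[OF a hc_cart[OF b c s(2)] seq_pcomp(2)[OF s]] assoc_cart[OF s']
  note R = assoc_cart[OF s] hc_cart[OF hc_cart[OF a b s(1)] c seq_pcomp(1)[OF s]]
  show ?thesis
  proof (rule cart_eq_on_triples[OF s cart_vcomp[OF L] cart_vcomp[OF R]])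
    fix c1 c2 c3 assume m: "matched p q c1 c2" "matched q r c2 c3"
    note n = act_matched[OF a b m(1)] act_matched[OF b c m(2)]
    let ?x = "pair p (pcomp q r) c1 (pair q r c2 c3)"
    note x = pair_cell(1)[OF matched_pair_right[OF m]]
    have "act (vcomp (assoc p' q' r') (hc a (hc b c))) ?x =
        pair (pcomp p' q') r' (pair p' q' (act a c1) (act b c2)) (act c c3)"
      using act_vcomp[OF L x] act_hc[OF a hc_cart[OF b c s(2)] matched_pair_right[OF m]]
        act_hc[OF b c m(2)] assoc(2)[OF s' n] by simp
    also have "\<dots> = act (vcomp (hc (hc a b) c) (assoc p q r)) ?x"
      using act_vcomp[OF R x] act_hc[OF hc_cart[OF a b s(1)] c matched_pair_left[OF m]]
        act_hc[OF a b m(1)] assoc(2)[OF s m] by simp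
    finally show "act (vcomp (assoc p' q' r') (hc a (hc b c))) ?x =
        act (vcomp (hc (hc a b) c) (assoc p q r)) ?x" .
  qed
qed

lemma assoc_pentagon:
  assumes s: "seq f g" "seq g h" "seq h k"
  shows "vcomp (hc (assoc f g h) (cart_id k))
      (vcomp (assoc f (pcomp g h) k) (hc (cart_id f) (assoc g h k))) =
    vcomp (assoc (pcomp f g) h k) (assoc f g (pcomp h k))"
proof -
  have i: "cart (cart_id f) f f" "cart (cart_id k) k k" using s by (auto simp: seq_def cart_id)
  note sgh = seq_pcomp[OF s(1,2)] and shk = seq_pcomp[OF s(2,3)]
  note sfgh = seq_pcomp[OF sgh(2) shk(1)]
  note A1 = hc_cart[OF i(1) assoc_cart[OF s(2,3)] seq_pcomp(2)[OF s(1) shk(2)]]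
  note A2 = assoc_cart[OF sgh(2) shk(1)]
  note A3 = hc_cart[OF assoc_cart[OF s(1,2)] i(2) sfgh(1)]
  note B1 = assoc_cart[OF s(1) shk(2)] and B2 = assoc_cart[OF sgh(1) s(3)]
  show ?thesis
  proof (rule cart_eq_on_triples[OF s(1) shk(2) cart_vcomp[OF cart_vcomp[OF A1 A2] A3]
        cart_vcomp[OF B1 B2]])
    fix c1 c2 d assume m: "matched f g c1 c2" "matched g (pcomp h k) c2 d"
    obtain c3 c4 where n: "matched h k c3 c4" and d: "d = pair h k c3 c4"
      using pair_surj[OF s(3) matchedD(2)[OF m(2)]] by metis
    have m2: "matched g h c2 c3"
      using matchedD[OF m(2)] matchedD[OF n] pair_cell[OF n] d by (simp add: matched_def)
    let ?x = "pair f (pcomp g (pcomp h k)) c1 (pair g (pcomp h k) c2 d)"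
    note e = matched_pair_left[OF m2 n] and e' = matched_pair_right[OF m(1) m2]
    note x = pair_cell(1)[OF matched_pair_right[OF m]]
    have f: "cell f c1" "cell k c4" using matchedD[OF m(1)] matchedD[OF n] by auto
    have "act (vcomp (hc (assoc f g h) (cart_id k))
        (vcomp (assoc f (pcomp g h) k) (hc (cart_id f) (assoc g h k)))) ?x =
        act (hc (assoc f g h) (cart_id k)) (act (assoc f (pcomp g h) k)
          (act (hc (cart_id f) (assoc g h k)) ?x))"
      using act_vcomp[OF cart_vcomp[OF A1 A2] A3 x] act_vcomp[OF A1 A2 x] by simp
    also have "act (hc (cart_id f) (assoc g h k)) ?x =
        pair f (pcomp (pcomp g h) k) c1 (pair (pcomp g h) k (pair g h c2 c3) c4)"
      using act_hc[OF i(1) assoc_cart[OF s(2,3)] matched_pair_right[OF m]] assoc(2)[OF s(2,3) m2 n] f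
      by (simp add: d)
    also have "act (assoc f (pcomp g h) k) \<dots> =
        pair (pcomp f (pcomp g h)) k (pair f (pcomp g h) c1 (pair g h c2 c3)) c4"
      by (rule assoc(2)[OF sgh(2) shk(1) e' e])
    also have "act (hc (assoc f g h) (cart_id k)) \<dots> =
        pair (pcomp (pcomp f g) h) k (pair (pcomp f g) h (pair f g c1 c2) c3) c4"
      using act_hc[OF assoc_cart[OF s(1,2)] i(2) matched_pair_left[OF e' e]]
        assoc(2)[OF s(1,2) m(1) m2] f by simp
    also have "\<dots> = act (assoc (pcomp f g) h k) (pair (pcomp f g) (pcomp h k) (pair f g c1 c2) d)"
      using assoc(2)[OF sgh(1) s(3) matched_pair_left[OF m(1) m2] n] d by simp
    also have "\<dots> = act (vcomp (assoc (pcomp f g) h k) (assoc f g (pcomp h k))) ?x"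
      using act_vcomp[OF B1 B2 x] assoc(2)[OF s(1) shk(2) m] by simp
    finally show "act (vcomp (hc (assoc f g h) (cart_id k))
        (vcomp (assoc f (pcomp g h) k) (hc (cart_id f) (assoc g h k)))) ?x =
      act (vcomp (assoc (pcomp f g) h k) (assoc f g (pcomp h k))) ?x" .
  qed
qed

end

section \<open>Units\<close>

context pb_category
begin

text \<open>Among the cells into the identity polynomial, those with an identity as middle map suffice for
the unit laws, since every other one is isomorphic to one of them (\<open>identity_cell_iso\<close>).\<close>

definition unit_cell :: "'m \<Rightarrow> 'm cell" where
  "unit_cell x = \<lparr> cq = Ident C (Dom C x), cr = x, cs = x \<rparr>"

lemma poly_ident_poly:
  assumes "X \<in> Obj C"
  shows "poly (poly_ident C X)"
  using assms exponentiable_ident by (auto simp: poly_def is_polynomial_def poly_ident_def)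

lemma poly_ident_sel [simp]:
  "poly1 (poly_ident C X) = Ident C X" "poly2 (poly_ident C X) = Ident C X"
  "poly3 (poly_ident C X) = Ident C X"
  by (simp_all add: poly_ident_def)

lemma unit_cell:
  assumes "x \<in> Arr C" "Cod C x = X"
  shows "cell (poly_ident C X) (unit_cell x)" "lft (poly_ident C X) (unit_cell x) = x"
    "rgt (poly_ident C X) (unit_cell x) = x"
proof -
  have "X \<in> Obj C" using assms cod_obj by blast
  then show "cell (poly_ident C X) (unit_cell x)"
    using pullback_swap[OF pullback_ident[of x]] assms poly_ident_poly
    by (simp add: cell_def unit_cell_def)
  show "lft (poly_ident C X) (unit_cell x) = x" "rgt (poly_ident C X) (unit_cell x) = x"
    using assms by (simp_all add: lft_def rgt_def unit_cell_def)
qed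

lemma unit_cell_mor_iff:
  assumes "x \<in> Arr C" "x' \<in> Arr C"
  shows "cell_mor (unit_cell x) (unit_cell x') t t' \<longleftrightarrow>
    t = t' \<and> t \<in> Arr C \<and> Dom C t = Dom C x \<and> Cod C t = Dom C x' \<and> x' \<cdot> t = x"
  using assms by (auto simp: cell_mor_def unit_cell_def)

text \<open>The middle map of a cell into the identity polynomial is a pullback of an identity. So it is invertible,
although it need not be an identity itself as in \<open>unit_cell\<close>.\<close>

lemma identity_cell_iso:
  assumes X: "X \<in> Obj C" and c: "cell (poly_ident C X) c"
  obtains i where "i \<in> Arr C" "Dom C i = Dom C (cs c)" "Cod C i = Dom C (cq c)"
    "cq c \<cdot> i = Ident C (Dom C (cs c))" "i \<cdot> cq c = Ident C (Dom C (cq c))"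
    "cr c \<cdot> i = cs c" "cs c \<cdot> cq c = cr c" "Cod C (cr c) = X" "Cod C (cs c) = X"
proof -
  note T = cell_type(1-7)[OF c] and pb = cellD(9)[OF c]
  have TX: "Cod C (cr c) = X" "Cod C (cs c) = X" using T X by simp_all
  obtain i where i: "i \<in> Arr C" "Dom C i = Dom C (cs c)" "Cod C i = Dom C (cr c)"
      "cr c \<cdot> i = cs c" "cq c \<cdot> i = Ident C (Dom C (cs c))"
    using pullback_lift[OF pb, of "cs c" "Ident C (Dom C (cs c))"] T X by auto
  have sq: "cs c \<cdot> cq c = cr c" using cellD(8)[OF c] T TX X by simp
  have e: "cr c \<cdot> (i \<cdot> cq c) = cr c" "cq c \<cdot> (i \<cdot> cq c) = cq c"
    using triangle_comp[OF i(4), of "cq c"] triangle_comp[OF i(5), of "cq c"] i T sq by simp_all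
  have "i \<cdot> cq c = Ident C (Dom C (cq c))"
    by (rule pullback_unique[OF pb]) (use i T e in simp_all)
  then show thesis using that i T TX sq by simp
qed

end

context poly_choice
begin

abbreviation then_unit :: "'m polynomial \<Rightarrow> 'm polynomial" where
  "then_unit p \<equiv> pcomp p (poly_ident C (Cod C (poly3 p)))"

abbreviation unit_then :: "'m polynomial \<Rightarrow> 'm polynomial" where
  "unit_then p \<equiv> pcomp (poly_ident C (Cod C (poly1 p))) p"

abbreviation post_unit :: "'m polynomial \<Rightarrow> 'm cell \<Rightarrow> 'm cell" where
  "post_unit p c \<equiv> pair p (poly_ident C (Cod C (poly3 p))) c (unit_cell (rgt p c))"

abbreviation pre_unit :: "'m polynomial \<Rightarrow> 'm cell \<Rightarrow> 'm cell" where
  "pre_unit p c \<equiv> pair (poly_ident C (Cod C (poly1 p))) p (unit_cell (lft p c)) c"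

lemma seq_unit:
  assumes "poly p"
  shows "seq p (poly_ident C (Cod C (poly3 p)))" "seq (poly_ident C (Cod C (poly1 p))) p"
  using assms polyD[OF assms] poly_ident_poly by (simp_all add: seq_def)

lemma matched_unit:
  assumes "cell p c"
  shows "matched p (poly_ident C (Cod C (poly3 p))) c (unit_cell (rgt p c))"
    "matched (poly_ident C (Cod C (poly1 p))) p (unit_cell (lft p c)) c"
  using assms boundary_type[OF assms] unit_cell[of "rgt p c"] unit_cell[of "lft p c"]
  by (simp_all add: matched_def)

text \<open>A cell into \<open>p\<close> followed by the identity is a pairing of some \<open>c1\<close> and \<open>c2\<close>. The invertible middle map of
\<open>c2\<close> can be absorbed into \<open>c1\<close>; this changes the pair \<open>(c1, c2)\<close> by an isomorphism that is the identity at
both outer ends, so it does not change the pairing.\<close>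

lemma post_unit_surj:
  assumes p: "poly p" and e: "cell (then_unit p) e"
  obtains c where "cell p c" "post_unit p c = e"
proof -
  let ?I = "poly_ident C (Cod C (poly3 p))"
  have X: "Cod C (poly3 p) \<in> Obj C" using polyD(3)[OF p] by simp
  obtain c1 c2 where m: "matched p ?I c1 c2" "pair p ?I c1 c2 = e"
    by (rule pair_surj[OF seq_unit(1)[OF p] e])
  note T = cell_type[OF matchedD(1)[OF m(1)]] cell_type(1-4,7)[OF matchedD(2)[OF m(1)]]
    matchedD(4)[OF m(1)]
  obtain i where i: "i \<in> Arr C" "Dom C i = Dom C (cs c2)" "Cod C i = Dom C (cq c2)"
    "cq c2 \<cdot> i = Ident C (Dom C (cs c2))" "i \<cdot> cq c2 = Ident C (Dom C (cq c2))"
    "cr c2 \<cdot> i = cs c2" "cs c2 \<cdot> cq c2 = cr c2" "Cod C (cr c2) = Cod C (poly3 p)"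
    by (rule identity_cell_iso[OF X matchedD(2)[OF m(1)]])
  define c where "c = \<lparr> cq = cq c2 \<cdot> cq c1, cr = cr c1, cs = cs c1 \<cdot> i \<rparr>"
  have sq: "cq c1 \<cdot> Ident C (Dom C (cq c1)) = i \<cdot> (cq c2 \<cdot> cq c1)"
    using triangle_comp[OF i(5), of "cq c1"] i T by simp
  have "is_pullback C (cq c1) i (Ident C (Dom C (cq c1))) (cq c2 \<cdot> cq c1)"
    by (rule pullback_iso[where a' = "cq c2" and b' = "Ident C (Dom C (cq c1))"])
      (use i(1-5) T sq in simp_all)
  from pullback_paste[OF cellD(9)[OF matchedD(1)[OF m(1)]] this]
  have c: "cell p c" using T p by (simp add: cell_def c_def)
  have "rgt p c1 = cr c2" using matchedD(3)[OF m(1)] T i(8) by (simp add: lft_def)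
  then have "poly3 p \<cdot> (cs c1 \<cdot> i) = cr c2 \<cdot> i"
    using triangle_comp[of "poly3 p" "cs c1" "cr c2" i] i T by (simp add: rgt_def)
  then have x: "rgt p c = cs c2" using i by (simp add: rgt_def c_def)
  have e1: "(cs c1 \<cdot> i) \<cdot> cq c2 = cs c1" using i T by simp
  have "cell_mor c1 c (Ident C (Dom C (cq c1))) (cq c2)"
    "cell_mor c2 (unit_cell (rgt p c)) (cq c2) (Ident C (Dom C (cs c2)))"
    using T i e1 unfolding x by (simp_all add: cell_mor_def c_def unit_cell_def)
  then have "cell_mor e (post_unit p c) (Ident C (Dom C (cq c1))) (Ident C (Dom C (cs c2)))"
    using pair_mor_iff[OF m(1) matched_unit(1)[OF c]] m(2) by blast
  then have M: "cr (post_unit p c) \<cdot> Ident C (Dom C (cq c1)) = cr e"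
    "cs (post_unit p c) \<cdot> Ident C (Dom C (cs c2)) = cs e" by (simp_all add: cell_mor_def)
  note P = pair_cell[OF matched_unit(1)[OF c]] and E = pair_cell(4,5)[OF m(1), unfolded m(2)]
  have q: "cq (post_unit p c) = cq e"
    using P(4) E T i x by (simp add: unit_cell_def c_def)
  have "cr (post_unit p c) = cr e" "cs (post_unit p c) = cs e"
    using M q cell_type(1-4)[OF P(1)] P(5) E T x by (simp_all add: unit_cell_def)
  with q have "post_unit p c = e" by (simp add: cell.equality)
  then show thesis using that c by blast
qed

lemma pre_unit_surj:
  assumes p: "poly p" and e: "cell (unit_then p) e"
  obtains c where "cell p c" "pre_unit p c = e"
proof -
  let ?I = "poly_ident C (Cod C (poly1 p))"
  have X: "Cod C (poly1 p) \<in> Obj C" using polyD(1)[OF p] by simp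
  obtain c1 c2 where m: "matched ?I p c1 c2" "pair ?I p c1 c2 = e"
    by (rule pair_surj[OF seq_unit(2)[OF p] e])
  note T = cell_type[OF matchedD(2)[OF m(1)]] cell_type(1-4,7)[OF matchedD(1)[OF m(1)]]
    matchedD(4)[OF m(1)]
  obtain i where i: "i \<in> Arr C" "Dom C i = Dom C (cs c1)" "Cod C i = Dom C (cq c1)"
    "cq c1 \<cdot> i = Ident C (Dom C (cs c1))" "i \<cdot> cq c1 = Ident C (Dom C (cq c1))"
    "cr c1 \<cdot> i = cs c1" "cs c1 \<cdot> cq c1 = cr c1" "Cod C (cs c1) = Cod C (poly1 p)"
    by (rule identity_cell_iso[OF X matchedD(1)[OF m(1)]])
  define c where "c = \<lparr> cq = cq c2 \<cdot> cq c1, cr = cr c2 \<cdot> cq c1, cs = cs c2 \<rparr>"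
  have "is_pullback C (cq c2) (Ident C (Dom C (cs c2))) (cq c1) (cq c2 \<cdot> cq c1)"
    by (rule pullback_iso[where a' = "Ident C (Dom C (cs c2))" and b' = i])
      (use i(1-5) T in simp_all)
  from pullback_paste[OF cellD(9)[OF matchedD(2)[OF m(1)]] this]
  have c: "cell p c" using T p by (simp add: cell_def c_def)
  have "lft p c2 = cs c1" using matchedD(3)[OF m(1)] T i(8) by (simp add: rgt_def)
  then have "poly1 p \<cdot> (cr c2 \<cdot> cq c1) = cs c1 \<cdot> cq c1"
    using triangle_comp[of "poly1 p" "cr c2" "cs c1" "cq c1"] T by (simp add: lft_def)
  then have x: "lft p c = cr c1" using i by (simp add: lft_def c_def)
  have e1: "(cq c2 \<cdot> cq c1) \<cdot> i = cq c2" "(cr c2 \<cdot> cq c1) \<cdot> i = cr c2" using i T by simp_all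
  have "cell_mor c1 (unit_cell (lft p c)) (Ident C (Dom C (cq c1))) i"
    "cell_mor c2 c i (Ident C (Dom C (cs c2)))"
    using T i e1 unfolding x by (simp_all add: cell_mor_def c_def unit_cell_def)
  then have "cell_mor e (pre_unit p c) (Ident C (Dom C (cq c1))) (Ident C (Dom C (cs c2)))"
    using pair_mor_iff[OF m(1) matched_unit(2)[OF c]] m(2) by blast
  then have M: "cr (pre_unit p c) \<cdot> Ident C (Dom C (cq c1)) = cr e"
    "cs (pre_unit p c) \<cdot> Ident C (Dom C (cs c2)) = cs e" by (simp_all add: cell_mor_def)
  note P = pair_cell[OF matched_unit(2)[OF c]] and E = pair_cell(4,5)[OF m(1), unfolded m(2)]
  have q: "cq (pre_unit p c) = cq e"
    using P(4) E T i x by (simp add: unit_cell_def c_def)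
  have "Dom C (cs c) = Dom C (cs c2)" by (simp add: c_def)
  then have "cr (pre_unit p c) = cr e" "cs (pre_unit p c) = cs e"
    using M q cell_type(1-4)[OF P(1)] P(5) E T x by simp_all
  with q have "pre_unit p c = e" by (simp add: cell.equality)
  then show thesis using that c by blast
qed

definition post_spec where
  "post_spec p \<alpha> \<longleftrightarrow> cart_iso \<alpha> (then_unit p) p \<and> (\<forall>c. cell p c \<longrightarrow> act \<alpha> (post_unit p c) = c)"

definition pre_spec where
  "pre_spec p \<alpha> \<longleftrightarrow> cart_iso \<alpha> (unit_then p) p \<and> (\<forall>c. cell p c \<longrightarrow> act \<alpha> (pre_unit p c) = c)"

definition drop_post :: "'m polynomial \<Rightarrow> 'm cart_mor" where
  "drop_post p = (SOME \<alpha>. post_spec p \<alpha>)"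

definition drop_pre :: "'m polynomial \<Rightarrow> 'm cart_mor" where
  "drop_pre p = (SOME \<alpha>. pre_spec p \<alpha>)"

text \<open>A morphism between unit cells is a single map over their boundaries. Hence a morphism between the
pairings of \<open>c\<close> and \<open>d\<close> with unit cells is just a morphism from \<open>c\<close> to \<open>d\<close>.\<close>

lemma drop_post:
  assumes p: "poly p"
  shows "cart_iso (drop_post p) (then_unit p) p"
    and "\<And>c. cell p c \<Longrightarrow> act (drop_post p) (post_unit p c) = c"
proof -
  have "\<exists>\<alpha>. cart_iso \<alpha> (then_unit p) p \<and> (\<forall>c \<in> Collect (cell p). act \<alpha> (post_unit p c) = c)"
  proof (rule comparison_iso[OF pcomp_poly(1)[OF seq_unit(1)[OF p]] p])
    fix c assume "c \<in> Collect (cell p)"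
    then have c: "cell p c" by simp
    note P = pair_cell[OF matched_unit(1)[OF c]]
    show "cell (then_unit p) (post_unit p c) \<and> cell p c \<and> cq c = cq (post_unit p c) \<and>
        lft p c = lft (then_unit p) (post_unit p c) \<and> rgt p c = rgt (then_unit p) (post_unit p c)"
      using P c unit_cell[of "rgt p c"] boundary_type[OF c] cell_type[OF c]
      by (simp add: unit_cell_def)
  next
    obtain c where "cell p c" "post_unit p c = id_cell (then_unit p)"
      by (rule post_unit_surj[OF p id_cell_cell[OF pcomp_poly(1)[OF seq_unit(1)[OF p]]]])
    then show "\<exists>c \<in> Collect (cell p). post_unit p c = id_cell (then_unit p)" by blast
    show "\<exists>c \<in> Collect (cell p). c = id_cell p" using p by simp
  next
    fix c d t t' assume "c \<in> Collect (cell p)" "d \<in> Collect (cell p)"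
    then have c: "cell p c" and d: "cell p d" by auto
    note B = boundary_type[OF c] boundary_type[OF d]
    have "rgt p d \<cdot> t' = rgt p c" if "cell_mor c d t t'"
      using cell_morD[OF that] cell_type[OF c] cell_type[OF d] by (simp add: rgt_def)
    then have "cell_mor c d t t' \<longleftrightarrow>
        (\<exists>u. cell_mor c d t u \<and> cell_mor (unit_cell (rgt p c)) (unit_cell (rgt p d)) u t')"
      using B unit_cell_mor_iff[OF B(2,8)] cell_morD[of c d t t'] by auto
    then show "cell_mor (post_unit p c) (post_unit p d) t t' \<longleftrightarrow> cell_mor c d t t'"
      using pair_mor_iff[OF matched_unit(1)[OF c] matched_unit(1)[OF d]] by simp
  qed
  then obtain \<alpha> where "post_spec p \<alpha>" unfolding post_spec_def by auto
  then have "post_spec p (drop_post p)" unfolding drop_post_def by (rule someI)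
  then show "cart_iso (drop_post p) (then_unit p) p"
    "\<And>c. cell p c \<Longrightarrow> act (drop_post p) (post_unit p c) = c" unfolding post_spec_def by blast+
qed

lemma drop_pre:
  assumes p: "poly p"
  shows "cart_iso (drop_pre p) (unit_then p) p"
    and "\<And>c. cell p c \<Longrightarrow> act (drop_pre p) (pre_unit p c) = c"
proof -
  have "\<exists>\<alpha>. cart_iso \<alpha> (unit_then p) p \<and> (\<forall>c \<in> Collect (cell p). act \<alpha> (pre_unit p c) = c)"
  proof (rule comparison_iso[OF pcomp_poly(1)[OF seq_unit(2)[OF p]] p])
    fix c assume "c \<in> Collect (cell p)"
    then have c: "cell p c" by simp
    note P = pair_cell[OF matched_unit(2)[OF c]]
    show "cell (unit_then p) (pre_unit p c) \<and> cell p c \<and> cq c = cq (pre_unit p c) \<and>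
        lft p c = lft (unit_then p) (pre_unit p c) \<and> rgt p c = rgt (unit_then p) (pre_unit p c)"
      using P c unit_cell[of "lft p c"] boundary_type[OF c] cell_type[OF c]
      by (simp add: unit_cell_def)
  next
    obtain c where "cell p c" "pre_unit p c = id_cell (unit_then p)"
      by (rule pre_unit_surj[OF p id_cell_cell[OF pcomp_poly(1)[OF seq_unit(2)[OF p]]]])
    then show "\<exists>c \<in> Collect (cell p). pre_unit p c = id_cell (unit_then p)" by blast
    show "\<exists>c \<in> Collect (cell p). c = id_cell p" using p by simp
  next
    fix c d t t' assume "c \<in> Collect (cell p)" "d \<in> Collect (cell p)"
    then have c: "cell p c" and d: "cell p d" by auto
    note B = boundary_type[OF c] boundary_type[OF d]
    have "lft p d \<cdot> t = lft p c" if "cell_mor c d t t'"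
      using cell_morD[OF that] cell_type[OF c] cell_type[OF d] by (simp add: lft_def)
    then have "cell_mor c d t t' \<longleftrightarrow>
        (\<exists>u. cell_mor (unit_cell (lft p c)) (unit_cell (lft p d)) t u \<and> cell_mor c d u t')"
      using B unit_cell_mor_iff[OF B(1,7)] cell_morD[of c d t t'] by auto
    then show "cell_mor (pre_unit p c) (pre_unit p d) t t' \<longleftrightarrow> cell_mor c d t t'"
      using pair_mor_iff[OF matched_unit(2)[OF c] matched_unit(2)[OF d]] by simp
  qed
  then obtain \<alpha> where "pre_spec p \<alpha>" unfolding pre_spec_def by auto
  then have "pre_spec p (drop_pre p)" unfolding drop_pre_def by (rule someI)
  then show "cart_iso (drop_pre p) (unit_then p) p"
    "\<And>c. cell p c \<Longrightarrow> act (drop_pre p) (pre_unit p c) = c" unfolding pre_spec_def by blast+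
qed

lemmas drop_post_cart = drop_post(1)[THEN cart_isoD]
lemmas drop_pre_cart = drop_pre(1)[THEN cart_isoD]

lemma act_id_unit:
  assumes "x \<in> Arr C" "Cod C x = X"
  shows "act (cart_id (poly_ident C X)) (unit_cell x) = unit_cell x"
  using unit_cell(1)[OF assms] by simp

lemma cart_cod:
  assumes "cart a p p'"
  shows "Cod C (poly1 p') = Cod C (poly1 p)" "Cod C (poly3 p') = Cod C (poly3 p)"
proof -
  note A = cartD[OF assms] and P = polyD[OF cartD(2)[OF assms]]
  have "Cod C (poly1 p' \<cdot> cart0 a) = Cod C (poly1 p')" "Cod C (poly3 p' \<cdot> cart1 a) = Cod C (poly3 p')"
    using A(5-10) P by simp_all
  then show "Cod C (poly1 p') = Cod C (poly1 p)" "Cod C (poly3 p') = Cod C (poly3 p)"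
    using A(11,12) by simp_all
qed

lemma drop_post_natural:
  assumes a: "cart a p p'"
  shows "vcomp (drop_post p') (hc a (cart_id (poly_ident C (Cod C (poly3 p))))) =
    vcomp a (drop_post p)"
proof -
  let ?I = "poly_ident C (Cod C (poly3 p))"
  have p: "poly p" "poly p'" using cartD[OF a] by auto
  have I: "cart (cart_id ?I) ?I ?I" using seq_unit(1)[OF p(1)] by (simp add: seq_def cart_id)
  note L = hc_cart[OF a I seq_unit(1)[OF p(1)]] drop_post_cart[OF p(2), unfolded cart_cod[OF a]]
  note R = drop_post_cart[OF p(1)] a
  show ?thesis
  proof (rule cart_eqI[OF cart_vcomp[OF L] cart_vcomp[OF R]])
    obtain c where c: "cell p c" and e: "post_unit p c = id_cell (then_unit p)"
      by (rule post_unit_surj[OF p(1) id_cell_cell[OF cartD(1)[OF R(1)]]])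
    note x = pair_cell(1)[OF matched_unit(1)[OF c]]
    have "act (vcomp (drop_post p') (hc a (cart_id ?I))) (post_unit p c) = act a c"
      using act_vcomp[OF L x] act_hc[OF a I matched_unit(1)[OF c]]
        act_id_unit[of "rgt p c"] boundary_type[OF c] act_cell[OF a c]
        drop_post(2)[OF p(2), of "act a c"] cart_cod[OF a] by simp
    also have "\<dots> = act (vcomp a (drop_post p)) (post_unit p c)"
      using act_vcomp[OF R x] drop_post(2)[OF p(1) c] by simp
    finally show "act (vcomp (drop_post p') (hc a (cart_id ?I))) (id_cell (then_unit p)) =
        act (vcomp a (drop_post p)) (id_cell (then_unit p))" by (simp only: e)
  qed
qed

lemma drop_pre_natural:
  assumes a: "cart a p p'"
  shows "vcomp (drop_pre p') (hc (cart_id (poly_ident C (Cod C (poly1 p)))) a) =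
    vcomp a (drop_pre p)"
proof -
  let ?I = "poly_ident C (Cod C (poly1 p))"
  have p: "poly p" "poly p'" using cartD[OF a] by auto
  have I: "cart (cart_id ?I) ?I ?I" using seq_unit(2)[OF p(1)] by (simp add: seq_def cart_id)
  note L = hc_cart[OF I a seq_unit(2)[OF p(1)]] drop_pre_cart[OF p(2), unfolded cart_cod[OF a]]
  note R = drop_pre_cart[OF p(1)] a
  show ?thesis
  proof (rule cart_eqI[OF cart_vcomp[OF L] cart_vcomp[OF R]])
    obtain c where c: "cell p c" and e: "pre_unit p c = id_cell (unit_then p)"
      by (rule pre_unit_surj[OF p(1) id_cell_cell[OF cartD(1)[OF R(1)]]])
    note x = pair_cell(1)[OF matched_unit(2)[OF c]]
    have "act (vcomp (drop_pre p') (hc (cart_id ?I) a)) (pre_unit p c) = act a c"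
      using act_vcomp[OF L x] act_hc[OF I a matched_unit(2)[OF c]]
        act_id_unit[of "lft p c"] boundary_type[OF c] act_cell[OF a c]
        drop_pre(2)[OF p(2), of "act a c"] cart_cod[OF a] by simp
    also have "\<dots> = act (vcomp a (drop_pre p)) (pre_unit p c)"
      using act_vcomp[OF R x] drop_pre(2)[OF p(1) c] by simp
    finally show "act (vcomp (drop_pre p') (hc (cart_id ?I) a)) (id_cell (unit_then p)) =
        act (vcomp a (drop_pre p)) (id_cell (unit_then p))" by (simp only: e)
  qed
qed

text \<open>Each cell into the source is a pairing of some \<open>c1\<close> with the pairing of a unit cell and some \<open>c\<close>, and both
sides turn it into the pairing of \<open>c1\<close> and \<open>c\<close>.\<close>

lemma unit_triangle:
  assumes s: "seq f g"
  defines "I \<equiv> poly_ident C (Cod C (poly3 f))"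
  shows "vcomp (hc (drop_post f) (cart_id g)) (assoc f I g) = hc (cart_id f) (drop_pre g)"
proof -
  have p: "poly f" "poly g" and fg: "Cod C (poly3 f) = Cod C (poly1 g)"
    using s by (auto simp: seq_def)
  have si: "seq f I" "seq I g" using seq_unit(1)[OF p(1)] seq_unit(2)[OF p(2)] fg by (simp_all add: I_def)
  note i = cart_id[OF p(1)] cart_id[OF p(2)]
  have post: "cart (drop_post f) (pcomp f I) f" using drop_post_cart[OF p(1)] by (simp add: I_def)
  have pre: "cart (drop_pre g) (pcomp I g) g" using drop_pre_cart[OF p(2)] by (simp add: I_def fg)
  note L = assoc_cart[OF si] hc_cart[OF post i(2) seq_pcomp(1)[OF si]]
  note R = hc_cart[OF i(1) pre seq_pcomp(2)[OF si]]
  show ?thesis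
  proof (rule cart_eq_on_pairs[OF seq_pcomp(2)[OF si] cart_vcomp[OF L] R])
    fix c1 d assume m: "matched f (pcomp I g) c1 d"
    have "cell (unit_then g) d" using matchedD(2)[OF m] by (simp add: I_def fg)
    then obtain c where c: "cell g c" "pre_unit g c = d" by (rule pre_unit_surj[OF p(2)])
    then have d: "d = pair I g (unit_cell (lft g c)) c" by (simp add: I_def fg)
    have n: "matched I g (unit_cell (lft g c)) c"
      using matched_unit(2)[OF c(1)] by (simp add: I_def fg)
    have e: "rgt f c1 = lft g c"
      using matchedD(3)[OF m] pair_cell(2)[OF n] unit_cell(2)[of "lft g c"] boundary_type[OF c(1)]
      by (simp add: d I_def fg)
    have m1: "matched f I c1 (unit_cell (lft g c))"
      using matched_unit(1)[OF matchedD(1)[OF m]] e by (simp add: I_def)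
    have m2: "act (drop_post f) (pair f I c1 (unit_cell (lft g c))) = c1"
      using drop_post(2)[OF p(1) matchedD(1)[OF m]] e by (simp add: I_def)
    have m3: "act (drop_pre g) d = c" using drop_pre(2)[OF p(2) c(1)] c(2) by simp
    have "act (vcomp (hc (drop_post f) (cart_id g)) (assoc f I g)) (pair f (pcomp I g) c1 d) =
        act (hc (drop_post f) (cart_id g)) (pair (pcomp f I) g (pair f I c1 (unit_cell (lft g c))) c)"
      using act_vcomp[OF L pair_cell(1)[OF m]] assoc(2)[OF si m1 n] by (simp add: d)
    also have "\<dots> = pair f g c1 c"
      using act_hc[OF post i(2) matched_pair_left[OF m1 n]] m2 c by simp
    also have "\<dots> = act (hc (cart_id f) (drop_pre g)) (pair f (pcomp I g) c1 d)"
      using act_hc[OF i(1) pre m] m3 matchedD(1)[OF m] by simp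
    finally show "act (vcomp (hc (drop_post f) (cart_id g)) (assoc f I g)) (pair f (pcomp I g) c1 d) =
        act (hc (cart_id f) (drop_pre g)) (pair f (pcomp I g) c1 d)" .
  qed
qed

end

section \<open>The bicategory of polynomials\<close>

context pb_category
begin

lemma is_polynomial_iff:
  "is_polynomial C X Y p \<longleftrightarrow> poly p \<and> Cod C (poly1 p) = X \<and> Cod C (poly3 p) = Y"
  by (auto simp: poly_def is_polynomial_def)

lemma Poly_simps [simp]:
  "Obj (Poly C X Y) = {p. is_polynomial C X Y p}"
  "Dom (Poly C X Y) = csrc" "Cod (Poly C X Y) = ctgt"
  "Comp (Poly C X Y) = vcomp" "Ident (Poly C X Y) = cart_id"
  by (simp_all add: Poly_def vcomp_def cart_id_def mor_of_def id_cell_def fun_eq_iff)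

lemma Poly_hom:
  "\<alpha> \<in> hom (Poly C X Y) p p' \<longleftrightarrow> is_polynomial C X Y p \<and> is_polynomial C X Y p' \<and> cart \<alpha> p p'"
proof -
  have "is_cart_mor C \<alpha> \<longleftrightarrow> cart \<alpha> p p'"
    if p: "poly p" "poly p'" and e: "csrc \<alpha> = p" "ctgt \<alpha> = p'"
  proof
    assume c: "cart \<alpha> p p'"
    show "is_cart_mor C \<alpha>"
      using cartD[OF c] polyD[OF p(1)] polyD[OF p(2)]
      by (simp add: is_cart_mor_def Let_def hom_def)
  next
    assume "is_cart_mor C \<alpha>"
    then show "cart \<alpha> p p'" using p e by (simp add: is_cart_mor_def Let_def cart_def cell_def)
  qed
  moreover have "csrc \<alpha> = p \<and> ctgt \<alpha> = p'" if "cart \<alpha> p p'" using cartD[OF that] by simp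
  ultimately show ?thesis
    unfolding hom_def Poly_simps by (auto simp: Poly_def is_polynomial_iff)
qed

lemma vcomp_id:
  assumes \<alpha>: "cart \<alpha> p p'"
  shows "vcomp \<alpha> (cart_id p) = \<alpha>" "vcomp (cart_id p') \<alpha> = \<alpha>"
proof -
  have p: "poly p" "poly p'" using cartD[OF \<alpha>] by auto
  note i = cart_id[OF p(1)] cart_id[OF p(2)] and c = id_cell_cell[OF p(1)]
  show "vcomp \<alpha> (cart_id p) = \<alpha>"
    by (rule cart_eqI[OF cart_vcomp[OF i(1) \<alpha>] \<alpha>]) (use act_vcomp[OF i(1) \<alpha> c] c in simp)
  show "vcomp (cart_id p') \<alpha> = \<alpha>"
    by (rule cart_eqI[OF cart_vcomp[OF \<alpha> i(2)] \<alpha>])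
      (use act_vcomp[OF \<alpha> i(2) c] act_cell(1)[OF \<alpha> c] in simp)
qed

lemma vcomp_assoc:
  assumes \<alpha>: "cart \<alpha> p q" and \<beta>: "cart \<beta> q r" and \<gamma>: "cart \<gamma> r s"
  shows "vcomp (vcomp \<gamma> \<beta>) \<alpha> = vcomp \<gamma> (vcomp \<beta> \<alpha>)"
  using cartD[OF \<alpha>] cartD[OF \<beta>] cartD[OF \<gamma>] by (simp add: vcomp_def)

lemma Poly_category: "category (Poly C X Y)"
proof
  show "Dom (Poly C X Y) f \<in> Obj (Poly C X Y)" "Cod (Poly C X Y) f \<in> Obj (Poly C X Y)"
    if "f \<in> Arr (Poly C X Y)" for f
    using that by (simp_all add: Poly_def)
  show "Ident (Poly C X Y) p \<in> hom (Poly C X Y) p p" if "p \<in> Obj (Poly C X Y)" for p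
    using that cart_id by (simp add: Poly_hom) (simp add: is_polynomial_iff)
  show "g \<cdot>\<^bsub>Poly C X Y\<^esub> f \<in> hom (Poly C X Y) p r"
    if "f \<in> hom (Poly C X Y) p q" "g \<in> hom (Poly C X Y) q r" for f g p q r
    using that cart_vcomp by (auto simp: Poly_hom)
  show "f \<cdot>\<^bsub>Poly C X Y\<^esub> Ident (Poly C X Y) p = f" "Ident (Poly C X Y) q \<cdot>\<^bsub>Poly C X Y\<^esub> f = f"
    if "f \<in> hom (Poly C X Y) p q" for f p q
    using that vcomp_id by (auto simp: Poly_hom)
  show "(h \<cdot>\<^bsub>Poly C X Y\<^esub> g) \<cdot>\<^bsub>Poly C X Y\<^esub> f = h \<cdot>\<^bsub>Poly C X Y\<^esub> (g \<cdot>\<^bsub>Poly C X Y\<^esub> f)"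
    if "f \<in> hom (Poly C X Y) p q" "g \<in> hom (Poly C X Y) q r" "h \<in> hom (Poly C X Y) r s"
    for f g h p q r s
    using that vcomp_assoc by (auto simp: Poly_hom)
qed

lemma Poly_iso:
  assumes "cart_iso \<alpha> p p'" "is_polynomial C X Y p" "is_polynomial C X Y p'"
  shows "is_iso (Poly C X Y) \<alpha>"
proof -
  obtain \<beta> where \<alpha>: "cart \<alpha> p p'"
    and \<beta>: "cart \<beta> p' p" "vcomp \<beta> \<alpha> = cart_id p" "vcomp \<alpha> \<beta> = cart_id p'"
    using assms(1) unfolding cart_iso_def by blast
  have h: "\<alpha> \<in> hom (Poly C X Y) p p'" "\<beta> \<in> hom (Poly C X Y) p' p"
    using assms \<alpha> \<beta> by (simp_all add: Poly_hom)
  then have "\<alpha> \<in> Arr (Poly C X Y)" "csrc \<alpha> = p" "ctgt \<alpha> = p'" by (simp_all add: hom_def)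
  then show ?thesis using h(2) \<beta>(2,3) unfolding is_iso_def by auto
qed

lemma poly_ident_polynomial: "X \<in> Obj C \<Longrightarrow> is_polynomial C X X (poly_ident C X)"
  using poly_ident_poly by (simp add: is_polynomial_iff)

end

lemma hom_prod_cat:
  "x \<in> hom (prod_cat A B) a b \<longleftrightarrow> fst x \<in> hom A (fst a) (fst b) \<and> snd x \<in> hom B (snd a) (snd b)"
  by (cases x; cases a; cases b) (auto simp: hom_def prod_cat_def)

lemma category_prod_cat:
  assumes "category A" "category B"
  shows "category (prod_cat A B)"
proof -
  interpret A: category A by fact
  interpret B: category B by fact
  show ?thesis
  proof
    show "g \<cdot>\<^bsub>prod_cat A B\<^esub> f \<in> hom (prod_cat A B) a c"
      if "f \<in> hom (prod_cat A B) a b" "g \<in> hom (prod_cat A B) b c" for f g a b c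
      using that A.comp_hom B.comp_hom unfolding hom_prod_cat
      by (cases f; cases g) (auto simp: prod_cat_def)
    show "Ident (prod_cat A B) a \<in> hom (prod_cat A B) a a" if "a \<in> Obj (prod_cat A B)" for a
      using that A.ident_hom B.ident_hom unfolding hom_prod_cat
      by (cases a) (auto simp: prod_cat_def)
    show "f \<cdot>\<^bsub>prod_cat A B\<^esub> Ident (prod_cat A B) a = f"
      if "f \<in> hom (prod_cat A B) a b" for f a b
      using that A.comp_ident B.comp_ident unfolding hom_prod_cat
      by (cases f; cases a; cases b) (auto simp: prod_cat_def)
    show "Ident (prod_cat A B) b \<cdot>\<^bsub>prod_cat A B\<^esub> f = f"
      if "f \<in> hom (prod_cat A B) a b" for f a b
      using that A.ident_comp B.ident_comp unfolding hom_prod_cat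
      by (cases f; cases a; cases b) (auto simp: prod_cat_def)
    show "(h \<cdot>\<^bsub>prod_cat A B\<^esub> g) \<cdot>\<^bsub>prod_cat A B\<^esub> f =
        h \<cdot>\<^bsub>prod_cat A B\<^esub> (g \<cdot>\<^bsub>prod_cat A B\<^esub> f)"
      if "f \<in> hom (prod_cat A B) a b" "g \<in> hom (prod_cat A B) b c" "h \<in> hom (prod_cat A B) c d"
      for f g h a b c d
      using that A.comp_assoc B.comp_assoc unfolding hom_prod_cat
      by (cases f; cases g; cases h) (auto simp: prod_cat_def)
  qed (auto simp: prod_cat_def)
qed

context poly_choice
begin

text \<open>The identity polynomial stands on the left of \<open>p\<close> in the left unitor, which means that it is applied after
\<open>p\<close>. For this reason the left unitor is \<open>drop_post\<close> and the right unitor is \<open>drop_pre\<close>.\<close>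

definition Poly_bicat :: "('o, 'm polynomial, 'm cart_mor) prebicat" where
  "Poly_bicat = \<lparr> Obj0 = Obj C, HomCat = Poly C, Unit = poly_ident C,
    HComp = (\<lambda>X Y Z. \<lparr> fob = \<lambda>(q, p). pcomp p q, far = \<lambda>(\<beta>, \<alpha>). hc \<alpha> \<beta> \<rparr>),
    Assoc = (\<lambda>W X Y Z r q p. assoc p q r),
    LUnit = (\<lambda>X Y p. drop_post p),
    RUnit = (\<lambda>X Y p. drop_pre p) \<rparr>"

lemma Poly_bicat_simps [simp]:
  "Obj0 Poly_bicat = Obj C" "HomCat Poly_bicat X Y = Poly C X Y" "Unit Poly_bicat X = poly_ident C X"
  "fob (HComp Poly_bicat X Y Z) (q, p) = pcomp p q" "far (HComp Poly_bicat X Y Z) (\<beta>, \<alpha>) = hc \<alpha> \<beta>"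
  "Assoc Poly_bicat W X Y Z r q p = assoc p q r" "LUnit Poly_bicat X Y p = drop_post p"
  "RUnit Poly_bicat X Y p = drop_pre p"
  by (simp_all add: Poly_bicat_def)

lemma polynomial_seq:
  assumes "is_polynomial C X Y p" "is_polynomial C Y Z q"
  shows "seq p q" "is_polynomial C X Z (pcomp p q)"
proof -
  show "seq p q" using assms by (simp add: is_polynomial_iff seq_def)
  then show "is_polynomial C X Z (pcomp p q)"
    using assms pcomp_poly by (simp add: is_polynomial_iff)
qed

lemma hcomp_functor:
  "cat_functor (prod_cat (Poly C Y Z) (Poly C X Y)) (Poly C X Z) (HComp Poly_bicat X Y Z)"
proof (intro cat_functor.intro category_prod_cat Poly_category cat_functor_axioms.intro)
  let ?P = "prod_cat (Poly C Y Z) (Poly C X Y)" and ?F = "HComp Poly_bicat X Y Z"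
  show "fob ?F a \<in> Obj (Poly C X Z)" if "a \<in> Obj ?P" for a
    using that polynomial_seq(2) by (cases a) (auto simp: prod_cat_def)
  show "far ?F f \<in> hom (Poly C X Z) (fob ?F a) (fob ?F b)" if "f \<in> hom ?P a b" for f a b
    using that polynomial_seq hc_cart
    by (cases f; cases a; cases b) (auto simp: hom_prod_cat Poly_hom)
  show "far ?F (Ident ?P a) = Ident (Poly C X Z) (fob ?F a)" if "a \<in> Obj ?P" for a
    using that polynomial_seq(1) hc_id by (cases a) (auto simp: prod_cat_def)
  show "far ?F (g \<cdot>\<^bsub>?P\<^esub> f) = far ?F g \<cdot>\<^bsub>Poly C X Z\<^esub> far ?F f"
    if f: "f \<in> hom ?P a b" and g: "g \<in> hom ?P b c" for f g a b c
  proof -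
    obtain f1 f2 g1 g2 where fg: "f = (f2, f1)" "g = (g2, g1)" by (cases f; cases g) blast
    have c: "cart f1 (snd a) (snd b)" "cart g1 (snd b) (snd c)" "cart f2 (fst a) (fst b)"
      "cart g2 (fst b) (fst c)" and s: "seq (snd a) (fst a)"
      using f g polynomial_seq(1) by (auto simp: fg hom_prod_cat Poly_hom)
    show ?thesis using hc_vcomp[OF c s] by (simp add: fg prod_cat_def)
  qed
qed

lemma Poly_assoc:
  assumes "is_polynomial C W X f" "is_polynomial C X Y g" "is_polynomial C Y Z h"
  shows "assoc f g h \<in> hom (Poly C W Z) (pcomp f (pcomp g h)) (pcomp (pcomp f g) h)"
    "is_iso (Poly C W Z) (assoc f g h)"
proof -
  note s = polynomial_seq[OF assms(1,2)] polynomial_seq[OF assms(2,3)]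
  note t = polynomial_seq(2)[OF assms(1) s(4)] polynomial_seq(2)[OF s(2) assms(3)]
  show "assoc f g h \<in> hom (Poly C W Z) (pcomp f (pcomp g h)) (pcomp (pcomp f g) h)"
    using assoc_cart[OF s(1,3)] t by (simp add: Poly_hom)
  show "is_iso (Poly C W Z) (assoc f g h)" by (rule Poly_iso[OF assoc(1)[OF s(1,3)] t])
qed

lemma Poly_unitors:
  assumes "is_polynomial C X Y p"
  shows "drop_post p \<in> hom (Poly C X Y) (pcomp p (poly_ident C Y)) p"
    "is_iso (Poly C X Y) (drop_post p)"
    "drop_pre p \<in> hom (Poly C X Y) (pcomp (poly_ident C X) p) p"
    "is_iso (Poly C X Y) (drop_pre p)"
proof -
  have p: "poly p" "Cod C (poly1 p) = X" "Cod C (poly3 p) = Y"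
    using assms by (auto simp: is_polynomial_iff)
  have XY: "X \<in> Obj C" "Y \<in> Obj C" using polyD(1,3)[OF p(1)] p(2,3) by auto
  note t = polynomial_seq(2)[OF assms poly_ident_polynomial[OF XY(2)]]
    polynomial_seq(2)[OF poly_ident_polynomial[OF XY(1)] assms]
  note d = drop_post(1)[OF p(1), unfolded p(2,3)] drop_pre(1)[OF p(1), unfolded p(2,3)]
  show "drop_post p \<in> hom (Poly C X Y) (pcomp p (poly_ident C Y)) p"
    "drop_pre p \<in> hom (Poly C X Y) (pcomp (poly_ident C X) p) p"
    using d[THEN cart_isoD] t assms by (simp_all add: Poly_hom)
  show "is_iso (Poly C X Y) (drop_post p)" "is_iso (Poly C X Y) (drop_pre p)"
    using Poly_iso[OF d(1) t(1) assms] Poly_iso[OF d(2) t(2) assms] by auto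
qed

lemma Poly_bicategory: "bicategory Poly_bicat"
proof (rule bicategory.intro, goal_cases)
  case 1
  then show ?case using Poly_category by simp
next
  case 2
  then show ?case using poly_ident_polynomial by simp
next
  case 3
  then show ?case using hcomp_functor by simp
next
  case 4
  then show ?case using Poly_assoc(1) by simp
next
  case 5
  then show ?case using Poly_assoc(2) by simp
next
  case (6 W X Y Z a f f' b g g' c h h')
  then have "is_polynomial C W X f" "is_polynomial C X Y g" "is_polynomial C Y Z h"
    and c: "cart a f f'" "cart b g g'" "cart c h h'" by (simp_all add: Poly_hom)
  then show ?case using assoc_natural[OF c] polynomial_seq(1) by simp
next
  case 7
  then show ?case using Poly_unitors(1) by simp
next
  case 8
  then show ?case using Poly_unitors(2) by simp
next
  case (9 X Y a f f')
  then show ?case using drop_post_natural[of a f f'] by (simp add: Poly_hom is_polynomial_iff)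
next
  case 10
  then show ?case using Poly_unitors(3) by simp
next
  case 11
  then show ?case using Poly_unitors(4) by simp
next
  case (12 X Y a f f')
  then show ?case using drop_pre_natural[of a f f'] by (simp add: Poly_hom is_polynomial_iff)
next
  case (13 V W X Y Z f g h k)
  then have "seq f g" "seq g h" "seq h k" using polynomial_seq(1) by auto
  then show ?case using assoc_pentagon[of f g h k] by simp
next
  case (14 X Y Z f g)
  then show ?case using unit_triangle[of f g] polynomial_seq(1)[of X Y f Z g]
    by (simp add: is_polynomial_iff)
qed

end

lemma (in pb_category) terminal_choice_exists: "\<exists>T. terminal_choice C T"
proof -
  have "\<exists>t. terminal (SdC C [p, q]) t" if c: "composable C [p, q]" for p q
  proof -
    have p: "poly p" "poly q" "Cod C (poly3 p) = Cod C (poly1 q)"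
      using c by (auto simp: composable_def poly_def)
    obtain c d where "universal_pair p q c d" using universal_pair_exists[OF p] by blast
    then show ?thesis
      using terminal_pair_iff[OF p(1,2)] by (auto simp: universal_pair_def)
  qed
  then have "terminal_choice C (\<lambda>ps. SOME t. terminal (SdC C ps) t)"
    unfolding terminal_choice_def by (blast intro: someI_ex)
  then show ?thesis by blast
qed

theorem theorem3p1p10:
  fixes E :: "('o, 'm) precat"
  assumes "category E" and "has_pullbacks E"
  shows "(\<exists>T. terminal_choice E T) \<and>
    (\<forall>T. terminal_choice E T \<longrightarrow>
      (\<exists>B :: ('o, 'm polynomial, 'm cart_mor) prebicat.
         bicategory B \<and>
         Obj0 B = Obj E \<and>
         (\<forall>X \<in> Obj E. \<forall>Y \<in> Obj E. HomCat B X Y = Poly E X Y) \<and>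
         (\<forall>X \<in> Obj E. Unit B X = poly_ident E X) \<and>
         (\<forall>X \<in> Obj E. \<forall>Y \<in> Obj E. \<forall>Z \<in> Obj E.
            (\<forall>p \<in> Obj (Poly E X Y). \<forall>q \<in> Obj (Poly E Y Z).
               fob (HComp B X Y Z) (q, p) = poly_comp E T [p, q]) \<and>
            (\<forall>f \<in> Arr (Poly E X Y). \<forall>g \<in> Arr (Poly E Y Z).
               far (HComp B X Y Z) (g, f) = cart_hcomp E T [f, g]))))"
proof -
  interpret E: pb_category E
    using assms by (simp add: pb_category_def pb_category_axioms_def)
  show ?thesis
  proof (intro conjI allI impI, goal_cases)
    case 1
    show ?case by (rule E.terminal_choice_exists)
  next
    case (2 T)
    then interpret poly_choice E T by unfold_locales
    show ?case by (intro exI[of _ Poly_bicat] conjI Poly_bicategory) simp_all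
  qed
qed

end
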